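(* Let $\boldsymbol{s}=\boldsymbol{s}_\Sigma$ be the mutation class associated with a once-punctured closed surface $\Sigma$ of genus $g\geq1$. Then any finite subgroup $G\subset\Gamma_{\boldsymbol{s}}$ of the cluster modular group has fixed points in $\mathcal{A}_{\boldsymbol{s}}(\mathbb{R}_{>0})$ and in $\mathcal{X}_{\boldsymbol{s}}(\mathbb{R}_{>0})$.
   Context: Seeds. Fix a finite set $I$, $n=|I|$, and positive integers $(d_i)_{i\in I}$. Let $\mathcal{F}_A,\mathcal{F}_X$ be fields isomorphic to the rational function field over $\mathbb{Q}$ in $n$ variables. A seed $\mathbf{i}=(\varepsilon,\mathbf{A},\mathbf{X})$ consists of an integer matrix $\varepsilon=(\varepsilon_{ij})_{i,j\in I}$ (exchange matrix) with $(\varepsilon_{ij}d_j)$ skew-symmetric, a tuple $\mathbf{A}=(A_i)_{i\in I}$ of free generators of the field $\mathcal{F}_A$ and a tuple $\mathbf{X}=(X_i)_{i\in I}$ of free generators of $\mathcal{F}_X$. With $[x]_+=\max\{x,0\}$, the mutation $\mu_k(\mathbf{i})=(\varepsilon',\mathbf{A}',\mathbf{X}')$, $k\in I$, is given by: $\varepsilon'_{ij}=-\varepsilon_{ij}$ if $i=k$ or $j=k$, and $\varepsilon'_{ij}=\varepsilon_{ij}+[\varepsilon_{ik}]_+[\varepsilon_{kj}]_+-[-\varepsilon_{ik}]_+[-\varepsilon_{kj}]_+$ otherwise; $A'_k=A_k^{-1}\big(\prod_j A_j^{[\varepsilon_{kj}]_+}+\prod_j A_j^{[-\varepsilon_{kj}]_+}\big)$,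 $A'_i=A_i$ for $i\ne k$; $X'_k=X_k^{-1}$, $X'_i=X_i(1+X_k^{-\mathrm{sgn}(\varepsilon_{ik})})^{-\varepsilon_{ik}}$ for $i\neq k$ (so $X_i'=X_i$ if $\varepsilon_{ik}=0$). Two seeds are mutation-equivalent if related by a sequence of mutations and simultaneous relabelings by permutations of $I$; an equivalence class $\boldsymbol{s}$ is a mutation class. Cluster manifolds. Write $\varepsilon^{\mathbf{i}},A_j^{\mathbf{i}},X_j^{\mathbf{i}}$ for the data of $\mathbf{i}\in\boldsymbol{s}$. $\mathcal{A}_{\boldsymbol{s}}(\mathbb{R}_{>0})$ is the real-analytic manifold with global charts $\psi_{\mathbf{i}}=(A_j^{\mathbf{i}})_{j}:\mathcal{A}_{\boldsymbol{s}}(\mathbb{R}_{>0})\xrightarrow{\sim}\mathbb{R}_{>0}^I$, $\mathbf{i}\in\boldsymbol{s}$, whose transition maps for $\mathbf{i}'=\mu_k(\mathbf{i})$ are given by $A_k^{\mathbf{i}'}=(A_k^{\mathbf{i}})^{-1}\big(\prod_j (A_j^{\mathbf{i}})^{[\varepsilon^{\mathbf{i}}_{kj}]_+}+\prod_j (A_j^{\mathbf{i}})^{[-\varepsilon^{\mathbf{i}}_{kj}]_+}\big)$, $A_i^{\mathbf{i}'}=A_i^{\mathbf{i}}$ for $i\ne k$ (and by permutations of coordinates for relabelings); $\mathcal{X}_{\boldsymbol{s}}(\mathbb{R}_{>0})$ is defined likewise with charts $(X_j^{\mathbf{i}})_j$ and the formulas $X_k^{\mathbf{i}'}=(X_k^{\mathbf{i}})^{-1}$,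 $X_i^{\mathbf{i}'}=X_i^{\mathbf{i}}(1+(X_k^{\mathbf{i}})^{-\mathrm{sgn}(\varepsilon^{\mathbf{i}}_{ik})})^{-\varepsilon^{\mathbf{i}}_{ik}}$ for $i\ne k$. Cluster modular group. $\Gamma_{\boldsymbol{s}}$ is the group of permutations $\phi$ of the set $\boldsymbol{s}$ of seeds that preserve exchange matrices ($\varepsilon^{\phi(\mathbf{i})}=\varepsilon^{\mathbf{i}}$) and commute with all mutations $\mu_k$ and all relabelings. It acts on $\mathcal{A}_{\boldsymbol{s}}(\mathbb{R}_{>0})$ by $A_j^{\mathbf{i}}(\phi(g))=A_j^{\phi^{-1}(\mathbf{i})}(g)$ and on $\mathcal{X}_{\boldsymbol{s}}(\mathbb{R}_{>0})$ by $X_j^{\mathbf{i}}(\phi(g))=X_j^{\phi^{-1}(\mathbf{i})}(g)$. A subgroup $G$ has a fixed point in a set if some point of it is fixed by every element of $G$. The mutation class $\boldsymbol{s}_\Sigma$ (Fomin–Shapiro–Thurston). Let $\Sigma$ be a closed oriented surface of genus $g\ge1$ with one puncture. An ideal triangulation $\triangle$ of $\Sigma$ is a maximal collection of pairwise non-isotopic, essential simple arcs based at the puncture with disjoint interiors; it has $n=6g-3$ arcs and cuts $\Sigma$ into triangles. Take $I$ to be the set of arcs of $\triangle$, all $d_i=1$, and $\varepsilon_{\alpha\beta}$ the number of corners of triangles of $\triangle$ at which $\beta$ immediately follows $\alpha$ in the clockwise order, minus the number of those at which $\alpha$ immediately follows $\beta$ in the clockwise order. $\boldsymbol{s}_\Sigma$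 is the mutation class of a seed with this exchange matrix; it does not depend on $\triangle$. *)

theory Defs
  imports
    "HOL-Complex_Analysis.Complex_Analysis"
    "HOL-Homology.Homology"
    "HOL-Combinatorics.Permutations"
begin

section \<open>Seeds and mutations\<close>

text \<open>The finite index set \<open>I\<close> is a finite type \<open>'i\<close>.  The ambient fields are types \<open>'a\<close>, \<open>'x\<close>
  of characteristic zero; that they are isomorphic to the rational function field in \<open>CARD('i)\<close>
  variables over the rationals is the existence of free generators indexed by \<open>'i\<close>.\<close>

record ('i, 'a, 'x) seed =
  exmat :: "'i \<Rightarrow> 'i \<Rightarrow> int"
  avar :: "'i \<Rightarrow> 'a"
  xvar :: "'i \<Rightarrow> 'x"

text \<open>Polynomials in the variables \<open>'i\<close> with rational coefficients are finitely supported functions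
  on exponent vectors.\<close>

definition poly_value :: "(('i::finite \<Rightarrow> nat) \<Rightarrow> rat) \<Rightarrow> ('i \<Rightarrow> 'f::field_char_0) \<Rightarrow> 'f" where
  "poly_value c Y = (\<Sum>m | c m \<noteq> 0. of_rat (c m) * (\<Prod>i\<in>UNIV. Y i ^ m i))"

definition algebraically_independent :: "('i::finite \<Rightarrow> 'f::field_char_0) \<Rightarrow> bool" where
  "algebraically_independent Y \<longleftrightarrow>
     (\<forall>c. finite {m. c m \<noteq> 0} \<longrightarrow> poly_value c Y = 0 \<longrightarrow> (\<forall>m. c m = 0))"

definition generates_field :: "('i::finite \<Rightarrow> 'f::field_char_0) \<Rightarrow> bool" where
  "generates_field Y \<longleftrightarrow>
     (\<forall>y. \<exists>c d. finite {m. c m \<noteq> 0} \<and> finite {m. d m \<noteq> 0} \<and>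
        poly_value d Y \<noteq> 0 \<and> y = poly_value c Y / poly_value d Y)"

definition free_generators :: "('i::finite \<Rightarrow> 'f::field_char_0) \<Rightarrow> bool" where
  "free_generators Y \<longleftrightarrow> algebraically_independent Y \<and> generates_field Y"

definition is_seed ::
    "('i \<Rightarrow> int) \<Rightarrow> ('i::finite, 'a::field_char_0, 'x::field_char_0) seed \<Rightarrow> bool" where
  "is_seed d S \<longleftrightarrow>
     (\<forall>i. d i > 0) \<and>
     (\<forall>i j. exmat S i j * d j = - (exmat S j i * d i)) \<and>
     free_generators (avar S) \<and> free_generators (xvar S)"

abbreviation pos_part :: "int \<Rightarrow> int" where
  "pos_part x \<equiv> max x 0"

definition mutate_matrix :: "'i \<Rightarrow> ('i \<Rightarrow> 'i \<Rightarrow> int) \<Rightarrow> 'i \<Rightarrow> 'i \<Rightarrow> int" where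
  "mutate_matrix k e = (\<lambda>i j.
     if i = k \<or> j = k then - e i j
     else e i j + pos_part (e i k) * pos_part (e k j) - pos_part (- e i k) * pos_part (- e k j))"

text \<open>The two transformations below are used both for the cluster variables in the ambient fields
  and for the positive real coordinates of the cluster manifolds.\<close>

definition mutate_A :: "'i \<Rightarrow> ('i::finite \<Rightarrow> 'i \<Rightarrow> int) \<Rightarrow> ('i \<Rightarrow> 'f::field) \<Rightarrow> 'i \<Rightarrow> 'f" where
  "mutate_A k e A = (\<lambda>i.
     if i = k then inverse (A k) *
       ((\<Prod>j\<in>UNIV. A j powi pos_part (e k j)) + (\<Prod>j\<in>UNIV. A j powi pos_part (- e k j)))
     else A i)"

definition mutate_X :: "'i \<Rightarrow> ('i \<Rightarrow> 'i \<Rightarrow> int) \<Rightarrow> ('i \<Rightarrow> 'f::field) \<Rightarrow> 'i \<Rightarrow> 'f" where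
  "mutate_X k e X = (\<lambda>i.
     if i = k then inverse (X k)
     else X i * (1 + X k powi (- sgn (e i k))) powi (- e i k))"

definition mutate ::
    "'i \<Rightarrow> ('i::finite, 'a::field, 'x::field) seed \<Rightarrow> ('i, 'a, 'x) seed" where
  "mutate k S = \<lparr>exmat = mutate_matrix k (exmat S),
                 avar = mutate_A k (exmat S) (avar S),
                 xvar = mutate_X k (exmat S) (xvar S)\<rparr>"

definition relabel :: "('i \<Rightarrow> 'i) \<Rightarrow> ('i, 'a, 'x) seed \<Rightarrow> ('i, 'a, 'x) seed" where
  "relabel \<sigma> S = \<lparr>exmat = (\<lambda>i j. exmat S (\<sigma> i) (\<sigma> j)), avar = avar S \<circ> \<sigma>, xvar = xvar S \<circ> \<sigma>\<rparr>"

definition seed_step ::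
    "('i::finite, 'a::field, 'x::field) seed \<Rightarrow> ('i, 'a, 'x) seed \<Rightarrow> bool" where
  "seed_step S S' \<longleftrightarrow> (\<exists>k. S' = mutate k S) \<or> (\<exists>\<sigma>. bij \<sigma> \<and> S' = relabel \<sigma> S)"

definition mutation_class ::
    "('i::finite, 'a::field, 'x::field) seed \<Rightarrow> ('i, 'a, 'x) seed set" where
  "mutation_class S = {S'. seed_step\<^sup>*\<^sup>* S S'}"

section \<open>Cluster manifolds and the cluster modular group\<close>

text \<open>A point of a cluster manifold is the family of its coordinate vectors in all charts, that is,
  a family of positive vectors indexed by the seeds of the class and compatible with all transition
  maps.  The chart of the seed \<open>S\<close> is evaluation at \<open>S\<close>.\<close>

definition A_manifold ::
    "('i::finite, 'a::field, 'x::field) seed set \<Rightarrow> (('i, 'a, 'x) seed \<Rightarrow> 'i \<Rightarrow> real) set" where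
  "A_manifold s = {p \<in> extensional s. \<forall>S\<in>s.
     (\<forall>j. p S j > 0) \<and>
     (\<forall>k. p (mutate k S) = mutate_A k (exmat S) (p S)) \<and>
     (\<forall>\<sigma>. bij \<sigma> \<longrightarrow> p (relabel \<sigma> S) = p S \<circ> \<sigma>)}"

definition X_manifold ::
    "('i::finite, 'a::field, 'x::field) seed set \<Rightarrow> (('i, 'a, 'x) seed \<Rightarrow> 'i \<Rightarrow> real) set" where
  "X_manifold s = {p \<in> extensional s. \<forall>S\<in>s.
     (\<forall>j. p S j > 0) \<and>
     (\<forall>k. p (mutate k S) = mutate_X k (exmat S) (p S)) \<and>
     (\<forall>\<sigma>. bij \<sigma> \<longrightarrow> p (relabel \<sigma> S) = p S \<circ> \<sigma>)}"

definition cluster_modular_group ::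
    "('i::finite, 'a::field, 'x::field) seed set \<Rightarrow>
     (('i, 'a, 'x) seed \<Rightarrow> ('i, 'a, 'x) seed) monoid" where
  "cluster_modular_group s =
     \<lparr>carrier = {\<phi>. \<phi> permutes s \<and> (\<forall>S\<in>s.
         exmat (\<phi> S) = exmat S \<and>
         (\<forall>k. \<phi> (mutate k S) = mutate k (\<phi> S)) \<and>
         (\<forall>\<sigma>. bij \<sigma> \<longrightarrow> \<phi> (relabel \<sigma> S) = relabel \<sigma> (\<phi> S)))},
      monoid.mult = (\<circ>), one = id\<rparr>"

definition cluster_action ::
    "(('i, 'a, 'x) seed \<Rightarrow> ('i, 'a, 'x) seed) \<Rightarrow>
     (('i, 'a, 'x) seed \<Rightarrow> 'i \<Rightarrow> real) \<Rightarrow> ('i, 'a, 'x) seed \<Rightarrow> 'i \<Rightarrow> real" where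
  "cluster_action \<phi> p = (\<lambda>S. p (inv_into UNIV \<phi> S))"

section \<open>Closed oriented surfaces\<close>

definition orientation_preserving_at :: "(complex \<Rightarrow> complex) \<Rightarrow> complex \<Rightarrow> bool" where
  "orientation_preserving_at h z \<longleftrightarrow>
     (\<forall>\<^sub>F r in at_right 0. winding_number (h \<circ> circlepath z r) (h z) = 1)"

definition surface_chart :: "'p topology \<Rightarrow> 'p set \<times> ('p \<Rightarrow> complex) \<Rightarrow> bool" where
  "surface_chart T = (\<lambda>(U, f). openin T U \<and> open (f ` U) \<and>
     homeomorphic_map (subtopology T U) (top_of_set (f ` U)) f)"

text \<open>An orientation is given by an atlas of charts with values in the (standardly oriented) complex
  plane all of whose coordinate changes preserve the orientation.\<close>

definition oriented_atlas :: "'p topology \<Rightarrow> ('p set \<times> ('p \<Rightarrow> complex)) set \<Rightarrow> bool" where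
  "oriented_atlas T \<A> \<longleftrightarrow>
     (\<forall>c\<in>\<A>. surface_chart T c) \<and> topspace T = (\<Union>(U, f)\<in>\<A>. U) \<and>
     (\<forall>(U, f)\<in>\<A>. \<forall>(V, h)\<in>\<A>. \<forall>x\<in>U \<inter> V.
        orientation_preserving_at (h \<circ> inv_into U f) (f x))"

definition closed_oriented_surface :: "'p topology \<Rightarrow> ('p set \<times> ('p \<Rightarrow> complex)) set \<Rightarrow> bool" where
  "closed_oriented_surface T \<A> \<longleftrightarrow>
     compact_space T \<and> connected_space T \<and> Hausdorff_space T \<and> oriented_atlas T \<A>"

definition has_genus :: "'p topology \<Rightarrow> nat \<Rightarrow> bool" where
  "has_genus T g \<longleftrightarrow> homology_group 1 T \<cong> free_Abelian_group {..<2 * g}"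

section \<open>Ideal triangulations of a once-punctured surface\<close>

text \<open>The punctured surface is the closed surface \<open>T\<close> with the marked point \<open>p\<close>.  An arc is the image
  of a loop at \<open>p\<close> without self-intersections other than the coincidence of its endpoints.\<close>

definition simple_loop_at :: "'p topology \<Rightarrow> 'p \<Rightarrow> (real \<Rightarrow> 'p) \<Rightarrow> bool" where
  "simple_loop_at T p \<gamma> \<longleftrightarrow> pathin T \<gamma> \<and> \<gamma> 0 = p \<and> \<gamma> 1 = p \<and> inj_on \<gamma> {0..<1}"

definition parametrizes_arc :: "'p topology \<Rightarrow> 'p \<Rightarrow> (real \<Rightarrow> 'p) \<Rightarrow> 'p set \<Rightarrow> bool" where
  "parametrizes_arc T p \<gamma> \<alpha> \<longleftrightarrow> simple_loop_at T p \<gamma> \<and> \<gamma> ` {0..1} = \<alpha>"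

text \<open>Essential: not contractible onto the puncture with endpoints fixed.  Isotopy of arcs takes place
  within the class of simple arcs at \<open>p\<close>; arcs are not directed, so any parametrizations may be
  used.\<close>

definition essential_arc :: "'p topology \<Rightarrow> 'p \<Rightarrow> 'p set \<Rightarrow> bool" where
  "essential_arc T p \<alpha> \<longleftrightarrow> (\<exists>\<gamma>. parametrizes_arc T p \<gamma> \<alpha> \<and>
     \<not> homotopic_with (\<lambda>h. h 0 = p \<and> h 1 = p) (top_of_set {0..1}) T \<gamma> (\<lambda>_. p))"

definition isotopic_arcs :: "'p topology \<Rightarrow> 'p \<Rightarrow> 'p set \<Rightarrow> 'p set \<Rightarrow> bool" where
  "isotopic_arcs T p \<alpha> \<beta> \<longleftrightarrow> (\<exists>\<gamma> \<delta>. parametrizes_arc T p \<gamma> \<alpha> \<and> parametrizes_arc T p \<delta> \<beta> \<and>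
     homotopic_with (simple_loop_at T p) (top_of_set {0..1}) T \<gamma> \<delta>)"

definition arc_system :: "'p topology \<Rightarrow> 'p \<Rightarrow> 'p set set \<Rightarrow> bool" where
  "arc_system T p D \<longleftrightarrow> (\<forall>\<alpha>\<in>D. essential_arc T p \<alpha>) \<and>
     pairwise (\<lambda>\<alpha> \<beta>. \<alpha> \<inter> \<beta> = {p} \<and> \<not> isotopic_arcs T p \<alpha> \<beta>) D"

definition ideal_triangulation :: "'p topology \<Rightarrow> 'p \<Rightarrow> 'p set set \<Rightarrow> bool" where
  "ideal_triangulation T p D \<longleftrightarrow> arc_system T p D \<and>
     (\<forall>D'. arc_system T p D' \<longrightarrow> D \<subseteq> D' \<longrightarrow> D' = D)"

text \<open>The model triangle has the cube roots of unity as vertices; vertices and sides are numbered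
  counterclockwise, modulo 3.\<close>

definition tri_vertex :: "nat \<Rightarrow> complex" where
  "tri_vertex k = cis (2 * pi * real k / 3)"

definition model_triangle :: "complex set" where
  "model_triangle = convex hull {tri_vertex 0, tri_vertex 1, tri_vertex 2}"

definition tri_side :: "nat \<Rightarrow> real \<Rightarrow> complex" where
  "tri_side k = linepath (tri_vertex k) (tri_vertex (k + 1))"

definition triangles :: "'p topology \<Rightarrow> 'p set set \<Rightarrow> 'p set set" where
  "triangles T D = connected_components_of (subtopology T (topspace T - \<Union>D))"

text \<open>The images of the sides of the triangle \<open>C\<close>, with \<open>\<tau> C\<close> the map from the model triangle to the
  closure of \<open>C\<close>.\<close>

definition side_arc :: "('p set \<Rightarrow> complex \<Rightarrow> 'p) \<Rightarrow> 'p set \<Rightarrow> nat \<Rightarrow> 'p set" where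
  "side_arc \<tau> C k = (\<tau> C \<circ> tri_side k) ` {0..1}"

text \<open>The arcs of \<open>D\<close> cut the surface into triangles, via the orientation-preserving maps \<open>\<tau> C\<close>:
  each complementary component \<open>C\<close> is the interior of a triangle whose sides run along arcs of \<open>D\<close>,
  and the surface is recovered from the disjoint union of the triangles by gluing their sides in
  pairs, one pair for each arc, reversing the boundary orientation.  The affine form of the gluing is
  only a normalization of the maps \<open>\<tau> C\<close> on the sides.  Two sides of one triangle may be
  glued to each other, or two triangles may share several arcs.\<close>

definition cuts_into_triangles ::
    "'p topology \<Rightarrow> ('p set \<times> ('p \<Rightarrow> complex)) set \<Rightarrow> 'p \<Rightarrow> 'p set set \<Rightarrow>
     ('p set \<Rightarrow> complex \<Rightarrow> 'p) \<Rightarrow> bool" where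
  "cuts_into_triangles T \<A> p D \<tau> \<longleftrightarrow>
     (\<forall>C\<in>triangles T D.
        continuous_map (top_of_set model_triangle) T (\<tau> C) \<and>
        bij_betw (\<tau> C) (interior model_triangle) C \<and>
        (\<forall>z\<in>interior model_triangle. \<forall>(U, f)\<in>\<A>. \<tau> C z \<in> U \<longrightarrow>
           orientation_preserving_at (f \<circ> \<tau> C) z) \<and>
        (\<forall>k<3. side_arc \<tau> C k \<in> D \<and> simple_loop_at T p (\<tau> C \<circ> tri_side k))) \<and>
     (\<forall>\<alpha>\<in>D. card {(C, k). C \<in> triangles T D \<and> k < 3 \<and> side_arc \<tau> C k = \<alpha>} = 2) \<and>
     (\<forall>C\<in>triangles T D. \<forall>C'\<in>triangles T D. \<forall>k<3. \<forall>k'<3.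
        (C, k) \<noteq> (C', k') \<longrightarrow> side_arc \<tau> C k = side_arc \<tau> C' k' \<longrightarrow>
        (\<forall>t\<in>{0..1}. \<tau> C (tri_side k t) = \<tau> C' (tri_side k' (1 - t))))"

text \<open>At the corner of a triangle at the common vertex of the sides \<open>k\<close> and \<open>k + 1\<close>, rotating clockwise
  about the vertex through the triangle leads from side \<open>k\<close> to side \<open>k + 1\<close>.  So this counts
  the corners at which \<open>\<beta>\<close> immediately follows \<open>\<alpha>\<close> in the clockwise order.\<close>

definition clockwise_corners ::
    "'p topology \<Rightarrow> 'p set set \<Rightarrow> ('p set \<Rightarrow> complex \<Rightarrow> 'p) \<Rightarrow> 'p set \<Rightarrow> 'p set \<Rightarrow> nat" where
  "clockwise_corners T D \<tau> \<alpha> \<beta> =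
     card {(C, k). C \<in> triangles T D \<and> k < 3 \<and>
                   side_arc \<tau> C k = \<alpha> \<and> side_arc \<tau> C ((k + 1) mod 3) = \<beta>}"

definition triangulation_matrix ::
    "'p topology \<Rightarrow> 'p set set \<Rightarrow> ('p set \<Rightarrow> complex \<Rightarrow> 'p) \<Rightarrow> 'p set \<Rightarrow> 'p set \<Rightarrow> int" where
  "triangulation_matrix T D \<tau> \<alpha> \<beta> =
     int (clockwise_corners T D \<tau> \<alpha> \<beta>) - int (clockwise_corners T D \<tau> \<beta> \<alpha>)"

end

theory Submission
  imports Defs
begin

text \<open>
  A finite group that preserves a proper, strictly convex function fixes the point where the minimum
  is attained. So it suffices to find such a function on the \<open>A\<close>-manifold for every finite group
  \<open>G\<close>; this is the convexity argument for Nielsen realization, carried out in lambda lengths.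

  The logarithms of the coordinates of the initial seed \<open>S0\<close> identify the \<open>A\<close>-manifold with a Euclidean
  space (\<open>A_manifold_point_exists\<close>, \<open>A_manifold_point_unique\<close>). In these coordinates every cluster
  coordinate of every seed is a finite sum of exponentials of linear forms
  (\<open>cluster_coordinate_exp_sum\<close>), hence convex. The function is
  \<open>H p + (\<Sum>\<phi>\<in>G. \<Sum>j. p (\<phi> S0) j)\<close>, where \<open>H\<close> is the length of the horocycle at the puncture,
  summed over all triangulations with the given exchange matrix. Its second summand is
  \<open>G\<close>-invariant because it runs over an orbit, and strictly convex because \<open>\<phi> = id\<close> contributes the
  coordinates themselves; it bounds the coordinates from above. The horocycle length is invariant
  under all mutations (\<open>total_horocycle_invariant\<close>), is again a sum of exponentials, and bounds the
  coordinates from below (\<open>total_horocycle_ge\<close>), so the sum is proper.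

  Seeds are handled through gluings of triangles: permutations \<open>\<sigma>\<close> of the sides of the arcs, sending
  each side of a triangle to the next one. A mutation is a flip of the gluing as long as the arcs
  around a diagonal do not cancel in the exchange matrix, and they cannot cancel because all vertices
  of the triangles are the same point and more than two darts leave it. That the corners of the
  triangles form a single cycle is where the topology enters: otherwise the sectors of the triangles
  at the puncture would disconnect a punctured disc (\<open>sides_around_puncture\<close>).

  Positivity comes from the universal cover. Developing the initial triangulation into the plane
  assigns a vector to every vertex of the lifted triangulation, in such a way that lambda lengths are
  determinants. Walking away from a vertex through the lifted triangles, one keeps expressing
  its vector as a positive combination of the two vectors of the current edge, with sums of exponentials
  as coefficients (\<open>outward_positive_span\<close>). Hence the determinant of any two vertices is a sum of
  exponentials up to sign, and a flip replaces a lifted edge by another pair of vertices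
  (\<open>development_flip\<close>).

  Finally the monomials \<open>\<Prod>j. A j powi \<epsilon> i j\<close> map the \<open>A\<close>-manifold to the \<open>X\<close>-manifold, compatibly with
  mutations (\<open>monomials_mutate\<close>), and so map fixed points to fixed points.
\<close>

section \<open>Gluings of triangles\<close>

text \<open>The two sides of the arc \<open>i\<close> are the darts \<open>(i, True)\<close> and \<open>(i, False)\<close>. A dart is directed
  so that the triangle that it bounds lies on its left.\<close>

type_synonym 'i dart = "'i \<times> bool"

definition opp :: "'i dart \<Rightarrow> 'i dart" where
  "opp e = (fst e, \<not> snd e)"

lemma opp_opp [simp]: "opp (opp e) = e"
  and fst_opp [simp]: "fst (opp e) = fst e"
  and opp_neq [simp]: "opp e \<noteq> e" "e \<noteq> opp e"
  by (auto simp: opp_def prod_eq_iff)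

lemma fst_eq_dart_iff: "fst e = fst e' \<longleftrightarrow> e = e' \<or> e = opp e'"
  by (auto simp: opp_def prod_eq_iff)

lemma opp_eq_iff: "opp e = e' \<longleftrightarrow> e = opp e'"
  by auto

text \<open>The permutation \<open>\<sigma>\<close> rotates the sides of each triangle counterclockwise. The dart \<open>\<sigma> (opp e)\<close>
  leaves the same vertex as \<open>e\<close> and is the next one around it, so the last assumption says
  that all darts leave one vertex. It is stated through invariant sets because these are
  easily carried through a flip.\<close>

locale gluing =
  fixes \<sigma> :: "'i::finite dart \<Rightarrow> 'i dart"
  assumes cube: "\<sigma> (\<sigma> (\<sigma> e)) = e"
    and no_fix: "\<sigma> e \<noteq> e"
    and one_vertex: "(\<And>e. e \<in> X \<Longrightarrow> \<sigma> (opp e) \<in> X) \<Longrightarrow> X = {} \<or> X = UNIV"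

definition dart_matrix :: "('i::finite dart \<Rightarrow> 'i dart) \<Rightarrow> 'i \<Rightarrow> 'i \<Rightarrow> int" where
  "dart_matrix \<sigma> i j =
     (\<Sum>e\<in>UNIV. of_bool (fst e = i \<and> fst (\<sigma> e) = j) - of_bool (fst e = j \<and> fst (\<sigma> e) = i))"

text \<open>If \<open>k\<close> is a diagonal of the quadrilateral with sides \<open>a\<close>, \<open>b\<close>, \<open>c\<close>, \<open>d\<close>, where \<open>(\<kappa>, a, b)\<close>
  and \<open>(opp \<kappa>, c, d)\<close> are the adjacent triangles, the new triangles are \<open>(\<kappa>, b, c)\<close> and \<open>(opp
  \<kappa>, d, a)\<close>. The four clauses apply to the darts of \<open>k\<close>, to \<open>b\<close> and \<open>d\<close>, to \<open>a\<close> and \<open>c\<close>, and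
  to the other triangles. This form is symmetric in the two darts of \<open>k\<close>.\<close>

definition flip :: "'i \<Rightarrow> ('i dart \<Rightarrow> 'i dart) \<Rightarrow> 'i dart \<Rightarrow> 'i dart" where
  "flip k \<sigma> e =
     (if fst e = k then \<sigma> (\<sigma> e)
      else if fst (\<sigma> e) = k then \<sigma> (opp (\<sigma> e))
      else if fst (\<sigma> (\<sigma> e)) = k then opp (\<sigma> (\<sigma> e))
      else \<sigma> e)"

text \<open>In a decorated ideal triangle with lambda lengths \<open>x\<close>, \<open>y\<close>, \<open>z\<close>, the horocycle at the vertex
  opposite to \<open>x\<close> has an arc of length \<open>x / (y * z)\<close> inside the triangle. The sum over all
  corners is the length of the whole horocycle at the puncture.\<close>

definition horocycle :: "('i::finite dart \<Rightarrow> 'i dart) \<Rightarrow> ('i \<Rightarrow> real) \<Rightarrow> real" where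
  "horocycle \<sigma> l = (\<Sum>e\<in>UNIV. l (fst e) / (l (fst (\<sigma> e)) * l (fst (\<sigma> (\<sigma> e)))))"

lemma dart_matrix_skew: "dart_matrix \<sigma> j i = - dart_matrix \<sigma> i j"
  unfolding dart_matrix_def by (simp add: sum_negf[symmetric] del: sum_subtractf)

lemma mutate_matrix_involutive: "mutate_matrix k (mutate_matrix k e) = e"
  by (auto simp: mutate_matrix_def fun_eq_iff)

context gluing
begin

lemma sigma_inj: "\<sigma> x = \<sigma> y \<longleftrightarrow> x = y"
  by (metis cube)

text \<open>A vertex with one dart would be the only vertex, while a triangle already has three darts;
  the same holds for two darts. These two facts exclude self-folded triangles and cancellation
  in the exchange matrix.\<close>

lemma valence_gt_1: "\<sigma> (opp e) \<noteq> e"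
proof
  assume "\<sigma> (opp e) = e"
  then have "{e} = UNIV" using one_vertex[of "{e}"] by auto
  then show False using no_fix[of e] by (metis UNIV_I singletonD)
qed

lemma valence_gt_2: "\<sigma> (opp (\<sigma> (opp e))) \<noteq> e"
proof
  assume "\<sigma> (opp (\<sigma> (opp e))) = e"
  then have "\<sigma> (opp x) \<in> {e, \<sigma> (opp e)}" if "x \<in> {e, \<sigma> (opp e)}" for x
    using that by auto
  from one_vertex[OF this] have U: "{e, \<sigma> (opp e)} = UNIV" by simp
  have "\<sigma> (\<sigma> e) \<noteq> e" "\<sigma> (\<sigma> e) \<noteq> \<sigma> e" using no_fix cube by metis+
  with U no_fix[of e] show False by (metis UNIV_I insert_iff singletonD)
qed

end

lemma sum_six:
  fixes g :: "'b::finite \<Rightarrow> 'c::comm_monoid_add"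
  assumes "distinct [u, v, w, x, y, z]"
  shows "(\<Sum>e\<in>UNIV. g e) = g u + g v + g w + g x + g y + g z + (\<Sum>e\<in>-{u, v, w, x, y, z}. g e)"
proof -
  have "(\<Sum>e\<in>UNIV. g e) = (\<Sum>e\<in>{u, v, w, x, y, z}. g e) + (\<Sum>e\<in>-{u, v, w, x, y, z}. g e)"
    by (subst sum.union_disjoint[symmetric]) (auto simp: Compl_partition)
  then show ?thesis using assms by (simp add: add.assoc)
qed

section \<open>Flips\<close>

lemma corner_sum_triangle: "u / (v * w) + v / (w * u) + w / (u * v) = (u * u + v * v + w * w) / (u * (v * w))"
    if "u > 0" "v > 0" "w > 0" for u v w :: real
    using that by (simp add: divide_simps)
text \<open>The lambda lengths \<open>y\<close>, \<open>y'\<close> of the two diagonals enter the right-hand side symmetrically,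
  up to a rotation of the sides; this is why the horocycle length survives a flip.\<close>

lemma corner_sum_quadrilateral: "y / (P * Q) + P / (Q * y) + Q / (y * P) + (y / (R * S) + R / (S * y) + S / (y * R))
      = (y * (P * Q + R * S) + y' * (P * S + Q * R)) / (P * Q * R * S)"
    if p: "y > 0" "P > 0" "Q > 0" "R > 0" "S > 0" and pt: "y * y' = P * R + Q * S"
    for y P Q R S y' :: real
proof -
    have "y / (P * Q) + P / (Q * y) + Q / (y * P) + (y / (R * S) + R / (S * y) + S / (y * R))
      = ((y * y + P * P + Q * Q) * (R * S) + (y * y + R * R + S * S) * (P * Q)) / (y * (P * Q * R * S))"
    proof -
      have "U / (y * (P * Q)) + V / (y * (R * S)) = (U * (R * S) + V * (P * Q)) / (y * (P * Q * R * S))" for U V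
        using p by (simp add: divide_simps)
      then show ?thesis
      unfolding corner_sum_triangle[OF p(1-3)] corner_sum_triangle[OF p(1,4,5)] .
    qed
    also have "(y * y + P * P + Q * Q) * (R * S) + (y * y + R * R + S * S) * (P * Q)
      = y * (y * (P * Q + R * S)) + (P * R + Q * S) * (P * S + Q * R)"
      by (simp add: algebra_simps)
    also have "\<dots> = y * (y * (P * Q + R * S) + y' * (P * S + Q * R))"
      unfolding pt[symmetric] by (simp add: algebra_simps)
    finally show ?thesis using p by simp
qed

locale flip_site = gluing \<sigma> for \<sigma> :: "'i::finite dart \<Rightarrow> 'i dart" +
  fixes k :: 'i and \<kappa> a b c d
  assumes k: "fst \<kappa> = k"
    and next_\<kappa>: "\<sigma> \<kappa> = a" and next_a: "\<sigma> a = b"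
    and next_\<kappa>': "\<sigma> (opp \<kappa>) = c" and next_c: "\<sigma> c = d"
begin

lemma next_b: "\<sigma> b = \<kappa>" and next_d: "\<sigma> d = opp \<kappa>"
  using next_\<kappa> next_a next_\<kappa>' next_c cube by metis+

lemmas next_simps = next_\<kappa> next_a next_b next_\<kappa>' next_c next_d

text \<open>Here \<open>a = opp b\<close> and \<open>c = opp d\<close> would produce a vertex with one dart, \<open>a = opp d\<close> and \<open>c =
  opp b\<close> a vertex with two. So an arc never occurs both on a side of the quadrilateral and on
  a neighbouring one, and its contributions to the row of \<open>k\<close> do not cancel.\<close>

lemma distinct_site: "distinct [\<kappa>, a, b, opp \<kappa>, c, d]"
  and fst_site: "fst a \<noteq> k" "fst b \<noteq> k" "fst c \<noteq> k" "fst d \<noteq> k"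
  and no_cancel: "fst a \<noteq> fst b" "fst a \<noteq> fst d" "fst c \<noteq> fst b" "fst c \<noteq> fst d"
proof -
  have n1: "a \<noteq> \<kappa>" "b \<noteq> a" "b \<noteq> \<kappa>" "c \<noteq> opp \<kappa>" "d \<noteq> c" "d \<noteq> opp \<kappa>"
    using next_simps no_fix by metis+
  have n2: "a \<noteq> opp \<kappa>" "b \<noteq> opp \<kappa>" "c \<noteq> \<kappa>" "d \<noteq> \<kappa>"
    using next_simps valence_gt_1 opp_opp by metis+
  have n3: "a \<noteq> c" "a \<noteq> d" "b \<noteq> c" "b \<noteq> d"
    using sigma_inj[of a c] sigma_inj[of a d] sigma_inj[of b c] sigma_inj[of b d]
      sigma_inj[of \<kappa> "opp \<kappa>"] n2 by (auto simp: next_simps)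
  have n4: "a \<noteq> opp b" "a \<noteq> opp d" "c \<noteq> opp b" "c \<noteq> opp d"
    using valence_gt_1[of b] valence_gt_2[of "opp \<kappa>"] valence_gt_2[of \<kappa>] valence_gt_1[of d] next_simps
    by (metis opp_opp)+
  show "distinct [\<kappa>, a, b, opp \<kappa>, c, d]" using n1 n2 n3 by auto
  show "fst a \<noteq> k" "fst b \<noteq> k" "fst c \<noteq> k" "fst d \<noteq> k"
    using n1 n2 by (auto simp: fst_eq_dart_iff k[symmetric])
  show "fst a \<noteq> fst b" "fst a \<noteq> fst d" "fst c \<noteq> fst b" "fst c \<noteq> fst d"
    using n1 n3 n4 by (auto simp: fst_eq_dart_iff)
qed

abbreviation site where "site \<equiv> {\<kappa>, a, b, opp \<kappa>, c, d}"

lemma next_notin_site: "e \<notin> site \<Longrightarrow> \<sigma> e \<notin> site"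
  using sigma_inj[of e \<kappa>] sigma_inj[of e a] sigma_inj[of e b]
    sigma_inj[of e "opp \<kappa>"] sigma_inj[of e c] sigma_inj[of e d]
  by (auto simp: next_simps)

lemma fst_notin_site: "e \<notin> site \<Longrightarrow> fst e \<noteq> k"
  by (auto simp: fst_eq_dart_iff k[symmetric])

lemma flip_site_simps:
  "flip k \<sigma> b = c" "flip k \<sigma> c = \<kappa>" "flip k \<sigma> \<kappa> = b"
  "flip k \<sigma> d = a" "flip k \<sigma> a = opp \<kappa>" "flip k \<sigma> (opp \<kappa>) = d"
  by (simp_all add: flip_def next_simps fst_site k)

lemma flip_notin_site: "e \<notin> site \<Longrightarrow> flip k \<sigma> e = \<sigma> e"
  by (meson flip_def fst_notin_site next_notin_site)

lemma gluing_flip: "gluing (flip k \<sigma>)"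
proof
  fix e
  show "flip k \<sigma> (flip k \<sigma> (flip k \<sigma> e)) = e"
  proof (cases "e \<in> site")
    case True
    then show ?thesis using flip_site_simps by auto
  next
    case False
    then show ?thesis by (simp only: flip_notin_site next_notin_site not_False_eq_True cube)
  qed
  show "flip k \<sigma> e \<noteq> e"
  proof (cases "e \<in> site")
    case True
    then show ?thesis using flip_site_simps distinct_site by auto
  next
    case False
    then show ?thesis using flip_notin_site no_fix by simp
  qed
next
  fix X' assume X': "\<And>e. e \<in> X' \<Longrightarrow> flip k \<sigma> (opp e) \<in> X'"
  \<comment> \<open>The darts of \<open>k\<close> change their origins. In the old gluing, \<open>\<kappa>\<close> leaves the same vertex as \<open>opp
    b\<close>, and \<open>opp \<kappa>\<close> the same vertex as \<open>opp d\<close>.\<close>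
  define X where "X = (X' - {\<kappa>, opp \<kappa>}) \<union> {e. e = \<kappa> \<and> opp b \<in> X'} \<union> {e. e = opp \<kappa> \<and> opp d \<in> X'}"
  have opps: "opp b \<noteq> \<kappa>" "opp b \<noteq> opp \<kappa>" "opp d \<noteq> \<kappa>" "opp d \<noteq> opp \<kappa>" "b \<noteq> \<kappa>" "d \<noteq> \<kappa>"
     "a \<noteq> \<kappa>" "c \<noteq> \<kappa>" "b \<noteq> opp \<kappa>" "d \<noteq> opp \<kappa>" "a \<noteq> opp \<kappa>" "c \<noteq> opp \<kappa>"
    using distinct_site fst_site k by (auto simp: opp_eq_iff)
  have b: "c \<in> X'" if "opp b \<in> X'" using X'[OF that] flip_site_simps by simp
  have d: "a \<in> X'" if "opp d \<in> X'" using X'[OF that] flip_site_simps by simp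
  have \<kappa>: "d \<in> X'" if "\<kappa> \<in> X'" using X'[OF that] flip_site_simps by simp
  have \<kappa>': "b \<in> X'" if "opp \<kappa> \<in> X'" using X'[OF that] flip_site_simps by simp
  have c: "d \<in> X'" "\<kappa> \<in> X'" if "opp c \<in> X'" using X'[OF that] flip_site_simps \<kappa> by simp_all
  have a: "b \<in> X'" "opp \<kappa> \<in> X'" if "opp a \<in> X'" using X'[OF that] flip_site_simps \<kappa>' by simp_all
  have "X = {} \<or> X = UNIV"
  proof (rule one_vertex)
    fix e assume e: "e \<in> X"
    consider "e = \<kappa>" | "e = opp \<kappa>" | "opp e = b" | "opp e = d" | "opp e = a" | "opp e = c"
      | "opp e \<notin> site" by (auto simp: opp_eq_iff)
    then show "\<sigma> (opp e) \<in> X"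
    proof cases
      case 1
      then have "opp b \<in> X'" using e by (auto simp: X_def next_simps)
      then show ?thesis using b 1 opps by (auto simp: X_def next_simps)
    next
      case 2
      then have "opp d \<in> X'" using e by (auto simp: X_def next_simps)
      then show ?thesis using d 2 opps by (auto simp: X_def next_simps)
    next
      case 3
      then have "e = opp b" by auto
      then show ?thesis using e opps by (auto simp: X_def next_simps)
    next
      case 4
      then have "e = opp d" by auto
      then show ?thesis using e opps by (auto simp: X_def next_simps)
    next
      case 5
      then have "e = opp a" by auto
      then show ?thesis using e opps a by (auto simp: X_def opp_eq_iff next_simps)
    next
      case 6
      then have "e = opp c" by auto
      then show ?thesis using e opps c by (auto simp: X_def opp_eq_iff next_simps)
    next
      case 7
      then have "e \<noteq> \<kappa>" "e \<noteq> opp \<kappa>" by auto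
      with e have "e \<in> X'" by (auto simp: X_def next_simps)
      then have "\<sigma> (opp e) \<in> X'" using X' flip_notin_site[OF 7] by metis
      then show ?thesis using next_notin_site[OF 7] by (auto simp: X_def next_simps)
    qed
  qed
  then show "X' = {} \<or> X' = UNIV"
  proof
    assume "X = {}"
    then have "X' \<subseteq> {\<kappa>, opp \<kappa>}" "d \<notin> X'" "b \<notin> X'" using opps by (auto simp: X_def next_simps)
    then show ?thesis using \<kappa> \<kappa>' by auto
  next
    assume "X = UNIV"
    then have "x \<in> X'" if "x \<noteq> \<kappa>" "x \<noteq> opp \<kappa>" for x
      using that by (auto simp: X_def next_simps)
    moreover from this have "opp a \<in> X'" "opp c \<in> X'"
      using opps by (auto simp: opp_eq_iff)
    ultimately have "x \<in> X'" for x
      using a c by (cases "x = \<kappa> \<or> x = opp \<kappa>") auto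
    then show ?thesis by auto
  qed
qed

lemma dart_matrix_row: "dart_matrix \<sigma> k j
    = of_bool (fst a = j) + of_bool (fst c = j) - of_bool (fst b = j) - of_bool (fst d = j)"
proof -
  have "(\<Sum>e\<in>-site. of_bool (fst e = k \<and> fst (\<sigma> e) = j) - of_bool (fst e = j \<and> fst (\<sigma> e) = k)) = (0::int)"
    by (rule sum.neutral) (use fst_notin_site next_notin_site in auto)
  then show ?thesis
    unfolding dart_matrix_def sum_six[OF distinct_site]
    using fst_site by (cases "j = k") (simp_all add: k next_simps)
qed

lemma pos_part_row:
  "pos_part (dart_matrix \<sigma> k j) = of_bool (fst a = j) + of_bool (fst c = j)"
  "pos_part (- dart_matrix \<sigma> k j) = of_bool (fst b = j) + of_bool (fst d = j)"
  unfolding dart_matrix_row using no_cancel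
  by (cases "fst a = j"; cases "fst b = j"; cases "fst c = j"; cases "fst d = j"; simp)+

text \<open>Flipping rotates the names of the sides, so that statements about a site also apply after
  the flip.\<close>

lemma flipped_site: "flip_site (flip k \<sigma>) k \<kappa> b c d a"
  by (intro flip_site.intro flip_site_axioms.intro gluing_flip k flip_site_simps)

lemma dart_matrix_flip: "dart_matrix (flip k \<sigma>) = mutate_matrix k (dart_matrix \<sigma>)"
proof (rule ext, rule ext)
  fix i j
  define D where "D x y = (of_bool (fst x = i) * of_bool (fst y = j)
     - of_bool (fst x = j) * of_bool (fst y = i) :: int)" for x y :: "'i dart"
  define rest where "rest = (\<Sum>e\<in>-site. D e (\<sigma> e))"
  have m: "dart_matrix \<tau> i j = (\<Sum>e\<in>UNIV. D e (\<tau> e))" for \<tau>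
    unfolding dart_matrix_def D_def of_bool_conj ..
  have m1: "dart_matrix \<sigma> i j = D \<kappa> a + D a b + D b \<kappa> + D (opp \<kappa>) c + D c d + D d (opp \<kappa>) + rest"
    unfolding m sum_six[OF distinct_site] rest_def by (simp add: next_simps)
  have "(\<Sum>e\<in>-site. D e (flip k \<sigma> e)) = rest"
    unfolding rest_def by (rule sum.cong) (simp_all add: flip_notin_site)
  then have m2: "dart_matrix (flip k \<sigma>) i j
     = D \<kappa> b + D a (opp \<kappa>) + D b c + D (opp \<kappa>) d + D c \<kappa> + D d a + rest"
    unfolding m sum_six[OF distinct_site] by (simp add: flip_site_simps)
  show "dart_matrix (flip k \<sigma>) i j = mutate_matrix k (dart_matrix \<sigma>) i j"
  proof (cases "i = k \<or> j = k")
    case True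
    then show ?thesis
      unfolding mutate_matrix_def
      using dart_matrix_row flip_site.dart_matrix_row[OF flipped_site]
      by (auto simp: dart_matrix_skew[of _ i k])
  next
    case False
    have pk: "pos_part (dart_matrix \<sigma> i k) = of_bool (fst b = i) + of_bool (fst d = i)"
      "pos_part (- dart_matrix \<sigma> i k) = of_bool (fst a = i) + of_bool (fst c = i)"
      unfolding dart_matrix_skew[of \<sigma> i k] using pos_part_row[of i] by simp_all
    \<comment> \<open>The identity to be proved, as a polynomial identity in the indicators \<open>[a = i]\<close>, \<open>[a = j]\<close>,
      and so on.\<close>
    have skew: "(bi * cj - bj * ci) + (di * aj - dj * ai) + r
      = (ai * bj - aj * bi) + (ci * dj - cj * di) + r + (bi + di) * (aj + cj) - (ai + ci) * (bj + dj)"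
      for ai aj bi bj ci cj di dj r :: int
      by (simp add: algebra_simps)
    have "(k = i) = False" "(k = j) = False" using False by auto
    then show ?thesis
      unfolding mutate_matrix_def if_not_P[OF False] pk pos_part_row m1 m2 D_def k fst_opp
      by (simp only: of_bool_eq mult_zero_left mult_zero_right diff_self add_0_left add_0_right)
        (rule skew)
  qed
qed

lemma mutate_A_dart_matrix:
  fixes l :: "'i \<Rightarrow> real"
  shows "mutate_A k (dart_matrix \<sigma>) l k
    = (l (fst a) * l (fst c) + l (fst b) * l (fst d)) / l k"
proof -
  have "(\<Prod>j\<in>UNIV. l j powi (of_bool (x = j) + of_bool (y = j))) = l x * l y" for x y
  proof -
    have "(\<Prod>j\<in>UNIV. l j powi (of_bool (x = j) + of_bool (y = j)))
       = (\<Prod>j\<in>UNIV. (if j = x then l j else 1) * (if j = y then l j else 1))"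
      by (rule prod.cong) (auto simp: power2_eq_square)
    then show ?thesis by (simp add: prod.distrib)
  qed
  then show ?thesis
    unfolding mutate_A_def pos_part_row by (simp add: field_simps)
qed

lemma horocycle_flip:
  fixes l :: "'i \<Rightarrow> real"
  assumes pos: "\<And>j. l j > 0"
  shows "horocycle (flip k \<sigma>) (mutate_A k (dart_matrix \<sigma>) l) = horocycle \<sigma> l"
proof -
  define l' where "l' = mutate_A k (dart_matrix \<sigma>) l"
  have l'_same: "l' j = l j" if "j \<noteq> k" for j
    using that by (simp add: l'_def mutate_A_def)
  define h where "h = (\<lambda>(\<sigma> :: 'i dart \<Rightarrow> 'i dart) (l :: 'i \<Rightarrow> real) e. l (fst e) / (l (fst (\<sigma> e)) * l (fst (\<sigma> (\<sigma> e)))))"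
  have rest: "(\<Sum>e\<in>-site. h (flip k \<sigma>) l' e) = (\<Sum>e\<in>-site. h \<sigma> l e)"
  proof (rule sum.cong[OF refl])
    fix e assume "e \<in> - site"
    then have e: "e \<notin> site" by simp
    note e1 = next_notin_site[OF e] and e2 = next_notin_site[OF next_notin_site[OF e]]
    show "h (flip k \<sigma>) l' e = h \<sigma> l e"
      unfolding h_def flip_notin_site[OF e] flip_notin_site[OF e1]
        l'_same[OF fst_notin_site[OF e]] l'_same[OF fst_notin_site[OF e1]]
        l'_same[OF fst_notin_site[OF e2]] ..
  qed
  define x A B C D x' where v: "x = l k" "A = l (fst a)" "B = l (fst b)" "C = l (fst c)" "D = l (fst d)"
     "x' = l' k"
  have vp: "x > 0" "A > 0" "B > 0" "C > 0" "D > 0" using pos by (auto simp: v)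
  have ptolemy: "x * x' = A * C + B * D"
    using vp(1) unfolding v l'_def mutate_A_dart_matrix by simp
  then have x'p: "x' > 0" using vp by (metis add_pos_pos mult_pos_pos zero_less_mult_pos)
  have l1: "x / (A * B) + A / (B * x) + B / (x * A) + (x / (C * D) + C / (D * x) + D / (x * C))
     = (x * (A * B + C * D) + x' * (A * D + B * C)) / (A * B * C * D)"
    by (rule corner_sum_quadrilateral[OF vp ptolemy])
  have ptolemy': "x' * x = B * D + C * A"
    using ptolemy by (simp only: mult.commute add.commute)
  have l2: "x' / (B * C) + B / (C * x') + C / (x' * B) + (x' / (D * A) + D / (A * x') + A / (x' * D))
     = (x' * (B * C + D * A) + x * (B * A + C * D)) / (B * C * D * A)"
    by (rule corner_sum_quadrilateral[OF x'p vp(3,4,5,2) ptolemy'])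
  have eq: "(x * (A * B + C * D) + x' * (A * D + B * C)) / (A * B * C * D)
      = (x' * (B * C + D * A) + x * (B * A + C * D)) / (B * C * D * A)"
    by (simp only: ac_simps)
  have "horocycle \<sigma> l = x / (A * B) + A / (B * x) + B / (x * A) + (x / (C * D) + C / (D * x) + D / (x * C))
      + (\<Sum>e\<in>-site. h \<sigma> l e)"
    unfolding horocycle_def h_def sum_six[OF distinct_site] by (simp only: v k fst_opp next_simps add.assoc)
  moreover have "horocycle (flip k \<sigma>) l'
      = x' / (B * C) + B / (C * x') + C / (x' * B) + (x' / (D * A) + D / (A * x') + A / (x' * D))
      + (\<Sum>e\<in>-site. h (flip k \<sigma>) l' e)"
    unfolding horocycle_def h_def sum_six[OF distinct_site] 
    by (simp only: v k fst_opp flip_site_simps fst_site l'_same not_False_eq_True add.assoc)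
  ultimately show ?thesis
    unfolding l'_def[symmetric] by (simp only: l1 l2 rest eq)
qed

text \<open>Two flips restore the diagonal but exchange its darts.\<close>

lemma flip_flip:
  "flip k (flip k \<sigma>) e = (let \<delta> = (\<lambda>e. if fst e = k then opp e else e) in \<delta> (\<sigma> (\<delta> e)))"
proof -
  show ?thesis
  proof (cases "e \<in> site")
    case True
    then show ?thesis
      by (elim insertE emptyE)
        (simp_all only: Let_def flip_site.flip_site_simps[OF flipped_site] next_simps fst_site k
          fst_opp opp_opp if_True if_False simp_thms)
  next
    case False
    then have e: "e \<notin> {\<kappa>, b, c, opp \<kappa>, d, a}" by auto
    then show ?thesis
      using False fst_notin_site[OF False] fst_notin_site[OF next_notin_site[OF False]]
      by (simp only: Let_def flip_site.flip_notin_site[OF flipped_site e] flip_notin_site if_False not_False_eq_True)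
  qed
qed

end

context gluing
begin

lemma flip_site_at:
  assumes "fst \<kappa> = k"
  shows "flip_site \<sigma> k \<kappa> (\<sigma> \<kappa>) (\<sigma> (\<sigma> \<kappa>)) (\<sigma> (opp \<kappa>)) (\<sigma> (\<sigma> (opp \<kappa>)))"
  by unfold_locales (use assms in auto)

lemmas gluing_flip = flip_site.gluing_flip[OF flip_site_at[OF fst_conv]]
lemmas dart_matrix_flip = flip_site.dart_matrix_flip[OF flip_site_at[OF fst_conv]]
lemmas horocycle_flip = flip_site.horocycle_flip[OF flip_site_at[OF fst_conv]]
lemmas flip_flip = flip_site.flip_flip[OF flip_site_at[OF fst_conv]]

end

section \<open>Relabelled gluings\<close>

definition conjugate :: "('i::finite dart \<Rightarrow> 'i dart) \<Rightarrow> ('i dart \<Rightarrow> 'i dart) \<Rightarrow> 'i dart \<Rightarrow> 'i dart" where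
  "conjugate \<theta> \<sigma> e = inv_into UNIV \<theta> (\<sigma> (\<theta> e))"

locale dart_relabelling = gluing \<sigma> for \<sigma> :: "'i::finite dart \<Rightarrow> 'i dart" +
  fixes \<theta> :: "'i dart \<Rightarrow> 'i dart" and \<pi> :: "'i \<Rightarrow> 'i"
  assumes bij: "bij \<theta>" and opp: "\<theta> (opp e) = opp (\<theta> e)" and fst: "fst (\<theta> e) = \<pi> (fst e)"
    and inj: "inj \<pi>"
begin

lemma theta_conjugate: "\<theta> (conjugate \<theta> \<sigma> e) = \<sigma> (\<theta> e)"
  unfolding conjugate_def using bij by (simp add: bij_is_surj surj_f_inv_f)

lemma theta_eq: "\<theta> e = \<theta> e' \<longleftrightarrow> e = e'"
  using bij by (simp add: bij_is_inj inj_eq)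

lemma gluing_conjugate: "gluing (conjugate \<theta> \<sigma>)"
proof
  fix e
  show "conjugate \<theta> \<sigma> (conjugate \<theta> \<sigma> (conjugate \<theta> \<sigma> e)) = e"
    unfolding theta_eq[symmetric, of _ e] theta_conjugate by (rule cube)
  show "conjugate \<theta> \<sigma> e \<noteq> e"
    unfolding theta_eq[symmetric, of _ e] theta_conjugate by (rule no_fix)
next
  fix X assume X: "\<And>e. e \<in> X \<Longrightarrow> conjugate \<theta> \<sigma> (opp e) \<in> X"
  have "\<theta> ` X = {} \<or> \<theta> ` X = UNIV"
  proof (rule one_vertex)
    fix e assume "e \<in> \<theta> ` X"
    then obtain e' where e': "e' \<in> X" "e = \<theta> e'" by blast
    have "\<theta> (conjugate \<theta> \<sigma> (opp e')) \<in> \<theta> ` X" using X[OF e'(1)] by blast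
    then show "\<sigma> (opp e) \<in> \<theta> ` X" unfolding theta_conjugate opp e'(2) .
  qed
  then show "X = {} \<or> X = UNIV"
  proof
    assume U: "\<theta> ` X = UNIV"
    have "e \<in> X" for e
    proof -
      have "\<theta> e \<in> \<theta> ` X" unfolding U by simp
      then show ?thesis unfolding image_iff theta_eq by simp
    qed
    then show ?thesis by blast
  qed simp
qed

lemma dart_matrix_conjugate: "dart_matrix (conjugate \<theta> \<sigma>) i j = dart_matrix \<sigma> (\<pi> i) (\<pi> j)"
proof -
  have "dart_matrix (conjugate \<theta> \<sigma>) i j = (\<Sum>e\<in>UNIV.
      of_bool (fst (\<theta> e) = \<pi> i \<and> fst (\<sigma> (\<theta> e)) = \<pi> j)
      - of_bool (fst (\<theta> e) = \<pi> j \<and> fst (\<sigma> (\<theta> e)) = \<pi> i))"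
    unfolding dart_matrix_def theta_conjugate[symmetric] fst inj_eq[OF inj] ..
  also have "\<dots> = dart_matrix \<sigma> (\<pi> i) (\<pi> j)"
    unfolding dart_matrix_def using bij by (rule sum.reindex_bij_betw)
  finally show ?thesis .
qed

lemma horocycle_conjugate: "horocycle (conjugate \<theta> \<sigma>) (l \<circ> \<pi>) = horocycle \<sigma> l"
proof -
  have "horocycle (conjugate \<theta> \<sigma>) (l \<circ> \<pi>)
      = (\<Sum>e\<in>UNIV. l (fst (\<theta> e)) / (l (fst (\<sigma> (\<theta> e))) * l (fst (\<sigma> (\<sigma> (\<theta> e))))))"
    unfolding horocycle_def comp_def fst[symmetric] theta_conjugate ..
  also have "\<dots> = horocycle \<sigma> l"
    unfolding horocycle_def using bij by (rule sum.reindex_bij_betw)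
  finally show ?thesis .
qed

end

definition relabel_dart :: "('i \<Rightarrow> 'i) \<Rightarrow> 'i dart \<Rightarrow> 'i dart" where
  "relabel_dart \<pi> = (\<lambda>(i, b). (\<pi> i, b))"

lemma (in gluing) relabel_dart_relabelling:
  assumes "bij \<pi>"
  shows "dart_relabelling \<sigma> (relabel_dart \<pi>) \<pi>"
proof
  show "bij (relabel_dart \<pi>)"
    by (rule o_bij[of "relabel_dart (inv_into UNIV \<pi>)"])
      (use assms in \<open>auto simp: relabel_dart_def fun_eq_iff bij_is_inj bij_is_surj surj_f_inv_f\<close>)
  show "inj \<pi>" using assms by (rule bij_is_inj)
qed (auto simp: relabel_dart_def opp_def)

section \<open>The corners of the triangles at the puncture\<close>

lemma tri_vertex_Complex:
  "tri_vertex 0 = Complex 1 0"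
  "tri_vertex (Suc 0) = Complex (-1/2) (sqrt 3 / 2)"
  "tri_vertex 2 = Complex (-1/2) (- sqrt 3 / 2)"
proof -
  show "tri_vertex 0 = Complex 1 0" by (simp add: tri_vertex_def complex_eq_iff)
  show "tri_vertex (Suc 0) = Complex (-1/2) (sqrt 3 / 2)"
    using cos_120 sin_120 by (simp add: tri_vertex_def complex_eq_iff)
  have "cis (2 * pi * 2 / 3) = cis (2 * pi) * cis (- (2 * pi / 3))"
    unfolding cis_mult by (rule arg_cong) simp
  then show "tri_vertex 2 = Complex (-1/2) (- sqrt 3 / 2)"
    using cos_120 sin_120 by (simp add: tri_vertex_def complex_eq_iff)
qed

lemma tri_vertex_3: "tri_vertex 3 = tri_vertex 0"
  by (simp add: tri_vertex_def complex_eq_iff)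

lemma tri_vertex_Suc: "k < 3 \<Longrightarrow> tri_vertex (k + 1) = tri_vertex ((k + 1) mod 3)"
  using tri_vertex_3 by (cases "k = 2") auto

lemma less_3_cases: "(k::nat) < 3 \<Longrightarrow> k = 0 \<or> k = Suc 0 \<or> k = 2"
  by auto

lemma Re_tri_vertex:
  assumes "j < 3" "k < 3" "j \<noteq> k"
  shows "Re (tri_vertex j * cnj (tri_vertex k)) = -1/2"
  using less_3_cases[OF assms(1)] less_3_cases[OF assms(2)] assms(3)
  by (elim disjE) (simp_all add: tri_vertex_Complex)

lemma dist_tri_vertex:
  assumes "j < 3" "k < 3" "j \<noteq> k"
  shows "dist (tri_vertex j) (tri_vertex k) = sqrt 3"
proof -
  have unit: "(Re (tri_vertex i))\<^sup>2 + (Im (tri_vertex i))\<^sup>2 = 1" for i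
    by (simp add: tri_vertex_def)
  have "(dist (tri_vertex j) (tri_vertex k))\<^sup>2
      = (Re (tri_vertex j) - Re (tri_vertex k))\<^sup>2 + (Im (tri_vertex j) - Im (tri_vertex k))\<^sup>2"
    by (simp add: dist_norm cmod_power2)
  also have "\<dots> = ((Re (tri_vertex j))\<^sup>2 + (Im (tri_vertex j))\<^sup>2)
      + ((Re (tri_vertex k))\<^sup>2 + (Im (tri_vertex k))\<^sup>2)
      - 2 * Re (tri_vertex j * cnj (tri_vertex k))"
    by (simp add: power2_eq_square algebra_simps)
  also have "\<dots> = 3" unfolding unit Re_tri_vertex[OF assms] by simp
  finally show ?thesis by (metis real_sqrt_unique zero_le_dist)
qed

lemma tri_side_end: "tri_side k 0 = tri_vertex k" "tri_side k 1 = tri_vertex (k + 1)"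
  by (simp_all add: tri_side_def linepath_def)

lemma dist_tri_side_start:
  assumes "k < 3" "0 \<le> t"
  shows "dist (tri_side k t) (tri_vertex k) = t * sqrt 3"
proof -
  have "tri_side k t - tri_vertex k = t *\<^sub>R (tri_vertex (k + 1) - tri_vertex k)"
    by (simp add: tri_side_def linepath_def algebra_simps)
  then have "dist (tri_side k t) (tri_vertex k) = t * dist (tri_vertex (k + 1)) (tri_vertex k)"
    using assms by (simp add: dist_norm)
  also have "dist (tri_vertex (k + 1)) (tri_vertex k) = sqrt 3"
    unfolding tri_vertex_Suc[OF assms(1)] using assms less_3_cases[of k]
    by (intro dist_tri_vertex) auto
  finally show ?thesis .
qed

lemma dist_tri_side_end:
  assumes "k < 3" "t \<le> 1"
  shows "dist (tri_side k t) (tri_vertex (k + 1)) = (1 - t) * sqrt 3"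
proof -
  have "tri_side k t - tri_vertex (k + 1) = (1 - t) *\<^sub>R (tri_vertex k - tri_vertex (k + 1))"
    by (simp add: tri_side_def linepath_def algebra_simps)
  then have "dist (tri_side k t) (tri_vertex (k + 1)) = (1 - t) * dist (tri_vertex k) (tri_vertex (k + 1))"
    using assms by (simp add: dist_norm)
  also have "dist (tri_vertex k) (tri_vertex (k + 1)) = sqrt 3"
    unfolding tri_vertex_Suc[OF assms(1)] using assms less_3_cases[of k]
    by (intro dist_tri_vertex) auto
  finally show ?thesis .
qed

text \<open>The sides and their end points are compared along the axis through the vertex \<open>j\<close>, on which
  the opposite side projects to the point \<open>-1/2\<close>.\<close>

lemma dist_tri_side_opposite:
  assumes "k < 3" "j < 3" "j \<noteq> k" "j \<noteq> (k + 1) mod 3"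
  shows "dist (tri_side k t) (tri_vertex j) \<ge> 3/2"
proof -
  have n: "cmod (tri_vertex j) = 1" by (simp add: tri_vertex_def)
  have 1: "Re (tri_vertex k * cnj (tri_vertex j)) = -1/2"
    by (rule Re_tri_vertex) (use assms in auto)
  have 2: "Re (tri_vertex (k + 1) * cnj (tri_vertex j)) = -1/2"
    unfolding tri_vertex_Suc[OF assms(1)] by (rule Re_tri_vertex) (use assms in auto)
  have 3: "tri_vertex j * cnj (tri_vertex j) = 1"
    using n complex_norm_square[of "tri_vertex j"] by simp
  have "(tri_side k t - tri_vertex j) * cnj (tri_vertex j)
     = (1 - t) *\<^sub>R (tri_vertex k * cnj (tri_vertex j)) + t *\<^sub>R (tri_vertex (k + 1) * cnj (tri_vertex j))
       - tri_vertex j * cnj (tri_vertex j)"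
    by (simp add: tri_side_def linepath_def algebra_simps)
  also have "Re \<dots> = (1 - t) * (-1/2) + t * (-1/2) - 1"
    unfolding plus_complex.sel minus_complex.sel scaleR_complex.sel 1 2
    unfolding 3 by simp
  also have "\<dots> = -3/2" by (simp add: field_simps)
  finally have "Re ((tri_side k t - tri_vertex j) * cnj (tri_vertex j)) = -3/2" .
  then have "3/2 = \<bar>Re ((tri_side k t - tri_vertex j) * cnj (tri_vertex j))\<bar>"
    by (simp only: abs_minus_cancel)
  also have "\<dots> \<le> cmod ((tri_side k t - tri_vertex j) * cnj (tri_vertex j))"
    by (rule abs_Re_le_cmod)
  also have "\<dots> = dist (tri_side k t) (tri_vertex j)"
    by (simp add: norm_mult n dist_norm)
  finally show ?thesis .
qed

lemma sqrt_3_gt_1: "sqrt 3 > (1::real)"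
  by simp

lemma tri_side_near_vertex:
  assumes "k < 3" "j < 3" "0 \<le> t" "t \<le> 1" "dist (tri_side k t) (tri_vertex j) \<le> 1/2"
  shows "j = k \<and> t < 1/2 \<or> j = (k + 1) mod 3 \<and> t > 1/2"
proof -
  have small: "s < 1/2" if "s * sqrt 3 \<le> 1/2" "0 \<le> s" for s
  proof (rule ccontr)
    assume "\<not> s < 1/2"
    then have "s * 1 < s * sqrt 3" using sqrt_3_gt_1 by (intro mult_strict_left_mono) auto
    with that \<open>\<not> s < 1/2\<close> show False by simp
  qed
  consider "j = k" | "j = (k + 1) mod 3" | "j \<noteq> k" "j \<noteq> (k + 1) mod 3" by blast
  then show ?thesis
  proof cases
    case 1
    then show ?thesis using assms dist_tri_side_start[of k t] small[of t] by auto
  next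
    case 2
    then have "dist (tri_side k t) (tri_vertex (k + 1)) \<le> 1/2"
      using assms tri_vertex_Suc by simp
    then show ?thesis using 2 assms dist_tri_side_end[of k t] small[of "1 - t"] by auto
  next
    case 3
    then show ?thesis using assms dist_tri_side_opposite[of k j t] by simp
  qed
qed

lemma model_triangle_cases:
  assumes "z \<in> model_triangle"
  obtains "z \<in> interior model_triangle" | k t where "k < 3" "0 \<le> t" "t \<le> 1" "z = tri_side k t"
proof (cases "z \<in> interior model_triangle")
  case False
  then have "z \<in> closed_segment (tri_vertex 0) (tri_vertex 1) \<union>
      closed_segment (tri_vertex 1) (tri_vertex 2) \<union> closed_segment (tri_vertex 2) (tri_vertex 0)"
    using assms interior_of_triangle[of "tri_vertex 0" "tri_vertex 1" "tri_vertex 2"]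
    unfolding model_triangle_def by auto
  then have "\<exists>k<3. z \<in> closed_segment (tri_vertex k) (tri_vertex (k + 1))"
    using tri_vertex_3 by (auto simp: numeral_3_eq_3 numeral_2_eq_2)
  then obtain k t where "k < 3" "0 \<le> t" "t \<le> 1" "z = tri_side k t"
    unfolding tri_side_def linepath_image_01[symmetric] by auto
  with that show thesis by blast
qed (use that in blast)

lemma tri_side_in_model: "k < 3 \<Longrightarrow> 0 \<le> t \<Longrightarrow> t \<le> 1 \<Longrightarrow> tri_side k t \<in> model_triangle"
proof -
  assume k: "k < 3" and t: "0 \<le> t" "t \<le> 1"
  have v: "tri_vertex k \<in> model_triangle" if "k < 3" for k
    unfolding model_triangle_def
    by (rule hull_inc) (use less_3_cases[OF that] in auto)
  have "convex model_triangle" by (simp add: model_triangle_def convex_convex_hull)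
  moreover have "tri_side k t \<in> closed_segment (tri_vertex k) (tri_vertex (k + 1))"
    unfolding tri_side_def using t by (rule linepath_in_path[OF atLeastAtMost_iff[THEN iffD2, OF conjI]])
  ultimately show ?thesis
    using closed_segment_subset[of "tri_vertex k" model_triangle "tri_vertex (k + 1)"] v k
      tri_vertex_Suc[OF k] by auto
qed

locale cut_surface =
  fixes T :: "'p topology" and p :: 'p and D :: "'p set set" and \<tau> :: "'p set \<Rightarrow> complex \<Rightarrow> 'p"
    and U :: "'p set" and f :: "'p \<Rightarrow> complex"
  assumes Hausdorff: "Hausdorff_space T"
    and chart: "surface_chart T (U, f)" and p_in_chart: "p \<in> U"
    and finite_arcs: "finite D"
    and arcs_meet: "\<alpha> \<in> D \<Longrightarrow> \<beta> \<in> D \<Longrightarrow> \<alpha> \<noteq> \<beta> \<Longrightarrow> \<alpha> \<inter> \<beta> = {p}"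
    and cont: "C \<in> triangles T D \<Longrightarrow> continuous_map (top_of_set model_triangle) T (\<tau> C)"
    and interior_bij: "C \<in> triangles T D \<Longrightarrow> bij_betw (\<tau> C) (interior model_triangle) C"
    and side_in_D: "C \<in> triangles T D \<Longrightarrow> k < 3 \<Longrightarrow> side_arc \<tau> C k \<in> D"
    and side_loop: "C \<in> triangles T D \<Longrightarrow> k < 3 \<Longrightarrow> simple_loop_at T p (\<tau> C \<circ> tri_side k)"
    and two_sides: "\<alpha> \<in> D \<Longrightarrow> card {(C, k). C \<in> triangles T D \<and> k < 3 \<and> side_arc \<tau> C k = \<alpha>} = 2"
    and glue: "C \<in> triangles T D \<Longrightarrow> C' \<in> triangles T D \<Longrightarrow> k < 3 \<Longrightarrow> k' < 3 \<Longrightarrow>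
        (C, k) \<noteq> (C', k') \<Longrightarrow> side_arc \<tau> C k = side_arc \<tau> C' k' \<Longrightarrow> 0 \<le> t \<Longrightarrow> t \<le> 1 \<Longrightarrow>
        \<tau> C (tri_side k t) = \<tau> C' (tri_side k' (1 - t))"
begin

definition sides :: "('p set \<times> nat) set" where
  "sides = {(C, k). C \<in> triangles T D \<and> k < 3}"

lemma finite_sides: "finite sides"
proof -
  have "sides = (\<Union>\<alpha>\<in>D. {(C, k). C \<in> triangles T D \<and> k < 3 \<and> side_arc \<tau> C k = \<alpha>})"
    using side_in_D by (auto simp: sides_def)
  moreover have "finite {(C, k). C \<in> triangles T D \<and> k < 3 \<and> side_arc \<tau> C k = \<alpha>}" if "\<alpha> \<in> D" for \<alpha>
    by (rule card_ge_0_finite) (use two_sides[OF that] in simp)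
  ultimately show ?thesis using finite_arcs by simp
qed

lemma finite_triangles: "finite (triangles T D)"
proof -
  have "triangles T D \<subseteq> fst ` sides"
  proof
    fix C assume "C \<in> triangles T D"
    then have "(C, 0) \<in> sides" by (simp add: sides_def)
    then show "C \<in> fst ` sides" by (metis fst_conv imageI)
  qed
  then show ?thesis using finite_sides finite_surj by blast
qed

lemma loopD:
  assumes "C \<in> triangles T D" "k < 3"
  shows "pathin T (\<tau> C \<circ> tri_side k)" "\<tau> C (tri_side k 0) = p" "\<tau> C (tri_side k 1) = p"
    "inj_on (\<tau> C \<circ> tri_side k) {0..<1}"
  using side_loop[OF assms] by (auto simp: simple_loop_at_def)

lemma side_not_p:
  assumes "C \<in> triangles T D" "k < 3" "0 < t" "t < 1"
  shows "\<tau> C (tri_side k t) \<noteq> p"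
  using inj_onD[OF loopD(4)[OF assms(1,2)], of t 0] loopD(2)[OF assms(1,2)] assms by auto

lemma side_not_p_iff:
  assumes "C \<in> triangles T D" "k < 3" "0 \<le> t" "t \<le> 1" "\<tau> C (tri_side k t) \<noteq> p"
  shows "0 < t" "t < 1"
  using loopD(2,3)[OF assms(1,2)] assms by (cases "t = 0"; cases "t = 1"; auto)+

lemma side_inj:
  assumes "C \<in> triangles T D" "k < 3" "0 < t" "t < 1" "0 < t'" "t' < 1"
    "\<tau> C (tri_side k t) = \<tau> C (tri_side k t')"
  shows "t = t'"
  using inj_onD[OF loopD(4)[OF assms(1,2)], of t t'] assms by auto

lemma side_mem: "0 \<le> t \<Longrightarrow> t \<le> 1 \<Longrightarrow> \<tau> C (tri_side k t) \<in> side_arc \<tau> C k"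
  by (auto simp: side_arc_def)

lemma triangle_disjoint_arcs: "C \<in> triangles T D \<Longrightarrow> x \<in> C \<Longrightarrow> x \<in> topspace T \<and> x \<notin> \<Union>D"
  using connected_components_of_subset[of C "subtopology T (topspace T - \<Union>D)"]
  unfolding triangles_def by auto

lemma interior_mem: "C \<in> triangles T D \<Longrightarrow> z \<in> interior model_triangle \<Longrightarrow> \<tau> C z \<in> C"
  using interior_bij bij_betwE by blast

lemma p_in_arc: "C \<in> triangles T D \<Longrightarrow> p \<in> \<Union>D"
  using side_mem[of 0 C 0] loopD(2)[of C 0] side_in_D[of C 0] by auto

text \<open>The radius is less than half the side length, which is the square root of 3, so the three
  sectors of a triangle are disjoint.\<close>

definition sector :: "nat \<Rightarrow> complex set" where
  "sector k = model_triangle \<inter> cball (tri_vertex k) (1/2)"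

text \<open>Away from \<open>p\<close>, two sectors can meet only along glued sides. Gluing reverses a side, so the
  beginning of one side is identified with the end of the other: the corner at the start of
  the side \<open>k\<close> meets the corner at the start of \<open>k' + 1\<close>.\<close>

lemma sectors_meet:
  assumes C: "C \<in> triangles T D" "k < 3" "z \<in> sector k"
    and C': "C' \<in> triangles T D" "k' < 3" "z' \<in> sector k'"
    and eq: "\<tau> C z = \<tau> C' z'" and not_p: "\<tau> C z \<noteq> p"
  shows "(C, k) = (C', k') \<or>
    (\<exists>m<3. (C, m) \<noteq> (C', k') \<and> side_arc \<tau> C m = side_arc \<tau> C' k' \<and> k = (m + 1) mod 3) \<or>
    (\<exists>m<3. (C, k) \<noteq> (C', m) \<and> side_arc \<tau> C k = side_arc \<tau> C' m \<and> k' = (m + 1) mod 3)"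
proof -
  have z: "z \<in> model_triangle" "dist z (tri_vertex k) \<le> 1/2"
    and z': "z' \<in> model_triangle" "dist z' (tri_vertex k') \<le> 1/2"
    using C C' by (auto simp: sector_def dist_commute)
  have same: "k = k'" if "z = z'"
  proof (rule ccontr)
    assume "k \<noteq> k'"
    then have "sqrt 3 = dist (tri_vertex k) (tri_vertex k')" using C C' dist_tri_vertex by simp
    also have "\<dots> \<le> dist z (tri_vertex k) + dist z (tri_vertex k')"
      by (simp add: dist_triangle3)
    finally show False using z z' that sqrt_3_gt_1 by simp
  qed
  have on_side: "\<tau> C z \<in> \<Union>D" if "C \<in> triangles T D" "m < 3" "0 \<le> t" "t \<le> 1" "z = tri_side m t" for C z m t
    using side_in_D side_mem that by blast
  show ?thesis
  proof (cases "z \<in> interior model_triangle")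
    case True
    then have zC: "\<tau> C z \<in> C" using interior_mem C by blast
    then have "\<tau> C' z' \<notin> \<Union>D" using triangle_disjoint_arcs C eq by auto
    then have "z' \<in> interior model_triangle"
      using model_triangle_cases[OF z'(1)] on_side[OF C'(1)] by metis
    then have "\<tau> C' z' \<in> C'" "z' \<in> interior model_triangle" using interior_mem C' by blast+
    then have "C = C'"
      using zC eq C(1) C'(1) pairwise_disjoint_connected_components_of
      unfolding triangles_def pairwise_def disjnt_iff by metis
    then have "z = z'"
      using interior_bij[OF C(1)] True \<open>z' \<in> interior model_triangle\<close> eq
      by (auto simp: bij_betw_def inj_on_def)
    then show ?thesis using same \<open>C = C'\<close> by simp
  next
    case False
    then obtain m t where m: "m < 3" "0 \<le> t" "t \<le> 1" "z = tri_side m t"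
      using model_triangle_cases[OF z(1)] by blast
    have "\<tau> C' z' \<in> \<Union>D" using on_side[OF C(1) m] eq by simp
    then have "z' \<notin> interior model_triangle"
      using interior_mem[OF C'(1)] triangle_disjoint_arcs[OF C'(1)] by blast
    then obtain m' t' where m': "m' < 3" "0 \<le> t'" "t' \<le> 1" "z' = tri_side m' t'"
      using model_triangle_cases[OF z'(1)] by blast
    have t: "0 < t" "t < 1" and t': "0 < t'" "t' < 1"
      using side_not_p_iff[OF C(1) m(1-3)] side_not_p_iff[OF C'(1) m'(1-3)] not_p eq m(4) m'(4) by auto
    have arcs: "side_arc \<tau> C m = side_arc \<tau> C' m'"
    proof (rule ccontr)
      assume "side_arc \<tau> C m \<noteq> side_arc \<tau> C' m'"
      then have "side_arc \<tau> C m \<inter> side_arc \<tau> C' m' = {p}"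
        using arcs_meet side_in_D C C' m m' by simp
      moreover have "\<tau> C z \<in> side_arc \<tau> C m \<inter> side_arc \<tau> C' m'"
        using side_mem[OF m(2,3), of C m] side_mem[OF m'(2,3), of C' m'] eq m(4) m'(4) by auto
      ultimately show False using not_p by auto
    qed
    show ?thesis
    proof (cases "(C, m) = (C', m')")
      case True
      then have "t = t'" using side_inj[OF C(1) m(1) t t'] eq m(4) m'(4) by auto
      then have "z = z'" using True m m' by simp
      then show ?thesis using same True by simp
    next
      case neq: False
      have "\<tau> C' (tri_side m' t') = \<tau> C' (tri_side m' (1 - t))"
        using glue[OF C(1) C'(1) m(1) m'(1) neq arcs m(2,3)] eq m(4) m'(4) by simp
      then have t't: "t' = 1 - t" using side_inj[OF C'(1) m'(1) t', of "1 - t"] t by simp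
      have near: "k = m \<and> t < 1/2 \<or> k = (m + 1) mod 3 \<and> t > 1/2"
        "k' = m' \<and> t' < 1/2 \<or> k' = (m' + 1) mod 3 \<and> t' > 1/2"
        using tri_side_near_vertex[of m k t] tri_side_near_vertex[of m' k' t'] m m' z z' C C' by auto
      then have "k = m \<and> k' = (m' + 1) mod 3 \<or> k = (m + 1) mod 3 \<and> k' = m'"
        using t't by auto
      then show ?thesis using neq arcs m m' by blast
    qed
  qed
qed

lemma closedin_image:
  assumes "C \<in> triangles T D" "closed K" "K \<subseteq> model_triangle"
  shows "closedin T (\<tau> C ` K)"
proof -
  have "compact model_triangle"
    unfolding model_triangle_def by (intro compact_convex_hull finite_imp_compact) simp
  then have "compact K" using assms compact_Int_closed[of model_triangle K] by (simp add: Int_absorb1)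
  then have "compactin (top_of_set model_triangle) K"
    using assms by (simp add: compactin_subtopology)
  then show ?thesis
    using image_compactin[OF _ cont[OF assms(1)]] compactin_imp_closedin[OF Hausdorff] by blast
qed

lemma closed_model_triangle: "closed model_triangle"
  unfolding model_triangle_def
  by (intro compact_imp_closed compact_convex_hull finite_imp_compact) simp

lemma p_at_vertex:
  assumes "C \<in> triangles T D" "z \<in> model_triangle" "\<tau> C z = p"
  shows "\<exists>k<3. z = tri_vertex k"
proof -
  have "z \<notin> interior model_triangle"
    using interior_mem[OF assms(1)] triangle_disjoint_arcs[OF assms(1)] p_in_arc[OF assms(1)] assms(3)
    by auto
  then obtain m t where m: "m < 3" "0 \<le> t" "t \<le> 1" "z = tri_side m t"
    using model_triangle_cases[OF assms(2)] by blast
  then have "t = 0 \<or> t = 1" using side_not_p[OF assms(1) m(1), of t] assms(3) by fastforce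
  then have "z = tri_vertex m \<or> z = tri_vertex ((m + 1) mod 3)"
    using m tri_side_end tri_vertex_Suc by metis
  moreover have "(m + 1) mod 3 < 3" by simp
  ultimately show ?thesis using m(1) by blast
qed

lemma corner_points_near_p:
  assumes "C \<in> triangles T D" "k < 3" "openin T V" "p \<in> V"
  obtains z where "z \<in> sector k" "\<tau> C z \<in> V" "\<tau> C z \<noteq> p"
proof -
  let ?\<gamma> = "\<tau> C \<circ> tri_side k"
  have "continuous_map (top_of_set {0..1}) T ?\<gamma>"
    using loopD(1)[OF assms(1,2)] by (simp add: pathin_def)
  then have "openin (top_of_set {0..1}) {t \<in> {0..1}. ?\<gamma> t \<in> V}"
    using openin_continuous_map_preimage[OF _ assms(3)] by fastforce
  moreover have "0 \<in> {t \<in> {0..1}. ?\<gamma> t \<in> V}" using loopD(2)[OF assms(1,2)] assms(4) by simp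
  ultimately obtain e where e: "e > 0" "ball 0 e \<inter> {0..1} \<subseteq> {t \<in> {0..1}. ?\<gamma> t \<in> V}"
    unfolding openin_contains_ball by blast
  define t where "t = min (e / 2) (1/4)"
  have t: "0 < t" "t < e" "t \<le> 1/4" using e(1) by (auto simp: t_def)
  then have tV: "?\<gamma> t \<in> V" using e(2) by (auto simp: subset_iff)
  have "sqrt 3 \<le> (2::real)" by (rule real_le_lsqrt) auto
  then have "t * sqrt 3 \<le> 1/4 * 2" using t by (intro mult_mono) auto
  then have "tri_side k t \<in> sector k"
    using dist_tri_side_start[of k t] tri_side_in_model[of k t] assms t
    by (simp add: sector_def dist_commute)
  then show thesis using that tV side_not_p[OF assms(1,2), of t] t by simp
qed

text \<open>A set \<open>Y\<close> of corners that is closed under passing to the neighbouring corner has sectors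
  that touch the remaining sectors only at \<open>p\<close>. A small punctured disc around \<open>p\<close> is covered
  by the sectors. Being connected, it lies in the sectors of \<open>Y\<close> or in the other ones; but
  every sector accumulates at \<open>p\<close>, so \<open>Y\<close> or its complement is empty.\<close>

lemma sides_around_puncture:
  assumes Y: "Y \<subseteq> sides"
    and closed: "\<And>C k C' k'. (C, k) \<in> sides \<Longrightarrow> (C', k') \<in> sides \<Longrightarrow> (C, k) \<noteq> (C', k') \<Longrightarrow>
      side_arc \<tau> C k = side_arc \<tau> C' k' \<Longrightarrow> (C, k) \<in> Y \<longleftrightarrow> (C', (k' + 1) mod 3) \<in> Y"
  shows "Y = {} \<or> Y = sides"
proof (rule ccontr)
  assume "\<not> (Y = {} \<or> Y = sides)"
  then obtain y n where y: "y \<in> Y" and n: "n \<in> sides - Y" using Y by blast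
  define K where "K Z = (\<Union>(C, k)\<in>Z. \<tau> C ` sector k)" for Z
  have closed_K: "closedin T (K Z)" if "Z \<subseteq> sides" for Z
    unfolding K_def
  proof (rule closedin_Union)
    show "finite ((\<lambda>(C, k). \<tau> C ` sector k) ` Z)" using that finite_sides finite_subset by blast
    fix S assume "S \<in> (\<lambda>(C, k). \<tau> C ` sector k) ` Z"
    then obtain C k where S: "S = \<tau> C ` sector k" "(C, k) \<in> Z" by auto
    show "closedin T S"
      unfolding S(1)
    proof (rule closedin_image)
      show "C \<in> triangles T D" using S(2) that by (auto simp: sides_def)
    qed (auto simp: sector_def intro: closed_model_triangle)
  qed
  \<comment> \<open>The part of the surface outside the open sectors; removing it from the chart leaves a
    neighbourhood of \<open>p\<close>.\<close>
  define N where "N = (\<Union>C\<in>triangles T D. \<tau> C ` (model_triangle - (\<Union>k<3. ball (tri_vertex k) (1/2))))"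
  have closed_N: "closedin T N"
    unfolding N_def
  proof (rule closedin_Union)
    show "finite ((\<lambda>C. \<tau> C ` (model_triangle - (\<Union>k<3. ball (tri_vertex k) (1/2)))) ` triangles T D)"
      using finite_triangles by blast
    fix S assume "S \<in> (\<lambda>C. \<tau> C ` (model_triangle - (\<Union>k<3. ball (tri_vertex k) (1/2)))) ` triangles T D"
    then obtain C where "C \<in> triangles T D" "S = \<tau> C ` (model_triangle - (\<Union>k<3. ball (tri_vertex k) (1/2)))"
      by blast
    then show "closedin T S"
      by (auto intro!: closedin_image closed_Diff closed_model_triangle)
  qed
  have p_N: "p \<notin> N"
  proof
    assume "p \<in> N"
    then obtain C z where "C \<in> triangles T D" "z \<in> model_triangle" "p = \<tau> C z"
      and z: "\<And>k. k < 3 \<Longrightarrow> z \<notin> ball (tri_vertex k) (1/2)"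
      unfolding N_def by blast
    then obtain k where "k < 3" "z = tri_vertex k" using p_at_vertex by metis
    with z[of k] show False by simp
  qed
  have U: "openin T U" "open (f ` U)" and hom: "homeomorphic_map (subtopology T U) (top_of_set (f ` U)) f"
    using chart by (auto simp: surface_chart_def)
  have UT: "U \<subseteq> topspace T" using U(1) openin_subset by blast
  obtain g where "homeomorphic_maps (subtopology T U) (top_of_set (f ` U)) f g"
    using hom homeomorphic_map_maps by blast
  then have cf: "continuous_map (subtopology T U) (top_of_set (f ` U)) f"
    and cg: "continuous_map (top_of_set (f ` U)) (subtopology T U) g"
    and gf: "\<And>x. x \<in> U \<Longrightarrow> g (f x) = x"
    using UT by (auto simp: homeomorphic_maps_def)
  define W where "W = U - N"
  have "openin (subtopology T U) W"
  proof -
    have "openin T W" unfolding W_def using U(1) closed_N by (rule openin_diff)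
    then show ?thesis using openin_subset_topspace_eq by (simp add: W_def openin_subtopology) blast
  qed
  then have "openin (top_of_set (f ` U)) (f ` W)"
    using homeomorphic_imp_open_map[OF hom] by (simp add: open_map_def)
  then have "open (f ` W)" using U(2) openin_open_trans by blast
  moreover have "f p \<in> f ` W" using p_in_chart p_N by (auto simp: W_def)
  ultimately obtain r where r: "r > 0" "ball (f p) r \<subseteq> f ` W"
    using open_contains_ball by blast
  define B where "B = ball (f p) r - {f p}"
  have B_sub: "B \<subseteq> f ` W" using r by (auto simp: B_def)
  have "connectedin (top_of_set (f ` U)) B"
    using B_sub connected_punctured_ball[of "f p" r] by (auto simp: connectedin_subtopology B_def W_def)
  then have "connectedin (subtopology T U) (g ` B)"
    using connectedin_continuous_map_image[OF cg] by blast
  then have conn: "connectedin T (g ` B)" by (simp add: connectedin_subtopology)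
  have gB: "x \<in> W \<and> x \<noteq> p" if "x \<in> g ` B" for x
  proof -
    obtain b where b: "b \<in> B" "x = g b" using \<open>x \<in> g ` B\<close> by blast
    then obtain w where "w \<in> W" "b = f w" using B_sub by blast
    then have "x = w" using b gf by (simp add: W_def)
    then show ?thesis using \<open>w \<in> W\<close> \<open>b = f w\<close> b by (auto simp: B_def)
  qed
  have cover: "g ` B \<subseteq> K Y \<union> K (sides - Y)"
  proof
    fix x assume "x \<in> g ` B"
    then have x: "x \<in> topspace T" "x \<notin> N" using gB UT by (auto simp: W_def)
    have "\<exists>C\<in>triangles T D. \<exists>z\<in>model_triangle. x = \<tau> C z"
    proof (cases "x \<in> \<Union>D")
      case True
      then obtain \<alpha> where \<alpha>: "\<alpha> \<in> D" "x \<in> \<alpha>" by blast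
      have "{(C, k). C \<in> triangles T D \<and> k < 3 \<and> side_arc \<tau> C k = \<alpha>} \<noteq> {}"
        using two_sides[OF \<alpha>(1)] by force
      then obtain C k where C: "C \<in> triangles T D" "k < 3" "side_arc \<tau> C k = \<alpha>" by blast
      then obtain t where "t \<in> {0..1}" "x = \<tau> C (tri_side k t)"
        using \<alpha>(2) by (auto simp: side_arc_def)
      then show ?thesis using C tri_side_in_model[of k t] by auto
    next
      case False
      then have "x \<in> \<Union>(triangles T D)"
        using x by (simp add: triangles_def Union_connected_components_of)
      then obtain C where C: "C \<in> triangles T D" "x \<in> C" by blast
      then obtain z where "z \<in> interior model_triangle" "x = \<tau> C z"
        using interior_bij[OF C(1)] by (auto simp: bij_betw_def)
      then show ?thesis using C interior_subset by blast
    qed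
    then obtain C z where C: "C \<in> triangles T D" "z \<in> model_triangle" "x = \<tau> C z" by blast
    with x(2) obtain k where k: "k < 3" "z \<in> ball (tri_vertex k) (1/2)"
      unfolding N_def by blast
    then have "(C, k) \<in> sides" "z \<in> sector k" using C by (auto simp: sides_def sector_def)
    then show "x \<in> K Y \<union> K (sides - Y)" using C by (auto simp: K_def)
  qed
  have disj: "K Y \<inter> K (sides - Y) \<inter> g ` B = {}"
  proof (rule ccontr)
    assume "K Y \<inter> K (sides - Y) \<inter> g ` B \<noteq> {}"
    then obtain x where x: "x \<in> K Y" "x \<in> K (sides - Y)" "x \<noteq> p" using gB by blast
    obtain C k z where C: "(C, k) \<in> Y" "z \<in> sector k" "x = \<tau> C z" using x(1) by (auto simp: K_def)
    obtain C' k' z' where C': "(C', k') \<in> sides" "(C', k') \<notin> Y" "z' \<in> sector k'" "x = \<tau> C' z'"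
      using x(2) by (auto simp: K_def)
    have s: "C \<in> triangles T D" "k < 3" "C' \<in> triangles T D" "k' < 3"
      using C C' Y by (auto simp: sides_def)
    have eq: "\<tau> C z = \<tau> C' z'" and np: "\<tau> C z \<noteq> p" using C C' x by auto
    from sectors_meet[OF s(1,2) C(2) s(3,4) C'(3) eq np]
    consider "(C, k) = (C', k')"
      | m where "m < 3" "(C, m) \<noteq> (C', k')" "side_arc \<tau> C m = side_arc \<tau> C' k'" "k = (m + 1) mod 3"
      | m where "m < 3" "(C, k) \<noteq> (C', m)" "side_arc \<tau> C k = side_arc \<tau> C' m" "k' = (m + 1) mod 3"
      by blast
    then show False
    proof cases
      case 1
      then show ?thesis using C C' by simp
    next
      case 2
      have "(C, m) \<in> sides" using s 2 by (simp add: sides_def)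
      then have "(C', k') \<in> Y \<longleftrightarrow> (C, (m + 1) mod 3) \<in> Y"
        using C'(1) 2 closed by metis
      then show ?thesis using 2 C(1) C'(2) by simp
    next
      case 3
      have "(C', m) \<in> sides" "(C, k) \<in> sides" using s 3 by (auto simp: sides_def)
      then have "(C, k) \<in> Y \<longleftrightarrow> (C', (m + 1) mod 3) \<in> Y"
        using 3 closed by metis
      then show ?thesis using 3 C(1) C'(2) by simp
    qed
  qed
  have meets: "K Z \<inter> g ` B \<noteq> {}" if z: "zz \<in> Z" "Z \<subseteq> sides" for zz Z
  proof -
    obtain C k where zz: "zz = (C, k)" by fastforce
    then have C: "C \<in> triangles T D" "k < 3" using z by (auto simp: sides_def)
    define V where "V = {x \<in> topspace (subtopology T U). f x \<in> ball (f p) r}"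
    have "openin (top_of_set (f ` U)) (f ` U \<inter> ball (f p) r)" by (simp add: openin_open_Int)
    then have "openin (subtopology T U) {x \<in> topspace (subtopology T U). f x \<in> f ` U \<inter> ball (f p) r}"
      using openin_continuous_map_preimage[OF cf] by blast
    moreover have "{x \<in> topspace (subtopology T U). f x \<in> f ` U \<inter> ball (f p) r} = V"
      by (auto simp: V_def)
    ultimately have "openin (subtopology T U) V" by simp
    then have V: "openin T V" using U(1) openin_trans_full by blast
    have "p \<in> V" using p_in_chart UT r by (auto simp: V_def)
    from corner_points_near_p[OF C V this] obtain z
      where z: "z \<in> sector k" "\<tau> C z \<in> V" "\<tau> C z \<noteq> p" .
    have u: "\<tau> C z \<in> U" "f (\<tau> C z) \<in> ball (f p) r" using z(2) by (auto simp: V_def)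
    then have "f (\<tau> C z) \<noteq> f p" using gf[of "\<tau> C z"] gf[OF p_in_chart] z(3) by metis
    then have "f (\<tau> C z) \<in> B" using u by (simp add: B_def)
    then have "\<tau> C z \<in> g ` B" using gf[OF u(1)] by (metis imageI)
    moreover have "\<tau> C z \<in> K Z" using z(1) that(1) zz by (auto simp: K_def)
    ultimately show ?thesis by blast
  qed
  show False
    using conn closed_K[OF Y] closed_K[of "sides - Y"] cover disj meets[OF y Y] meets[OF n]
    unfolding connectedin_closedin by (metis Diff_subset)
qed

end

context cut_surface
begin

text \<open>Each arc has two sides, and choosing which of them is the dart \<open>(i, True)\<close> identifies the
  darts with the sides of all triangles.\<close>

lemma gluing_exists:
  fixes arc :: "'i::finite \<Rightarrow> 'p set"
  assumes inj: "inj arc" and D: "D = range arc"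
  shows "\<exists>\<sigma>. gluing \<sigma> \<and> dart_matrix \<sigma> = (\<lambda>i j. triangulation_matrix T D \<tau> (arc i) (arc j))"
proof -
  define side where "side = (\<lambda>(C, k). side_arc \<tau> C k)"
  have "\<exists>x y. x \<noteq> y \<and> {s \<in> sides. side s = arc i} = {x, y}" for i
  proof -
    have "{s \<in> sides. side s = arc i} = {(C, k). C \<in> triangles T D \<and> k < 3 \<and> side_arc \<tau> C k = arc i}"
      by (auto simp: sides_def side_def)
    then have "card {s \<in> sides. side s = arc i} = 2" using two_sides[of "arc i"] D by simp
    then show ?thesis by (metis card_2_iff)
  qed
  then have "\<forall>i. \<exists>x y. x \<noteq> y \<and> {s \<in> sides. side s = arc i} = {x, y}" ..
  from choice[OF this] obtain x where
    "\<forall>i. \<exists>y. x i \<noteq> y \<and> {s \<in> sides. side s = arc i} = {x i, y}" ..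
  from choice[OF this] obtain y where
    xy: "\<And>i. x i \<noteq> y i" "\<And>i. {s \<in> sides. side s = arc i} = {x i, y i}" by blast
  define \<beta> where "\<beta> e = (if snd e then x (fst e) else y (fst e))" for e :: "'i dart"
  have \<beta>_sides: "\<beta> e \<in> sides" and side_\<beta>: "side (\<beta> e) = arc (fst e)" for e
    using xy(2)[of "fst e"] by (auto simp: \<beta>_def)
  have \<beta>_inj: "\<beta> e = \<beta> e' \<longleftrightarrow> e = e'" for e e'
  proof
    assume eq: "\<beta> e = \<beta> e'"
    then have "fst e = fst e'" using side_\<beta>[of e] side_\<beta>[of e'] inj by (simp add: inj_eq)
    then show "e = e'" using eq xy(1)[of "fst e"] by (auto simp: \<beta>_def prod_eq_iff split: if_splits)
  qed simp
  have \<beta>_surj: "\<exists>e. s = \<beta> e" if "s \<in> sides" for s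
  proof -
    have "side s \<in> D" using that side_in_D by (auto simp: sides_def side_def)
    then obtain i where "side s = arc i" using D by auto
    then have "s = x i \<or> s = y i" using that xy(2)[of i] by auto
    then have "s = \<beta> (i, True) \<or> s = \<beta> (i, False)" by (simp add: \<beta>_def)
    then show ?thesis by blast
  qed
  define nxt where "nxt = (\<lambda>(C :: 'p set, k :: nat). (C, (k + 1) mod 3))"
  have nxt_sides: "nxt s \<in> sides" if "s \<in> sides" for s using that by (auto simp: nxt_def sides_def)
  have nxt3: "nxt (nxt (nxt s)) = s" and nxt_neq: "nxt s \<noteq> s" if mem: "s \<in> sides" for s
  proof -
    obtain C k where s: "s = (C, k)" "k < 3" using mem by (auto simp: sides_def)
    show "nxt (nxt (nxt s)) = s" "nxt s \<noteq> s"
      using less_3_cases[OF s(2)] by (auto simp: s(1) nxt_def)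
  qed
  have "\<forall>e. \<exists>e'. \<beta> e' = nxt (\<beta> e)" using \<beta>_surj nxt_sides \<beta>_sides by metis
  then obtain \<sigma> where \<sigma>: "\<And>e. \<beta> (\<sigma> e) = nxt (\<beta> e)" by metis
  have "gluing \<sigma>"
  proof
    fix e
    show "\<sigma> (\<sigma> (\<sigma> e)) = e" using \<sigma> nxt3[OF \<beta>_sides] \<beta>_inj by metis
    show "\<sigma> e \<noteq> e" using \<sigma> nxt_neq[OF \<beta>_sides] by metis
  next
    fix X assume X: "\<And>e. e \<in> X \<Longrightarrow> \<sigma> (opp e) \<in> X"
    have inj_\<sigma>: "\<sigma> u = \<sigma> v \<longleftrightarrow> u = v" for u v using \<sigma> nxt3[OF \<beta>_sides] \<beta>_inj by metis
    \<comment> \<open>On a finite set an injective self-map is onto, so \<open>X\<close> is closed under predecessors as well.\<close>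
    have "inj_on (\<lambda>e. \<sigma> (opp e)) X" by (auto simp: inj_on_def inj_\<sigma> opp_eq_iff)
    then have "(\<lambda>e. \<sigma> (opp e)) ` X = X" using X by (intro endo_inj_surj) auto
    then have iff: "e \<in> X \<longleftrightarrow> \<sigma> (opp e) \<in> X" for e
      using inj_\<sigma> opp_eq_iff by (metis (no_types, lifting) X imageE opp_opp)
    have mem: "\<beta> e \<in> \<beta> ` X \<longleftrightarrow> e \<in> X" for e using \<beta>_inj by (metis image_iff)
    have "\<beta> ` X = {} \<or> \<beta> ` X = sides"
    proof (rule sides_around_puncture)
      show "\<beta> ` X \<subseteq> sides" using \<beta>_sides by auto
      fix C k C' k'
      assume s: "(C, k) \<in> sides" "(C', k') \<in> sides" "(C, k) \<noteq> (C', k')"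
        "side_arc \<tau> C k = side_arc \<tau> C' k'"
      obtain e where e1: "(C, k) = \<beta> e" using \<beta>_surj[OF s(1)] ..
      obtain e' where e2: "(C', k') = \<beta> e'" using \<beta>_surj[OF s(2)] ..
      note e = e1 e2
      have "arc (fst e) = arc (fst e')"
        using s(4) side_\<beta>[of e] side_\<beta>[of e'] by (simp add: side_def flip: e)
      then have "fst e' = fst e" using inj by (simp add: inj_eq)
      moreover have "e' \<noteq> e" using e s(3) by auto
      ultimately have e': "e' = opp e" by (simp add: fst_eq_dart_iff)
      have "(C', (k' + 1) mod 3) = \<beta> (\<sigma> (opp e))"
        unfolding \<sigma> e'[symmetric] e(2)[symmetric] by (simp add: nxt_def)
      then show "(C, k) \<in> \<beta> ` X \<longleftrightarrow> (C', (k' + 1) mod 3) \<in> \<beta> ` X"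
        using mem iff e(1) by metis
    qed
    then show "X = {} \<or> X = UNIV" using mem \<beta>_sides by auto
  qed
  moreover have "dart_matrix \<sigma> i j = triangulation_matrix T D \<tau> (arc i) (arc j)" for i j
  proof -
    have "int (clockwise_corners T D \<tau> (arc i) (arc j))
        = (\<Sum>e\<in>UNIV. of_bool (fst e = i \<and> fst (\<sigma> e) = j))" for i j
    proof -
      have "{(C, k). C \<in> triangles T D \<and> k < 3 \<and> side_arc \<tau> C k = arc i \<and> side_arc \<tau> C ((k + 1) mod 3) = arc j}
        = {s \<in> sides. side s = arc i \<and> side (nxt s) = arc j}"
        by (auto simp: sides_def side_def nxt_def)
      also have "\<dots> = \<beta> ` {e. fst e = i \<and> fst (\<sigma> e) = j}"
      proof (rule subset_antisym; rule subsetI)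
        fix s assume s: "s \<in> {s \<in> sides. side s = arc i \<and> side (nxt s) = arc j}"
        then obtain e where e: "s = \<beta> e" using \<beta>_surj by blast
        then have "arc (fst e) = arc i" "arc (fst (\<sigma> e)) = arc j"
          using s \<sigma> side_\<beta> by (metis (mono_tags, lifting) mem_Collect_eq)+
        then show "s \<in> \<beta> ` {e. fst e = i \<and> fst (\<sigma> e) = j}" using e inj by (simp add: inj_eq)
      next
        fix s assume "s \<in> \<beta> ` {e. fst e = i \<and> fst (\<sigma> e) = j}"
        then obtain e where "s = \<beta> e" "fst e = i" "fst (\<sigma> e) = j" by blast
        then show "s \<in> {s \<in> sides. side s = arc i \<and> side (nxt s) = arc j}"
          using \<beta>_sides[of e] side_\<beta>[of e] side_\<beta>[of "\<sigma> e"] by (simp add: \<sigma>)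
      qed
      finally have "clockwise_corners T D \<tau> (arc i) (arc j) = card (\<beta> ` {e. fst e = i \<and> fst (\<sigma> e) = j})"
        by (simp add: clockwise_corners_def)
      also have "\<dots> = card {e. fst e = i \<and> fst (\<sigma> e) = j}"
        by (rule card_image) (simp add: inj_on_def \<beta>_inj)
      finally show ?thesis by (simp add: sum_of_bool_eq)
    qed
    then show ?thesis by (simp add: dart_matrix_def triangulation_matrix_def sum_subtractf)
  qed
  ultimately show ?thesis by blast
qed

end

lemma triangulation_gluing_exists:
  fixes arc :: "'i::finite \<Rightarrow> 'p set"
  assumes "closed_oriented_surface T \<A>" "p \<in> topspace T" "inj arc"
    and "arc_system T p (range arc)" "cuts_into_triangles T \<A> p (range arc) \<tau>"
  shows "\<exists>\<sigma>. gluing \<sigma> \<and>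
    dart_matrix \<sigma> = (\<lambda>i j. triangulation_matrix T (range arc) \<tau> (arc i) (arc j))"
proof -
  have atlas: "oriented_atlas T \<A>" and H: "Hausdorff_space T"
    using assms(1) by (auto simp: closed_oriented_surface_def)
  then obtain U f where "(U, f) \<in> \<A>" "p \<in> U" using assms(2) by (auto simp: oriented_atlas_def)
  then have "surface_chart T (U, f)" using atlas by (auto simp: oriented_atlas_def)
  interpret cut_surface T p "range arc" \<tau> U f
  proof
    show "Hausdorff_space T" by fact
    show "surface_chart T (U, f)" by fact
    show "p \<in> U" by fact
    show "\<alpha> \<inter> \<beta> = {p}" if "\<alpha> \<in> range arc" "\<beta> \<in> range arc" "\<alpha> \<noteq> \<beta>" for \<alpha> \<beta>
      using assms(4) that unfolding arc_system_def pairwise_def by blast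
  qed (use assms(5) in \<open>unfold cuts_into_triangles_def, auto\<close>)
  show ?thesis using gluing_exists[OF assms(3) refl] .
qed

section \<open>Coordinates as specializations of cluster variables\<close>

lemma poly_value_superset:
  assumes "finite M" "{m. c m \<noteq> 0} \<subseteq> M"
  shows "poly_value c Y = (\<Sum>m\<in>M. of_rat (c m) * (\<Prod>i\<in>UNIV. Y i ^ m i))"
  unfolding poly_value_def using assms by (intro sum.mono_neutral_left) auto

lemma poly_value_diff:
  assumes "finite {m. c m \<noteq> 0}" "finite {m. d m \<noteq> 0}"
  shows "poly_value (\<lambda>m. c m - d m) Y = poly_value c Y - poly_value d Y"
proof -
  let ?M = "{m. c m \<noteq> 0} \<union> {m. d m \<noteq> 0}"
  have "finite ?M" using assms by (rule finite_UnI)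
  moreover have "{m. c m - d m \<noteq> 0} \<subseteq> ?M" by (rule subsetI) (metis (mono_tags) UnCI diff_self mem_Collect_eq)
  ultimately have M: "finite ?M" "{m. c m \<noteq> 0} \<subseteq> ?M" "{m. d m \<noteq> 0} \<subseteq> ?M" "{m. c m - d m \<noteq> 0} \<subseteq> ?M"
    using Un_upper1 Un_upper2 by blast+
  show ?thesis
    unfolding poly_value_superset[OF M(1,2)] poly_value_superset[OF M(1,3)] poly_value_superset[OF M(1,4)]
    by (simp only: of_rat_diff left_diff_distrib sum_subtractf)
qed

lemma poly_value_add:
  assumes "finite {m. c m \<noteq> 0}" "finite {m. d m \<noteq> 0}"
  shows "poly_value (\<lambda>m. c m + d m) Y = poly_value c Y + poly_value d Y"
proof -
  let ?M = "{m. c m \<noteq> 0} \<union> {m. d m \<noteq> 0}"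
  have "finite ?M" using assms by (rule finite_UnI)
  moreover have "{m. c m + d m \<noteq> 0} \<subseteq> ?M" by (rule subsetI) (metis (mono_tags) UnCI add_0 mem_Collect_eq)
  ultimately have M: "finite ?M" "{m. c m \<noteq> 0} \<subseteq> ?M" "{m. d m \<noteq> 0} \<subseteq> ?M" "{m. c m + d m \<noteq> 0} \<subseteq> ?M"
    using Un_upper1 Un_upper2 by blast+
  show ?thesis
    unfolding poly_value_superset[OF M(1,2)] poly_value_superset[OF M(1,3)] poly_value_superset[OF M(1,4)]
    by (simp only: of_rat_add distrib_right sum.distrib)
qed

definition poly_times ::
    "(('i::finite \<Rightarrow> nat) \<Rightarrow> rat) \<Rightarrow> (('i \<Rightarrow> nat) \<Rightarrow> rat) \<Rightarrow> ('i \<Rightarrow> nat) \<Rightarrow> rat" where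
  "poly_times c d q = (\<Sum>x\<in>{x \<in> {m. c m \<noteq> 0} \<times> {m. d m \<noteq> 0}. (\<lambda>i. fst x i + snd x i) = q}.
     c (fst x) * d (snd x))"

lemma poly_times_support:
  "{q. poly_times c d q \<noteq> 0}
    \<subseteq> (\<lambda>x i. fst x i + snd x i) ` ({m. c m \<noteq> 0} \<times> {m. d m \<noteq> 0})"
proof
  fix q assume "q \<in> {q. poly_times c d q \<noteq> 0}"
  then have "{x \<in> {m. c m \<noteq> 0} \<times> {m. d m \<noteq> 0}. (\<lambda>i. fst x i + snd x i) = q} \<noteq> {}"
    unfolding poly_times_def by (metis (mono_tags, lifting) mem_Collect_eq sum.empty)
  then show "q \<in> (\<lambda>x i. fst x i + snd x i) ` ({m. c m \<noteq> 0} \<times> {m. d m \<noteq> 0})" by blast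
qed

lemma finite_poly_times:
  assumes "finite {m. c m \<noteq> 0}" "finite {m. d m \<noteq> 0}"
  shows "finite {q. poly_times c d q \<noteq> 0}"
  by (rule finite_subset[OF poly_times_support finite_imageI[OF finite_cartesian_product[OF assms]]])

lemma poly_value_times:
  assumes "finite {m. c m \<noteq> 0}" "finite {m. d m \<noteq> 0}"
  shows "poly_value (poly_times c d) Y = poly_value c Y * poly_value d Y"
proof -
  let ?X = "{m. c m \<noteq> 0} \<times> {m. d m \<noteq> 0}" and ?s = "\<lambda>x i. fst x i + snd x i"
  let ?mono = "\<lambda>m. \<Prod>i\<in>UNIV. Y i ^ m i"
  have fin: "finite ?X" using assms by simp
  have "poly_value (poly_times c d) Y = (\<Sum>q\<in>?s ` ?X. of_rat (poly_times c d q) * ?mono q)"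
    by (rule poly_value_superset) (use fin poly_times_support in auto)
  also have "\<dots> = (\<Sum>q\<in>?s ` ?X. \<Sum>x\<in>{x \<in> ?X. ?s x = q}.
      of_rat (c (fst x)) * of_rat (d (snd x)) * ?mono (?s x))"
    unfolding poly_times_def of_rat_sum of_rat_mult sum_distrib_right by (intro sum.cong refl) auto
  also have "\<dots> = (\<Sum>x\<in>?X. of_rat (c (fst x)) * of_rat (d (snd x)) * ?mono (?s x))"
    using fin by (rule sum.image_gen[symmetric])
  also have "\<dots> = (\<Sum>x\<in>?X. (of_rat (c (fst x)) * ?mono (fst x)) * (of_rat (d (snd x)) * ?mono (snd x)))"
    by (intro sum.cong refl) (simp add: power_add prod.distrib algebra_simps)
  also have "\<dots> = poly_value c Y * poly_value d Y"
    unfolding poly_value_def sum_product sum.cartesian_product by (simp add: case_prod_beta)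
  finally show ?thesis .
qed

definition poly_values :: "('i::finite \<Rightarrow> 'a::field_char_0) \<Rightarrow> ('i \<Rightarrow> real) \<Rightarrow> 'a \<Rightarrow> real \<Rightarrow> bool" where
  "poly_values A a y r \<longleftrightarrow> (\<exists>c. finite {m. c m \<noteq> 0} \<and> y = poly_value c A \<and> r = poly_value c a)"

lemma poly_values_add:
  "poly_values A a y r \<Longrightarrow> poly_values A a y' r' \<Longrightarrow> poly_values A a (y + y') (r + r')"
  unfolding poly_values_def
proof (elim exE conjE)
  fix c d assume cd: "finite {m. c m \<noteq> 0}" "finite {m. d m \<noteq> 0}"
    and eq: "y = poly_value c A" "r = poly_value c a" "y' = poly_value d A" "r' = poly_value d a"
  have "{m. c m + d m \<noteq> 0} \<subseteq> {m. c m \<noteq> 0} \<union> {m. d m \<noteq> 0}"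
    by (rule subsetI) (metis (mono_tags) UnCI add_0 mem_Collect_eq)
  then have "finite {m. c m + d m \<noteq> 0}"
    by (rule finite_subset) (rule finite_UnI[OF cd])
  then show "\<exists>e. finite {m. e m \<noteq> 0} \<and> y + y' = poly_value e A \<and> r + r' = poly_value e a"
    by (intro exI[of _ "\<lambda>m. c m + d m"]) (simp add: eq poly_value_add[OF cd])
qed

lemma poly_values_mult:
  "poly_values A a y r \<Longrightarrow> poly_values A a y' r' \<Longrightarrow> poly_values A a (y * y') (r * r')"
  unfolding poly_values_def using poly_value_times finite_poly_times by metis

lemma poly_values_1: "poly_values A a 1 1"
  unfolding poly_values_def
proof (intro exI conjI)
  let ?c = "\<lambda>m. if m = (\<lambda>_. 0) then 1 else 0 :: rat"
  have s: "{m. ?c m \<noteq> 0} = {\<lambda>_. 0}" by auto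
  show "finite {m. ?c m \<noteq> 0}" "1 = poly_value ?c A" "1 = poly_value ?c a"
    unfolding poly_value_def s by simp_all
qed

lemma prod_power_single:
  fixes Y :: "'i::finite \<Rightarrow> 'f::field"
  shows "(\<Prod>j\<in>UNIV. Y j ^ (if j = i then 1 else 0)) = Y i"
proof -
  have "(\<Prod>j\<in>UNIV. Y j ^ (if j = i then 1 else 0)) = (\<Prod>j\<in>UNIV. if j = i then Y j else 1)"
    by (rule prod.cong) auto
  then show ?thesis by simp
qed

lemma poly_values_var: "poly_values A a (A i) (a i)"
  unfolding poly_values_def
proof (intro exI conjI)
  let ?m = "\<lambda>j. if j = i then 1 else 0 :: nat"
  let ?c = "\<lambda>m. if m = ?m then 1 else 0 :: rat"
  have s: "{m. ?c m \<noteq> 0} = {?m}" by auto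
  show "finite {m. ?c m \<noteq> 0}" "A i = poly_value ?c A" "a i = poly_value ?c a"
    by (simp_all add: poly_value_def s prod_power_single)
qed

lemma poly_values_unique:
  assumes "algebraically_independent A" "poly_values A a y r" "poly_values A a y r'"
  shows "r = r'"
proof -
  obtain c where c: "finite {m. c m \<noteq> 0}" "y = poly_value c A" "r = poly_value c a"
    using assms(2) unfolding poly_values_def by (elim exE conjE)
  obtain d where d: "finite {m. d m \<noteq> 0}" "y = poly_value d A" "r' = poly_value d a"
    using assms(3) unfolding poly_values_def by (elim exE conjE)
  have "{m. c m - d m \<noteq> 0} \<subseteq> {m. c m \<noteq> 0} \<union> {m. d m \<noteq> 0}"
    by (rule subsetI) (metis (mono_tags) UnCI diff_self mem_Collect_eq)
  then have fin: "finite {m. c m - d m \<noteq> 0}"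
    by (rule finite_subset) (rule finite_UnI[OF c(1) d(1)])
  have zero: "poly_value (\<lambda>m. c m - d m) A = 0"
    unfolding poly_value_diff[OF c(1) d(1)] using c(2) d(2) by simp
  have "(\<lambda>m. c m - d m) m = 0" for m
    using assms(1) fin zero unfolding algebraically_independent_def
    by (elim allE[of _ "\<lambda>m. c m - d m"] impE allE[of _ m])
  then have "c = d" by (simp add: fun_eq_iff)
  then show ?thesis using c d by simp
qed

lemma poly_values_nonzero:
  assumes "algebraically_independent A" "poly_values A a y r" "r \<noteq> 0"
  shows "y \<noteq> 0"
proof
  assume "y = 0"
  moreover have "poly_values A a 0 0"
    unfolding poly_values_def poly_value_def by (intro exI[of _ "\<lambda>_. 0"]) simp
  ultimately show False using poly_values_unique assms by metis
qed

text \<open>The number \<open>r\<close> is obtained from \<open>y\<close> by substituting \<open>a\<close> for the free generators \<open>A\<close>.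
  Requiring positive values of numerator and denominator makes the relation stable under
  subtraction-free operations.\<close>

definition specializes :: "('i::finite \<Rightarrow> 'a::field_char_0) \<Rightarrow> ('i \<Rightarrow> real) \<Rightarrow> 'a \<Rightarrow> real \<Rightarrow> bool" where
  "specializes A a y r \<longleftrightarrow> (\<exists>y1 r1 y2 r2. poly_values A a y1 r1 \<and> poly_values A a y2 r2 \<and>
     r1 > 0 \<and> r2 > 0 \<and> y = y1 / y2 \<and> r = r1 / r2)"

locale specialization =
  fixes A :: "'i::finite \<Rightarrow> 'a::field_char_0" and a :: "'i \<Rightarrow> real"
  assumes indep: "algebraically_independent A" and pos: "\<And>i. a i > 0"
begin

text \<open>Equal quotients give, after clearing denominators, two polynomials with the same value at
  the algebraically independent \<open>A\<close>; these have equal coefficients, hence equal values at \<open>a\<close>.\<close>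

lemma specializes_unique:
  assumes "specializes A a y r" "specializes A a y r'"
  shows "r = r'"
proof -
  obtain y1 r1 y2 r2 where 1: "poly_values A a y1 r1" "poly_values A a y2 r2"
    "r1 > 0" "r2 > 0" "y = y1 / y2" "r = r1 / r2" using assms(1) unfolding specializes_def by blast
  obtain y3 r3 y4 r4 where 2: "poly_values A a y3 r3" "poly_values A a y4 r4"
    "r3 > 0" "r4 > 0" "y = y3 / y4" "r' = r3 / r4" using assms(2) unfolding specializes_def by blast
  have "y2 \<noteq> 0" "y4 \<noteq> 0" using poly_values_nonzero[OF indep] 1 2 by auto
  then have "y1 * y4 = y3 * y2" using 1(5) 2(5) by (simp add: frac_eq_eq)
  then have "r1 * r4 = r3 * r2"
    using poly_values_unique[OF indep poly_values_mult[OF 1(1) 2(2)]] poly_values_mult[OF 2(1) 1(2)] by simp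
  then have "r1 / r2 = r3 / r4" using 1(4) 2(4) by (simp add: frac_eq_eq)
  then show ?thesis using 1(6) 2(6) by simp
qed

lemma specializes_pos: "specializes A a y r \<Longrightarrow> r > 0"
  unfolding specializes_def by auto

lemma specializes_1: "specializes A a 1 1"
  unfolding specializes_def
  by (rule exI[of _ 1])+ (use poly_values_1 in simp)

lemma specializes_var: "specializes A a (A i) (a i)"
  unfolding specializes_def
  by (rule exI[of _ "A i"], rule exI[of _ "a i"], rule exI[of _ 1], rule exI[of _ 1])
    (simp add: poly_values_1 poly_values_var pos)

lemma specializes_mult:
  assumes "specializes A a y r" "specializes A a y' r'"
  shows "specializes A a (y * y') (r * r')"
proof -
  obtain y1 r1 y2 r2 where 1: "poly_values A a y1 r1" "poly_values A a y2 r2"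
    "r1 > 0" "r2 > 0" "y = y1 / y2" "r = r1 / r2" using assms(1) unfolding specializes_def by blast
  obtain y3 r3 y4 r4 where 2: "poly_values A a y3 r3" "poly_values A a y4 r4"
    "r3 > 0" "r4 > 0" "y' = y3 / y4" "r' = r3 / r4" using assms(2) unfolding specializes_def by blast
  have "y * y' = (y1 * y3) / (y2 * y4)" "r * r' = (r1 * r3) / (r2 * r4)" using 1 2 by simp_all
  then show ?thesis
    unfolding specializes_def
    using poly_values_mult[OF 1(1) 2(1)] poly_values_mult[OF 1(2) 2(2)] 1 2 mult_pos_pos by metis
qed

lemma specializes_add:
  assumes "specializes A a y r" "specializes A a y' r'"
  shows "specializes A a (y + y') (r + r')"
proof -
  obtain y1 r1 y2 r2 where 1: "poly_values A a y1 r1" "poly_values A a y2 r2"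
    "r1 > 0" "r2 > 0" "y = y1 / y2" "r = r1 / r2" using assms(1) unfolding specializes_def by blast
  obtain y3 r3 y4 r4 where 2: "poly_values A a y3 r3" "poly_values A a y4 r4"
    "r3 > 0" "r4 > 0" "y' = y3 / y4" "r' = r3 / r4" using assms(2) unfolding specializes_def by blast
  have "y2 \<noteq> 0" "y4 \<noteq> 0" using poly_values_nonzero[OF indep] 1 2 by auto
  then have "y + y' = (y1 * y4 + y3 * y2) / (y2 * y4)" "r + r' = (r1 * r4 + r3 * r2) / (r2 * r4)"
    using 1 2 by (simp_all add: add_frac_eq)
  moreover have "poly_values A a (y1 * y4 + y3 * y2) (r1 * r4 + r3 * r2)"
    using 1 2 by (intro poly_values_add poly_values_mult)
  moreover have "r1 * r4 + r3 * r2 > 0" "r2 * r4 > 0" using 1 2 by (simp_all add: add_pos_pos)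
  ultimately show ?thesis
    unfolding specializes_def using poly_values_mult[OF 1(2) 2(2)] by metis
qed

lemma specializes_inverse:
  assumes "specializes A a y r"
  shows "specializes A a (inverse y) (inverse r)"
  using assms unfolding specializes_def by (metis inverse_divide)

lemma specializes_power: "specializes A a y r \<Longrightarrow> specializes A a (y ^ n) (r ^ n)"
  by (induction n) (auto intro: specializes_1 specializes_mult)

lemma specializes_powi: "specializes A a y r \<Longrightarrow> specializes A a (y powi n) (r powi n)"
  by (simp add: power_int_def specializes_power specializes_inverse)

lemma specializes_prod:
  "(\<And>j. j \<in> J \<Longrightarrow> specializes A a (y j) (r j)) \<Longrightarrow> specializes A a (prod y J) (prod r J)"
  by (induction J rule: infinite_finite_induct) (auto intro: specializes_1 specializes_mult)

lemma specializes_mutate_A: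
  assumes "\<And>j. specializes A a (y j) (r j)"
  shows "specializes A a (mutate_A k e y j) (mutate_A k e r j)"
  unfolding mutate_A_def
  by (auto intro!: assms specializes_mult specializes_add specializes_inverse specializes_prod specializes_powi)

end

lemma seed_in_class: "S \<in> mutation_class S"
  by (simp add: mutation_class_def)

lemma mutate_in_class: "S \<in> mutation_class S0 \<Longrightarrow> mutate k S \<in> mutation_class S0"
  unfolding mutation_class_def seed_step_def by (auto intro: rtranclp.rtrancl_into_rtrancl)

lemma relabel_in_class: "S \<in> mutation_class S0 \<Longrightarrow> bij \<pi> \<Longrightarrow> relabel \<pi> S \<in> mutation_class S0"
  unfolding mutation_class_def seed_step_def by (auto intro: rtranclp.rtrancl_into_rtrancl)

lemma mutation_class_induct [consumes 1, case_names start mutate relabel]: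
  assumes "S \<in> mutation_class S0" and "P S0"
    and "\<And>S k. S \<in> mutation_class S0 \<Longrightarrow> P S \<Longrightarrow> P (mutate k S)"
    and "\<And>S \<pi>. S \<in> mutation_class S0 \<Longrightarrow> bij \<pi> \<Longrightarrow> P S \<Longrightarrow> P (relabel \<pi> S)"
  shows "P S"
proof -
  have "seed_step\<^sup>*\<^sup>* S0 S" using assms(1) by (simp add: mutation_class_def)
  then show ?thesis
  proof (induction rule: rtranclp_induct)
    case (step S S')
    have "S \<in> mutation_class S0" using step(1) by (simp add: mutation_class_def)
    then show ?case using step assms(3,4) unfolding seed_step_def by blast
  qed (rule assms(2))
qed

inductive chart_values ::
    "('i::finite, 'a::field, 'x::field) seed \<Rightarrow> ('i \<Rightarrow> real) \<Rightarrow> ('i, 'a, 'x) seed \<Rightarrow> ('i \<Rightarrow> real) \<Rightarrow> bool"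
  for S0 a where
  start: "chart_values S0 a S0 a"
| mutate: "chart_values S0 a S q \<Longrightarrow> chart_values S0 a (mutate k S) (mutate_A k (exmat S) q)"
| relabel: "chart_values S0 a S q \<Longrightarrow> bij \<pi> \<Longrightarrow> chart_values S0 a (relabel \<pi> S) (q \<circ> \<pi>)"

text \<open>Coordinates at a seed must not depend on the path that leads there. They do not, because
  they are specializations of the cluster variables, which are part of the seed.\<close>

lemma A_manifold_point_exists:
  assumes indep: "algebraically_independent (avar S0)" and pos: "\<And>j. a j > 0"
  shows "\<exists>p\<in>A_manifold (mutation_class S0). p S0 = a"
proof -
  interpret specialization "avar S0" a by unfold_locales (use indep pos in auto)
  have spec: "specializes (avar S0) a (avar S j) (q j)" if "chart_values S0 a S q" for S q j
    using that
  proof (induction arbitrary: j rule: chart_values.induct)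
    case start
    then show ?case by (rule specializes_var)
  next
    case (mutate S q k)
    then show ?case by (simp add: mutate_def specializes_mutate_A)
  next
    case (relabel S q \<pi>)
    then show ?case by (simp add: relabel_def)
  qed
  have unique: "q = q'" if "chart_values S0 a S q" "chart_values S0 a S q'" for S q q'
    using spec[OF that(1)] spec[OF that(2)] specializes_unique by blast
  have total: "\<exists>q. chart_values S0 a S q" if "S \<in> mutation_class S0" for S
    using that by (induction rule: mutation_class_induct) (blast intro: chart_values.intros)+
  define p where "p = (\<lambda>S. if S \<in> mutation_class S0 then THE q. chart_values S0 a S q else undefined)"
  have p_eq: "p S = q" if "S \<in> mutation_class S0" "chart_values S0 a S q" for S q
    using that unique unfolding p_def by (simp add: the_equality)
  have p: "chart_values S0 a S (p S)" if "S \<in> mutation_class S0" for S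
    using total[OF that] p_eq[OF that] by auto
  have "p \<in> A_manifold (mutation_class S0)"
    unfolding A_manifold_def
  proof (intro CollectI conjI ballI allI impI)
    show "p \<in> extensional (mutation_class S0)" by (simp add: p_def extensional_def)
    fix S assume S: "S \<in> mutation_class S0"
    show "p S j > 0" for j using spec[OF p[OF S]] specializes_pos by blast
    show "p (mutate k S) = mutate_A k (exmat S) (p S)" for k
      by (rule p_eq[OF mutate_in_class[OF S] chart_values.mutate[OF p[OF S]]])
    show "p (relabel \<pi> S) = p S \<circ> \<pi>" if "bij \<pi>" for \<pi>
      by (rule p_eq[OF relabel_in_class[OF S that] chart_values.relabel[OF p[OF S] that]])
  qed
  moreover have "p S0 = a" by (rule p_eq[OF seed_in_class chart_values.start])
  ultimately show ?thesis by blast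
qed

lemma A_manifold_point_unique:
  assumes p: "p \<in> A_manifold (mutation_class S0)" and q: "q \<in> A_manifold (mutation_class S0)"
    and eq: "p S0 = q S0"
  shows "p = q"
proof
  fix S
  show "p S = q S"
  proof (cases "S \<in> mutation_class S0")
    case True
    then show ?thesis
      by (induction rule: mutation_class_induct) (use eq p q in \<open>auto simp: A_manifold_def\<close>)
  next
    case False
    then show ?thesis using p q by (simp add: A_manifold_def extensional_def)
  qed
qed

section \<open>Sums of exponentials\<close>

text \<open>In terms of \<open>exp (x $ i)\<close> these are the finite sums of Laurent monomials, with real
  exponents allowed. They are convex and stable under products with ratios of coordinates.\<close>

inductive exp_sum :: "('v::euclidean_space \<Rightarrow> real) \<Rightarrow> bool" where
  zero: "exp_sum (\<lambda>_. 0)"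
| mono: "exp_sum (\<lambda>x. exp (c \<bullet> x))"
| add: "exp_sum f \<Longrightarrow> exp_sum g \<Longrightarrow> exp_sum (\<lambda>x. f x + g x)"

lemma exp_sum_nonneg: "exp_sum f \<Longrightarrow> f x \<ge> 0"
  by (induction rule: exp_sum.induct) auto

lemma exp_sum_mult_exp: "exp_sum f \<Longrightarrow> exp_sum (\<lambda>x. f x * exp (c \<bullet> x))"
proof (induction rule: exp_sum.induct)
  case zero
  then show ?case using exp_sum.zero by simp
next
  case (mono d)
  then show ?case using exp_sum.mono[of "d + c"] by (simp add: exp_add inner_add_left)
next
  case (add f g)
  then show ?case using exp_sum.add by (simp add: distrib_right)
qed

lemma exp_sum_1: "exp_sum (\<lambda>_. 1)"
  using exp_sum.mono[of 0] by simp

lemma exp_sum_ratio: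
  assumes "exp_sum f"
  shows "exp_sum (\<lambda>x :: real^'n. f x * (exp (x $ i) / exp (x $ j)))"
proof -
  have "(axis i 1 - axis j 1 :: real^'n) \<bullet> x = x $ i - x $ j" for x
    by (simp add: inner_diff_left inner_axis')
  then show ?thesis using exp_sum_mult_exp[OF assms, of "axis i 1 - axis j 1"] by (simp add: exp_diff)
qed

lemma exp_sum_times_coordinate:
  assumes "exp_sum f"
  shows "exp_sum (\<lambda>x :: real^'n. f x * exp (x $ i))"
  using exp_sum_mult_exp[OF assms, of "axis i 1"] by (simp add: inner_axis')

lemma exp_sum_sum: "(\<And>a. a \<in> A \<Longrightarrow> exp_sum (f a)) \<Longrightarrow> exp_sum (\<lambda>x. \<Sum>a\<in>A. f a x)"
  by (induction A rule: infinite_finite_induct) (auto intro: exp_sum.intros)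

lemma exp_midpoint_less:
  fixes s t :: real
  assumes "s \<noteq> t"
  shows "exp ((s + t) / 2) < (exp s + exp t) / 2"
proof -
  have "exp (s / 2) \<noteq> exp (t / 2)" using assms by simp
  then have "(exp (s / 2) - exp (t / 2))\<^sup>2 > 0" by simp
  moreover have "exp s = exp (s / 2) * exp (s / 2)" "exp t = exp (t / 2) * exp (t / 2)"
    "exp ((s + t) / 2) = exp (s / 2) * exp (t / 2)"
    by (simp_all flip: exp_add add: add_divide_distrib)
  ultimately show ?thesis by (simp add: power2_eq_square algebra_simps)
qed

lemma exp_sum_midpoint: "exp_sum f \<Longrightarrow> f ((1/2) *\<^sub>R (x + y)) \<le> (f x + f y) / 2"
proof (induction rule: exp_sum.induct)
  case (mono c)
  have "c \<bullet> ((1/2) *\<^sub>R (x + y)) = (c \<bullet> x + c \<bullet> y) / 2" by (simp add: inner_add_right)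
  then show ?case using exp_midpoint_less[of "c \<bullet> x" "c \<bullet> y"] by (cases "c \<bullet> x = c \<bullet> y") auto
qed (auto simp: add_divide_distrib)

lemma exp_sum_continuous: "exp_sum f \<Longrightarrow> continuous_on UNIV f"
  by (induction rule: exp_sum.induct) (auto intro!: continuous_intros)

definition signed_exp_sum :: "('v::euclidean_space \<Rightarrow> real) \<Rightarrow> bool" where
  "signed_exp_sum f \<longleftrightarrow> exp_sum f \<or> exp_sum (\<lambda>x. - f x)"

section \<open>The developed triangulation\<close>

definition cross :: "complex \<Rightarrow> complex \<Rightarrow> real" where
  "cross u v = Re u * Im v - Im u * Re v"

lemma cross_simps:
  "cross (- u) v = - cross u v" "cross u (- v) = - cross u v"
  "cross (u + w) v = cross u v + cross w v" "cross u (v + w) = cross u v + cross u w"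
  "cross (r *\<^sub>R u) v = r * cross u v" "cross u (r *\<^sub>R v) = r * cross u v"
  "cross u u = 0"
  by (simp_all add: cross_def algebra_simps)

lemma cross_diff: "cross u (v - w) = cross u v - cross u w"
  by (simp add: cross_def algebra_simps)

lemma cross_swap: "cross v u = - cross u v"
  by (simp add: cross_def)

text \<open>Read with lambda lengths as determinants, this is Ptolemy's relation, which is the exchange
  relation of a flip.\<close>

lemma cross_pluecker: "cross u v * cross y z = cross u y * cross v z - cross u z * cross v y"
  by (simp add: cross_def algebra_simps)

text \<open>The developing map depends on the point of Teichmueller space, so a vertex of the developed
  triangulation is a vector depending on the logarithms of the initial coordinates. The two
  vectors of an edge matter only up to a common sign.\<close>

type_synonym 'i vertex = "(real, 'i) vec \<Rightarrow> complex"
type_synonym 'i edge = "'i vertex \<times> 'i vertex \<times> 'i dart"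

lemma vertex_uminus [simp]:
  fixes u v :: "'i::finite vertex"
  shows "- (- u) = u" "- u = - v \<longleftrightarrow> u = v"
  by (auto simp: fun_eq_iff)

context gluing
begin

definition len :: "'i dart \<Rightarrow> real^'i \<Rightarrow> real" where
  "len e x = exp (x $ fst e)"

lemma len_pos [simp]: "len e x > 0" "len e x \<noteq> 0" by (simp_all add: len_def)

text \<open>The third vertex \<open>z\<close> of the triangle on the left of the edge from \<open>u\<close> to \<open>v\<close>, determined by
  the required determinants \<open>cross v z = len (\<sigma> e)\<close> and \<open>cross u z = len (\<sigma> (\<sigma> e))\<close>.\<close>

definition apex :: "'i dart \<Rightarrow> 'i vertex \<Rightarrow> 'i vertex \<Rightarrow> 'i vertex" where
  "apex e u v = (\<lambda>x. (len (\<sigma> (\<sigma> e)) x / len e x) *\<^sub>R v x - (len (\<sigma> e) x / len e x) *\<^sub>R u x)"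

lemma apex_uminus: "apex e (- u) (- v) = - apex e u v"
  by (simp add: apex_def fun_eq_iff)

lemma apex_apex: "apex (\<sigma> e) v (apex e u v) = - u"
  by (simp add: apex_def fun_eq_iff cube scaleR_diff_right)

lemma apex_apex_apex: "apex (\<sigma> (\<sigma> e)) (apex e u v) (- u) = - v"
  by (simp add: apex_def fun_eq_iff cube scaleR_diff_right)

text \<open>Moves between lifted darts: to the other side of the edge, and to the next side of the
  triangle. With the minus sign, the determinant of the two end points stays positive.\<close>

inductive dstep :: "'i edge \<Rightarrow> 'i edge \<Rightarrow> bool" where
  turn: "dstep (u, v, e) (- v, u, opp e)"
| advance: "dstep (u, v, e) (v, apex e u v, \<sigma> e)"

lemma developed_next2: "dstep\<^sup>*\<^sup>* d (u, v, e) \<Longrightarrow> dstep\<^sup>*\<^sup>* d (apex e u v, - u, \<sigma> (\<sigma> e))"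
  using dstep.advance[of u v e] dstep.advance[of v "apex e u v" "\<sigma> e"]
  by (simp add: apex_apex rtranclp.rtrancl_into_rtrancl)

lemma developed_uminus: "dstep\<^sup>*\<^sup>* d (u, v, e) \<Longrightarrow> dstep\<^sup>*\<^sup>* d (- u, - v, e)"
  using dstep.turn[of u v e] dstep.turn[of "- v" u "opp e"]
  by (simp add: rtranclp.rtrancl_into_rtrancl)

lemma developed_turn: "dstep\<^sup>*\<^sup>* d (u, v, e) \<Longrightarrow> dstep\<^sup>*\<^sup>* d (- v, u, opp e)"
  by (erule rtranclp.rtrancl_into_rtrancl) (rule dstep.turn)

lemma developed_next: "dstep\<^sup>*\<^sup>* d (u, v, e) \<Longrightarrow> dstep\<^sup>*\<^sup>* d (v, apex e u v, \<sigma> e)"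
  by (erule rtranclp.rtrancl_into_rtrancl) (rule dstep.advance)

text \<open>Up to sign, turning twice and advancing three times are trivial.\<close>

lemma dstep_reversible: "dstep d d' \<Longrightarrow> dstep\<^sup>*\<^sup>* d' d"
proof (induction rule: dstep.induct)
  case (turn u v e)
  show ?case
    using developed_uminus[OF developed_turn[of "(- v, u, opp e)" "- v" u "opp e"]] by simp
next
  case (advance u v e)
  have "dstep\<^sup>*\<^sup>* (v, apex e u v, \<sigma> e) (- u, - v, e)"
    using developed_next2[of "(v, apex e u v, \<sigma> e)" v "apex e u v" "\<sigma> e"]
    by (simp add: apex_apex cube)
  then show ?case using developed_uminus by fastforce
qed

lemma developed_sym: "dstep\<^sup>*\<^sup>* d d' \<Longrightarrow> dstep\<^sup>*\<^sup>* d' d"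
  by (induction rule: rtranclp_induct) (auto intro: dstep_reversible rtranclp_trans)

lemma developed_cross:
  assumes "dstep\<^sup>*\<^sup>* (u0, v0, e0) (u, v, e)" "\<And>x. cross (u0 x) (v0 x) = len e0 x"
  shows "cross (u x) (v x) = len e x"
  using assms(1)
proof (induction "(u, v, e)" arbitrary: u v e rule: rtranclp_induct)
  case base
  then show ?case using assms(2) by simp
next
  case (step d)
  from step(2) show ?case
  proof cases
    case (turn v' e')
    then have "cross (v x) (v' x) = len e' x" using step(3) by simp
    then show ?thesis using turn by (simp add: cross_simps len_def cross_swap[of "v' x" "v x"])
  next
    case (advance u' e')
    then have "cross (u' x) (u x) = len e' x" using step(3) by simp
    then show ?thesis
      using advance cross_swap[of "u x" "u' x"] by (simp add: apex_def cross_diff cross_simps)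
  qed
qed

text \<open>The lifted darts reached from a starting dart by paths that never backtrack. Such a dart
  has the starting vertex on its right; after crossing the triangle on its left, one may leave
  it through either of the other two sides.\<close>

inductive outward :: "'i vertex \<Rightarrow> 'i vertex \<Rightarrow> 'i dart \<Rightarrow> 'i vertex \<Rightarrow> 'i vertex \<Rightarrow> 'i dart \<Rightarrow> bool"
  for u0 v0 e0 where
  start: "outward u0 v0 e0 u0 v0 e0"
| start': "outward u0 v0 e0 (- v0) u0 (opp e0)"
| left: "outward u0 v0 e0 u v e \<Longrightarrow> outward u0 v0 e0 (- apex e u v) v (opp (\<sigma> e))"
| right: "outward u0 v0 e0 u v e \<Longrightarrow> outward u0 v0 e0 u (apex e u v) (opp (\<sigma> (\<sigma> e)))"

definition positive_span :: "'i vertex \<Rightarrow> 'i vertex \<Rightarrow> 'i vertex \<Rightarrow> bool" where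
  "positive_span w u v \<longleftrightarrow> (\<exists>\<alpha> \<beta>. exp_sum \<alpha> \<and> exp_sum \<beta> \<and> (\<forall>x. w x = \<alpha> x *\<^sub>R u x + \<beta> x *\<^sub>R v x))"

text \<open>Solving for \<open>u\<close> in terms of \<open>v\<close> and the apex, or for \<open>v\<close> in terms of \<open>u\<close> and the apex,
  turns a positive combination of \<open>u\<close> and \<open>v\<close> into a positive combination of the end points of
  the next outward edge, and only involves ratios of lengths.\<close>

lemma outward_positive_span:
  "outward u0 v0 e0 u v e \<Longrightarrow> positive_span u0 u v \<or> positive_span (- u0) u v"
proof (induction rule: outward.induct)
  case start
  have "positive_span u0 u0 v0"
    unfolding positive_span_def
    by (rule exI[of _ "\<lambda>_. 1"], rule exI[of _ "\<lambda>_. 0"]) (simp add: exp_sum_1 exp_sum.zero)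
  then show ?case ..
next
  case start'
  have "positive_span u0 (- v0) u0"
    unfolding positive_span_def
    by (rule exI[of _ "\<lambda>_. 0"], rule exI[of _ "\<lambda>_. 1"]) (simp add: exp_sum_1 exp_sum.zero)
  then show ?case ..
next
  case (left u v e)
  have "positive_span w (- apex e u v) v" if span: "positive_span w u v" for w
  proof -
    obtain \<alpha> \<beta> where ab: "exp_sum \<alpha>" "exp_sum \<beta>" "\<And>x. w x = \<alpha> x *\<^sub>R u x + \<beta> x *\<^sub>R v x"
      using span unfolding positive_span_def by blast
    define \<alpha>' \<beta>' where "\<alpha>' = (\<lambda>x. \<alpha> x * (len e x / len (\<sigma> e) x))"
      and "\<beta>' = (\<lambda>x. \<alpha> x * (len (\<sigma> (\<sigma> e)) x / len (\<sigma> e) x) + \<beta> x)"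
    have "exp_sum \<alpha>'" "exp_sum \<beta>'"
      unfolding \<alpha>'_def \<beta>'_def len_def by (intro exp_sum_ratio exp_sum.add ab)+
    moreover have "w x = \<alpha>' x *\<^sub>R (- apex e u v) x + \<beta>' x *\<^sub>R v x" for x
      unfolding ab(3) \<alpha>'_def \<beta>'_def apex_def by (simp add: scaleR_diff_right scaleR_add_left)
    ultimately show ?thesis unfolding positive_span_def by blast
  qed
  then show ?case using left.IH by blast
next
  case (right u v e)
  have "positive_span w u (apex e u v)" if span: "positive_span w u v" for w
  proof -
    obtain \<alpha> \<beta> where ab: "exp_sum \<alpha>" "exp_sum \<beta>" "\<And>x. w x = \<alpha> x *\<^sub>R u x + \<beta> x *\<^sub>R v x"
      using span unfolding positive_span_def by blast
    define \<alpha>' \<beta>' where "\<alpha>' = (\<lambda>x. \<alpha> x + \<beta> x * (len (\<sigma> e) x / len (\<sigma> (\<sigma> e)) x))"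
      and "\<beta>' = (\<lambda>x. \<beta> x * (len e x / len (\<sigma> (\<sigma> e)) x))"
    have "exp_sum \<alpha>'" "exp_sum \<beta>'"
      unfolding \<alpha>'_def \<beta>'_def len_def by (intro exp_sum_ratio exp_sum.add ab)+
    moreover have "w x = \<alpha>' x *\<^sub>R u x + \<beta>' x *\<^sub>R apex e u v x" for x
      unfolding ab(3) \<alpha>'_def \<beta>'_def apex_def by (simp add: scaleR_diff_right scaleR_add_left)
    ultimately show ?thesis unfolding positive_span_def by blast
  qed
  then show ?case using right.IH by blast
qed

text \<open>One of the two darts of the edge points outward, where end points only matter up to a
  common sign.\<close>

definition visible :: "'i vertex \<Rightarrow> 'i vertex \<Rightarrow> 'i dart \<Rightarrow> 'i vertex \<Rightarrow> 'i vertex \<Rightarrow> 'i dart \<Rightarrow> bool" where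
  "visible u0 v0 e0 u v e \<longleftrightarrow>
     outward u0 v0 e0 u v e \<or> outward u0 v0 e0 (- u) (- v) e \<or>
     outward u0 v0 e0 (- v) u (opp e) \<or> outward u0 v0 e0 v (- u) (opp e)"

lemma visible_uminus: "visible u0 v0 e0 (- u) (- v) e \<longleftrightarrow> visible u0 v0 e0 u v e"
  unfolding visible_def by auto

lemma visible_turn: "visible u0 v0 e0 u v e \<Longrightarrow> visible u0 v0 e0 (- v) u (opp e)"
  unfolding visible_def by auto

lemma visible_next_outward:
  assumes "outward u0 v0 e0 u v e"
  shows "visible u0 v0 e0 v (apex e u v) (\<sigma> e)"
  using outward.left[OF assms] unfolding visible_def by auto

text \<open>An inward dart returns to the triangle from which the outward walk came, and the other
  sides of that triangle have been reached before.\<close>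

lemma visible_next_inward:
  assumes "outward u0 v0 e0 (- v) u (opp e)"
  shows "visible u0 v0 e0 v (apex e u v) (\<sigma> e)"
  using assms
proof cases
  case start
  then have "outward u0 v0 e0 (- u) (- v) e" using outward.start'[of u0 v0 e0] opp_opp[of e] by simp
  then show ?thesis
    using visible_next_outward[of u0 v0 e0 "- u" "- v" e] by (simp add: apex_uminus visible_uminus)
next
  case start'
  then have "u = u0" "v = v0" "e = e0" by (simp, simp, metis opp_opp)
  then show ?thesis using visible_next_outward outward.start by metis
next
  case (left u' e')
  then have eq: "v = apex e' u' u" "e = \<sigma> e'" by (metis vertex_uminus(1), metis opp_opp)
  have "outward u0 v0 e0 u' (apex e' u' u) (opp (\<sigma> (\<sigma> e')))" using left outward.right by blast
  then show ?thesis unfolding eq apex_apex visible_def by simp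
next
  case (right v' e')
  then have eq: "u = apex e' (- v) v'" "e = \<sigma> (\<sigma> e')" by (simp, metis opp_opp)
  have "apex e u v = - v'" using apex_apex_apex[of e' "- v" v'] by (simp add: eq)
  then show ?thesis using right unfolding eq cube visible_def by simp
qed

lemma visible_next:
  assumes "visible u0 v0 e0 u v e"
  shows "visible u0 v0 e0 v (apex e u v) (\<sigma> e)"
proof -
  consider "outward u0 v0 e0 u v e" | "outward u0 v0 e0 (- u) (- v) e"
    | "outward u0 v0 e0 (- v) u (opp e)" | "outward u0 v0 e0 (- (- v)) (- u) (opp e)"
    using assms unfolding visible_def by auto
  then show ?thesis
  proof cases
    case 1
    then show ?thesis by (rule visible_next_outward)
  next
    case 2
    from visible_next_outward[OF this] show ?thesis by (simp add: apex_uminus visible_uminus)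
  next
    case 3
    then show ?thesis by (rule visible_next_inward)
  next
    case 4
    from visible_next_inward[OF this] show ?thesis by (simp add: apex_uminus visible_uminus)
  qed
qed

lemma developed_visible:
  "dstep\<^sup>*\<^sup>* (u0, v0, e0) (u, v, e) \<Longrightarrow> visible u0 v0 e0 u v e"
proof (induction "(u, v, e)" arbitrary: u v e rule: rtranclp_induct)
  case base
  show ?case using outward.start by (simp add: visible_def)
next
  case (step d)
  from step(2) show ?case
  proof cases
    case (turn v' e')
    then show ?thesis using step(3) visible_turn by simp
  next
    case (advance u' e')
    then show ?thesis using step(3) visible_next by simp
  qed
qed

lemma signed_exp_sum_cross:
  assumes span: "positive_span w u v \<or> positive_span (- w) u v"
    and cross: "\<And>x. cross (u x) (v x) = len e x"
  shows "signed_exp_sum (\<lambda>x. cross (w x) (u x))" "signed_exp_sum (\<lambda>x. cross (w x) (v x))"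
proof -
  have pos: "exp_sum (\<lambda>x. - cross (w x) (u x)) \<and> exp_sum (\<lambda>x. cross (w x) (v x))"
    if span: "positive_span w u v" for w
  proof -
    obtain \<alpha> \<beta> where ab: "exp_sum \<alpha>" "exp_sum \<beta>" "\<And>x. w x = \<alpha> x *\<^sub>R u x + \<beta> x *\<^sub>R v x"
      using span unfolding positive_span_def by blast
    have "- cross (w x) (u x) = \<beta> x * len e x" "cross (w x) (v x) = \<alpha> x * len e x" for x
      using cross[of x] cross_swap[of "v x" "u x"] by (simp_all add: ab(3) cross_simps)
    then show ?thesis by (simp add: len_def exp_sum_times_coordinate ab(1,2))
  qed
  from span show "signed_exp_sum (\<lambda>x. cross (w x) (u x))" "signed_exp_sum (\<lambda>x. cross (w x) (v x))"
    using pos[of w] pos[of "- w"] unfolding signed_exp_sum_def by (auto simp: cross_simps)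
qed

text \<open>Every lifted dart can serve as the start of the outward walk, because the moves are
  reversible. So one may start at \<open>w\<close> and walk to \<open>u\<close>.\<close>

lemma developed_cross_signed_exp_sum:
  assumes start: "\<And>x. cross (u0 x) (v0 x) = len e0 x"
    and w: "dstep\<^sup>*\<^sup>* (u0, v0, e0) (w, w', e')" and u: "dstep\<^sup>*\<^sup>* (u0, v0, e0) (u, v, e)"
  shows "signed_exp_sum (\<lambda>x. cross (w x) (u x))"
proof -
  have cw: "cross (w x) (w' x) = len e' x" for x by (rule developed_cross[OF w start])
  have cu: "cross (u x) (v x) = len e x" for x by (rule developed_cross[OF u start])
  have cu': "cross (- v x) (u x) = len e x" for x using cu[of x] by (simp add: cross_def algebra_simps)
  have "dstep\<^sup>*\<^sup>* (w, w', e') (u, v, e)" using developed_sym[OF w] u by (rule rtranclp_trans)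
  then have "visible w w' e' u v e" by (rule developed_visible)
  then consider "outward w w' e' u v e" | "outward w w' e' (- u) (- v) e"
    | "outward w w' e' (- v) u (opp e)" | "outward w w' e' v (- u) (opp e)"
    unfolding visible_def by blast
  then show ?thesis
  proof cases
    case 1
    from signed_exp_sum_cross(1)[OF outward_positive_span[OF 1] cu] show ?thesis .
  next
    case 2
    from signed_exp_sum_cross(1)[OF outward_positive_span[OF 2], of e] cu
    show ?thesis by (auto simp: cross_simps signed_exp_sum_def)
  next
    case 3
    from signed_exp_sum_cross(2)[OF outward_positive_span[OF 3], of e] cu'
    show ?thesis by (simp add: cross_simps)
  next
    case 4
    from signed_exp_sum_cross(2)[OF outward_positive_span[OF 4], of e] cu'
    show ?thesis by (auto simp: cross_simps signed_exp_sum_def)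
  qed
qed

end

section \<open>Flipping the developed triangulation\<close>

text \<open>A lift \<open>L\<close> of the gluing \<open>\<sigma>\<close> to edges between vertices in a fixed set \<open>V\<close>, whose
  determinants are the coordinates \<open>l\<close>. Flips change the edges but not \<open>V\<close>, which keeps the
  vertices of the initial triangulation.\<close>

locale development = gluing \<sigma> for \<sigma> :: "'i::finite dart \<Rightarrow> 'i dart" +
  fixes V :: "'i vertex set" and l :: "'i \<Rightarrow> real^'i \<Rightarrow> real" and L :: "'i edge set"
  assumes vertices: "(u, v, e) \<in> L \<Longrightarrow> u \<in> V \<and> v \<in> V"
    and lengths: "(u, v, e) \<in> L \<Longrightarrow> cross (u x) (v x) = l (fst e) x"
    and turned: "(u, v, e) \<in> L \<Longrightarrow> (- v, u, opp e) \<in> L"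
    and third: "(u, v, e) \<in> L \<Longrightarrow> \<exists>z. (v, z, \<sigma> e) \<in> L \<and> (z, - u, \<sigma> (\<sigma> e)) \<in> L"
    and lifted: "\<exists>u v. (u, v, e) \<in> L"

lemma (in gluing) development_initial:
  assumes start: "\<And>x. cross (u0 x) (v0 x) = len e0 x"
  shows "development \<sigma> {u. \<exists>v e. dstep\<^sup>*\<^sup>* (u0, v0, e0) (u, v, e)} (\<lambda>i x. exp (x $ i))
    {(u, v, e). dstep\<^sup>*\<^sup>* (u0, v0, e0) (u, v, e)}"
proof
  fix u v e
  assume "(u, v, e) \<in> {(u, v, e). dstep\<^sup>*\<^sup>* (u0, v0, e0) (u, v, e)}"
  then have d: "dstep\<^sup>*\<^sup>* (u0, v0, e0) (u, v, e)" by simp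
  show "u \<in> {u. \<exists>v e. dstep\<^sup>*\<^sup>* (u0, v0, e0) (u, v, e)} \<and> v \<in> {u. \<exists>v e. dstep\<^sup>*\<^sup>* (u0, v0, e0) (u, v, e)}"
    using d developed_next[OF d] by blast
  show "cross (u x) (v x) = exp (x $ fst e)" for x
    using developed_cross[OF d start] by (simp add: len_def)
  show "(- v, u, opp e) \<in> {(u, v, e). dstep\<^sup>*\<^sup>* (u0, v0, e0) (u, v, e)}"
    using developed_turn[OF d] by simp
  show "\<exists>z. (v, z, \<sigma> e) \<in> {(u, v, e). dstep\<^sup>*\<^sup>* (u0, v0, e0) (u, v, e)}
      \<and> (z, - u, \<sigma> (\<sigma> e)) \<in> {(u, v, e). dstep\<^sup>*\<^sup>* (u0, v0, e0) (u, v, e)}"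
    using developed_next[OF d] developed_next2[OF d] by blast
next
  fix e
  let ?X = "{e. \<exists>u v. dstep\<^sup>*\<^sup>* (u0, v0, e0) (u, v, e)}"
  have "?X = {} \<or> ?X = UNIV"
  proof (rule one_vertex)
    fix e assume "e \<in> ?X"
    then obtain u v where "dstep\<^sup>*\<^sup>* (u0, v0, e0) (u, v, e)" by blast
    from developed_next[OF developed_turn[OF this]] show "\<sigma> (opp e) \<in> ?X" by blast
  qed
  moreover have "e0 \<in> ?X" by blast
  ultimately have "e \<in> ?X" by blast
  then show "\<exists>u v. (u, v, e) \<in> {(u, v, e). dstep\<^sup>*\<^sup>* (u0, v0, e0) (u, v, e)}" by simp
qed

context development
begin

lemma negated: "(u, v, e) \<in> L \<Longrightarrow> (- u, - v, e) \<in> L"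
  using turned[of u v e] turned[of "- v" u "opp e"] by simp

text \<open>A lifted quadrilateral with diagonal from \<open>u\<close> to \<open>v\<close>, and \<open>z\<close>, \<open>y\<close> the other vertices on
  the left and on the right.\<close>

definition quad_lift :: "'i vertex \<Rightarrow> 'i vertex \<Rightarrow> 'i vertex \<Rightarrow> 'i vertex \<Rightarrow> 'i dart \<Rightarrow> bool" where
  "quad_lift u v y z \<kappa> \<longleftrightarrow> (u, v, \<kappa>) \<in> L \<and> (v, z, \<sigma> \<kappa>) \<in> L \<and> (z, - u, \<sigma> (\<sigma> \<kappa>)) \<in> L \<and>
     (u, y, \<sigma> (opp \<kappa>)) \<in> L \<and> (y, v, \<sigma> (\<sigma> (opp \<kappa>))) \<in> L"

lemma quad_lift_turned: "quad_lift u v y z \<kappa> \<Longrightarrow> quad_lift (- v) u (- z) y (opp \<kappa>)"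
  unfolding quad_lift_def using turned negated by fastforce

lemma quad_lift_cross:
  assumes "quad_lift u v y z \<kappa>"
  shows "l (fst \<kappa>) x * cross (y x) (z x) = l (fst (\<sigma> \<kappa>)) x * l (fst (\<sigma> (opp \<kappa>))) x
    + l (fst (\<sigma> (\<sigma> \<kappa>))) x * l (fst (\<sigma> (\<sigma> (opp \<kappa>)))) x"
proof -
  have q: "cross (u x) (v x) = l (fst \<kappa>) x" "cross (v x) (z x) = l (fst (\<sigma> \<kappa>)) x"
    "cross (z x) (- u x) = l (fst (\<sigma> (\<sigma> \<kappa>))) x"
    "cross (u x) (y x) = l (fst (\<sigma> (opp \<kappa>))) x" "cross (y x) (v x) = l (fst (\<sigma> (\<sigma> (opp \<kappa>)))) x"
    using assms lengths[of _ _ _ x] unfolding quad_lift_def by fastforce+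
  have "cross (u x) (z x) = l (fst (\<sigma> (\<sigma> \<kappa>))) x"
    using q(3) cross_swap[of "u x" "z x"] by (simp add: cross_simps)
  moreover have "cross (v x) (y x) = - l (fst (\<sigma> (\<sigma> (opp \<kappa>)))) x"
    using q(5) cross_swap[of "v x" "y x"] by simp
  ultimately show ?thesis
    using cross_pluecker[of "u x" "v x" "y x" "z x"] q by simp
qed

lemma quad_lift_exists:
  assumes "(u, v, \<kappa>) \<in> L"
  obtains y z where "quad_lift u v y z \<kappa>"
proof -
  obtain z where z: "(v, z, \<sigma> \<kappa>) \<in> L" "(z, - u, \<sigma> (\<sigma> \<kappa>)) \<in> L" using third[OF assms] by blast
  obtain y where y: "(u, y, \<sigma> (opp \<kappa>)) \<in> L" "(y, - (- v), \<sigma> (\<sigma> (opp \<kappa>))) \<in> L"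
    using third[OF turned[OF assms]] by blast
  show thesis by (rule that[of y z]) (use assms y z in \<open>simp add: quad_lift_def\<close>)
qed

definition flipped :: "'i \<Rightarrow> 'i edge set" where
  "flipped k = {(u, v, e) \<in> L. fst e \<noteq> k} \<union>
     {(y, z, \<kappa>). fst \<kappa> = k \<and> (\<exists>u v. quad_lift u v y z \<kappa>)}"

text \<open>The lifted quadrilaterals keep their sides and change their diagonals; the length of the
  new diagonal is given by Ptolemy's relation.\<close>

lemma development_flip:
  assumes pos: "\<And>j x. l j x > 0"
    and same: "\<And>j. j \<noteq> k \<Longrightarrow> l' j = l j"
    and new: "\<And>\<kappa> x. fst \<kappa> = k \<Longrightarrow> l' k x = (l (fst (\<sigma> \<kappa>)) x * l (fst (\<sigma> (opp \<kappa>))) x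
      + l (fst (\<sigma> (\<sigma> \<kappa>))) x * l (fst (\<sigma> (\<sigma> (opp \<kappa>)))) x) / l k x"
  shows "development (flip k \<sigma>) V l' (flipped k)"
proof (intro development.intro development_axioms.intro)
  show "gluing (flip k \<sigma>)" by (rule gluing_flip)
next
  fix u v e assume "(u, v, e) \<in> flipped k"
  then show "u \<in> V \<and> v \<in> V"
    unfolding flipped_def quad_lift_def using vertices by blast
next
  fix u v e x assume "(u, v, e) \<in> flipped k"
  then consider "(u, v, e) \<in> L" "fst e \<noteq> k" | w w' where "fst e = k" "quad_lift w w' u v e"
    unfolding flipped_def by blast
  then show "cross (u x) (v x) = l' (fst e) x"
  proof cases
    case 1
    then show ?thesis using lengths same by simp
  next
    case 2
    have "l k x \<noteq> 0" using pos[of k x] by simp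
    moreover from this have "l k x * cross (u x) (v x) = l k x * l' k x"
      using quad_lift_cross[OF 2(2), of x] new[OF 2(1), of x] 2(1) by simp
    ultimately show ?thesis using 2(1) by simp
  qed
next
  fix u v e assume "(u, v, e) \<in> flipped k"
  then consider "(u, v, e) \<in> L" "fst e \<noteq> k" | w w' where "fst e = k" "quad_lift w w' u v e"
    unfolding flipped_def by blast
  then show "(- v, u, opp e) \<in> flipped k"
  proof cases
    case 1
    then show ?thesis using turned[OF 1(1)] by (simp add: flipped_def)
  next
    case 2
    then show ?thesis using quad_lift_turned[OF 2(2)] by (auto simp: flipped_def)
  qed
next
  fix e
  show "\<exists>u v. (u, v, e) \<in> flipped k"
  proof (cases "fst e = k")
    case True
    obtain u v where "(u, v, e) \<in> L" using lifted by blast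
    then obtain y z where "quad_lift u v y z e" by (rule quad_lift_exists)
    then show ?thesis using True unfolding flipped_def by blast
  next
    case False
    then show ?thesis using lifted[of e] unfolding flipped_def by blast
  qed
next
  fix u v e assume uve: "(u, v, e) \<in> flipped k"
  have old: "(u, v, e) \<in> flipped k \<longleftrightarrow> (u, v, e) \<in> L" if "fst e \<noteq> k" for u v e
    using that unfolding flipped_def by auto
  have diag: "(y, z, \<kappa>) \<in> flipped k" if "fst \<kappa> = k" "quad_lift u v y z \<kappa>" for u v y z \<kappa>
    using that unfolding flipped_def by auto
  define \<kappa>0 where "\<kappa>0 = (k, True)"
  have "fst \<kappa>0 = k" by (simp add: \<kappa>0_def)
  from flip_site_at[OF this] interpret s0: flip_site \<sigma> k \<kappa>0 "\<sigma> \<kappa>0" "\<sigma> (\<sigma> \<kappa>0)" "\<sigma> (opp \<kappa>0)" "\<sigma> (\<sigma> (opp \<kappa>0))" .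
  show "\<exists>z. (v, z, flip k \<sigma> e) \<in> flipped k \<and> (z, - u, flip k \<sigma> (flip k \<sigma> e)) \<in> flipped k"
  proof (cases "e \<in> s0.site")
    case False
    note off = s0.fst_notin_site s0.next_notin_site s0.flip_notin_site
    obtain z where "(v, z, \<sigma> e) \<in> L" "(z, - u, \<sigma> (\<sigma> e)) \<in> L"
      using third uve old[OF off(1)[OF False]] by blast
    then show ?thesis
      unfolding off(3)[OF False] off(3)[OF off(2)[OF False]]
      using old[OF off(1)[OF off(2)[OF False]]] old[OF off(1)[OF off(2)[OF off(2)[OF False]]]] by blast
  next
    case True
    then obtain \<kappa> where \<kappa>: "fst \<kappa> = k" "e = \<kappa> \<or> e = \<sigma> (\<sigma> \<kappa>) \<or> e = \<sigma> (opp \<kappa>)"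
      using s0.k by (metis fst_opp insertE opp_opp singletonD)
    define a b c d where abcd: "a = \<sigma> \<kappa>" "b = \<sigma> (\<sigma> \<kappa>)" "c = \<sigma> (opp \<kappa>)" "d = \<sigma> (\<sigma> (opp \<kappa>))"
    from flip_site_at[OF \<kappa>(1)] have site: "flip_site \<sigma> k \<kappa> a b c d" unfolding abcd .
    note nx = flip_site.next_simps[OF site] and fl = flip_site.flip_site_simps[OF site]
      and nk = flip_site.fst_site[OF site]
    have quadI: "quad_lift u v y z \<kappa>" if "(u, v, \<kappa>) \<in> L" "(v, z, a) \<in> L" "(z, - u, b) \<in> L"
      "(u, y, c) \<in> L" "(y, v, d) \<in> L" for u v y z
      using that by (simp add: quad_lift_def nx)
    from \<kappa>(2) consider "e = \<kappa>" | "e = b" | "e = c" by (auto simp: abcd)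
    then show ?thesis
    proof cases
      case 1
      then obtain w w' where "quad_lift w w' u v \<kappa>" using uve \<kappa>(1) unfolding flipped_def by blast
      then have "(v, - w, b) \<in> L" "(w, u, c) \<in> L" by (simp_all add: quad_lift_def nx)
      then have "(v, - w, b) \<in> flipped k" "(- w, - u, c) \<in> flipped k"
        using old nk negated by auto
      then show ?thesis unfolding 1 fl by blast
    next
      case 2
      have 0: "(u, v, b) \<in> L" using uve old[OF nk(2)] 2 by simp
      then obtain z where z: "(v, z, \<kappa>) \<in> L" "(z, - u, a) \<in> L" using third nx by metis
      obtain y where y: "(v, y, c) \<in> L" "(y, - (- z), d) \<in> L" using third[OF turned[OF z(1)]] nx by metis
      have "quad_lift v z y (- u) \<kappa>"
        by (rule quadI) (use z y negated[OF 0] in simp_all)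
      from diag[OF \<kappa>(1) this] show ?thesis unfolding 2 fl using y(1) old[OF nk(3)] by blast
    next
      case 3
      have 0: "(u, v, c) \<in> L" using uve old[OF nk(3)] 3 by simp
      then obtain z where z: "(v, z, d) \<in> L" "(z, - u, opp \<kappa>) \<in> L" using third nx by metis
      have z': "(u, z, \<kappa>) \<in> L" using turned[OF z(2)] by simp
      obtain q where q: "(z, q, a) \<in> L" "(q, - u, b) \<in> L" using third[OF z'] nx by metis
      have "quad_lift u z v q \<kappa>"
        by (rule quadI) (use z z' q 0 in simp_all)
      from diag[OF \<kappa>(1) this] show ?thesis unfolding 3 fl using q(2) old[OF nk(2)] by blast
    qed
  qed
qed

end

lemma (in development) development_relabel:
  assumes "bij \<pi>"
  shows "development (conjugate (relabel_dart \<pi>) \<sigma>) V (l \<circ> \<pi>) {(u, v, e). (u, v, relabel_dart \<pi> e) \<in> L}"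
proof -
  interpret r: dart_relabelling \<sigma> "relabel_dart \<pi>" \<pi> using assms by (rule relabel_dart_relabelling)
  show ?thesis
  proof (intro development.intro development_axioms.intro r.gluing_conjugate)
    fix u v e assume "(u, v, e) \<in> {(u, v, e). (u, v, relabel_dart \<pi> e) \<in> L}"
    then have uve: "(u, v, relabel_dart \<pi> e) \<in> L" by simp
    show "u \<in> V \<and> v \<in> V" using vertices[OF uve] .
    show "cross (u x) (v x) = (l \<circ> \<pi>) (fst e) x" for x using lengths[OF uve] by (simp add: r.fst)
    show "(- v, u, opp e) \<in> {(u, v, e). (u, v, relabel_dart \<pi> e) \<in> L}"
      using turned[OF uve] by (simp add: r.opp)
    show "\<exists>z. (v, z, conjugate (relabel_dart \<pi>) \<sigma> e) \<in> {(u, v, e). (u, v, relabel_dart \<pi> e) \<in> L} \<and>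
        (z, - u, conjugate (relabel_dart \<pi>) \<sigma> (conjugate (relabel_dart \<pi>) \<sigma> e))
          \<in> {(u, v, e). (u, v, relabel_dart \<pi> e) \<in> L}"
      using third[OF uve] by (simp add: r.theta_conjugate)
  next
    fix e
    show "\<exists>u v. (u, v, e) \<in> {(u, v, e). (u, v, relabel_dart \<pi> e) \<in> L}" using lifted by simp
  qed
qed

section \<open>Cluster coordinates are sums of exponentials\<close>

text \<open>Along the path of mutations, the seed carries a gluing with a development on the vertices
  of the initial triangulation. Each coordinate is the determinant of two such vertices, and
  positivity determines its sign.\<close>

lemma cluster_coordinate_exp_sum:
  fixes p :: "real^'i \<Rightarrow> ('i::finite, 'a::field_char_0, 'x::field_char_0) seed \<Rightarrow> 'i \<Rightarrow> real"
  assumes "gluing \<sigma>0" "exmat S0 = dart_matrix \<sigma>0"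
    and p: "\<And>x. p x \<in> A_manifold (mutation_class S0)" "\<And>x j. p x S0 j = exp (x $ j)"
    and S: "S \<in> mutation_class S0"
  shows "exp_sum (\<lambda>x. p x S j)"
proof -
  interpret base: gluing \<sigma>0 by fact
  define e0 :: "'i dart" where "e0 = (undefined, True)"
  define u0 v0 :: "'i vertex" where "u0 = (\<lambda>x. Complex 1 0)" and "v0 = (\<lambda>x. Complex 0 (base.len e0 x))"
  have start_cross: "cross (u0 x) (v0 x) = base.len e0 x" for x by (simp add: u0_def v0_def cross_def)
  define V where "V = {u. \<exists>v e. base.dstep\<^sup>*\<^sup>* (u0, v0, e0) (u, v, e)}"
  have "\<exists>\<sigma> L. development \<sigma> V (\<lambda>j x. p x S j) L \<and> exmat S = dart_matrix \<sigma>"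
    using S
  proof (induction rule: mutation_class_induct)
    case start
    show ?case
      using base.development_initial[of u0 v0 e0] start_cross assms(2) unfolding p(2) V_def by blast
  next
    case (mutate S k)
    then obtain \<sigma> L where dev: "development \<sigma> V (\<lambda>j x. p x S j) L" and ex: "exmat S = dart_matrix \<sigma>"
      by blast
    interpret development \<sigma> V "\<lambda>j x. p x S j" L by (rule dev)
    have pS: "p x S j > 0" "p x (mutate k S) = mutate_A k (dart_matrix \<sigma>) (p x S)" for x j
      using p(1)[of x] mutate.hyps ex by (auto simp: A_manifold_def)
    have "development (flip k \<sigma>) V (\<lambda>j x. p x (mutate k S) j) (flipped k)"
    proof (rule development_flip)
      show "p x S j > 0" for j x by (rule pS)
      show "(\<lambda>x. p x (mutate k S) j) = (\<lambda>x. p x S j)" if "j \<noteq> k" for j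
        unfolding pS(2) using that by (simp add: mutate_A_def)
      show "p x (mutate k S) k = (p x S (fst (\<sigma> \<kappa>)) * p x S (fst (\<sigma> (opp \<kappa>)))
          + p x S (fst (\<sigma> (\<sigma> \<kappa>))) * p x S (fst (\<sigma> (\<sigma> (opp \<kappa>))))) / p x S k"
        if "fst \<kappa> = k" for \<kappa> x
        unfolding pS(2) using flip_site.mutate_A_dart_matrix[OF flip_site_at[OF that]] .
    qed
    moreover have "exmat (mutate k S) = dart_matrix (flip k \<sigma>)"
      by (simp add: mutate_def ex dart_matrix_flip)
    ultimately show ?case by blast
  next
    case (relabel S \<pi>)
    then obtain \<sigma> L where dev: "development \<sigma> V (\<lambda>j x. p x S j) L" and ex: "exmat S = dart_matrix \<sigma>"
      by blast
    interpret development \<sigma> V "\<lambda>j x. p x S j" L by (rule dev)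
    interpret r: dart_relabelling \<sigma> "relabel_dart \<pi>" \<pi>
      using relabel.hyps by (intro relabel_dart_relabelling) auto
    have "p x (relabel \<pi> S) = p x S \<circ> \<pi>" for x
      using p(1)[of x] relabel.hyps by (auto simp: A_manifold_def)
    then have eq: "(\<lambda>j x. p x (relabel \<pi> S) j) = (\<lambda>j x. p x S j) \<circ> \<pi>" by (simp add: fun_eq_iff)
    have ex': "exmat (relabel \<pi> S) = dart_matrix (conjugate (relabel_dart \<pi>) \<sigma>)"
      by (simp add: relabel_def ex fun_eq_iff r.dart_matrix_conjugate)
    from development_relabel[OF relabel.hyps(2)] show ?case unfolding eq[symmetric] using ex' by blast
  qed
  then obtain \<sigma> L where "development \<sigma> V (\<lambda>j x. p x S j) L" by blast
  then interpret development \<sigma> V "\<lambda>j x. p x S j" L .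
  obtain u v where uv: "(u, v, (j, True)) \<in> L" using lifted by blast
  obtain w e w' e' where w: "base.dstep\<^sup>*\<^sup>* (u0, v0, e0) (u, w, e)" "base.dstep\<^sup>*\<^sup>* (u0, v0, e0) (v, w', e')"
    using vertices[OF uv] unfolding V_def by blast
  have "signed_exp_sum (\<lambda>x. cross (u x) (v x))"
    by (rule base.developed_cross_signed_exp_sum[OF start_cross w])
  then have "signed_exp_sum (\<lambda>x. p x S j)" unfolding lengths[OF uv] by simp
  moreover have "p x S j > 0" for x using p(1)[of x] S by (auto simp: A_manifold_def)
  ultimately show ?thesis
    unfolding signed_exp_sum_def using exp_sum_nonneg[of "\<lambda>x. - p x S j"] by (metis neg_0_le_iff_le not_le)
qed

section \<open>The total horocycle length\<close>

text \<open>The exchange matrix may come from several gluings. Summing over all of them gives a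
  function of the seed alone, as is needed for invariance under the cluster modular group,
  whose elements only preserve exchange matrices.\<close>

definition gluings :: "('i::finite \<Rightarrow> 'i \<Rightarrow> int) \<Rightarrow> ('i dart \<Rightarrow> 'i dart) set" where
  "gluings \<epsilon> = {\<sigma>. gluing \<sigma> \<and> dart_matrix \<sigma> = \<epsilon>}"

lemma bij_betw_by_card:
  fixes f g :: "'b::finite \<Rightarrow> 'b"
  assumes "inj_on f A" "f ` A \<subseteq> B" "inj_on g B" "g ` B \<subseteq> A"
  shows "bij_betw f A B"
proof -
  have "card B \<le> card A" using card_inj_on_le[OF assms(3,4)] by simp
  then have "f ` A = B" using assms(2) card_image[OF assms(1)] by (intro card_seteq) auto
  then show ?thesis using assms(1) by (simp add: bij_betw_def)
qed

lemma inj_on_flip: "inj_on (flip k) (gluings \<epsilon>)"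
proof (rule inj_onI)
  fix \<sigma> \<tau> assume "\<sigma> \<in> gluings \<epsilon>" "\<tau> \<in> gluings \<epsilon>" and eq: "flip k \<sigma> = flip k \<tau>"
  then have g: "gluing \<sigma>" "gluing \<tau>" by (auto simp: gluings_def)
  define \<delta> :: "'a dart \<Rightarrow> 'a dart" where "\<delta> = (\<lambda>e. if fst e = k then opp e else e)"
  have \<delta>: "\<delta> (\<delta> e) = e" for e by (simp add: \<delta>_def)
  have "\<delta> (\<sigma> (\<delta> e)) = \<delta> (\<tau> (\<delta> e))" for e
    using gluing.flip_flip[OF g(1), of k e] gluing.flip_flip[OF g(2), of k e] eq
    by (simp add: \<delta>_def Let_def)
  then have "\<sigma> (\<delta> (\<delta> e)) = \<tau> (\<delta> (\<delta> e))" for e using \<delta> by metis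
  then show "\<sigma> = \<tau>" by (simp add: \<delta> fun_eq_iff)
qed

lemma flip_gluings: "flip k ` gluings \<epsilon> \<subseteq> gluings (mutate_matrix k \<epsilon>)"
  using gluing.gluing_flip gluing.dart_matrix_flip by (auto simp: gluings_def)

lemma bij_betw_flip: "bij_betw (flip k) (gluings \<epsilon>) (gluings (mutate_matrix k \<epsilon>))"
proof (rule bij_betw_by_card)
  show "flip k ` gluings (mutate_matrix k \<epsilon>) \<subseteq> gluings \<epsilon>"
    using flip_gluings[of k "mutate_matrix k \<epsilon>"] by (simp add: mutate_matrix_involutive)
qed (rule inj_on_flip flip_gluings)+

lemma bij_betw_conjugate:
  fixes \<pi> :: "'i::finite \<Rightarrow> 'i"
  assumes "bij \<pi>"
  shows "bij_betw (conjugate (relabel_dart \<pi>)) (gluings \<epsilon>) (gluings (\<lambda>i j. \<epsilon> (\<pi> i) (\<pi> j)))"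
proof -
  have inj: "inj_on (conjugate (relabel_dart \<pi>)) (gluings \<epsilon>)"
    and into: "conjugate (relabel_dart \<pi>) ` gluings \<epsilon> \<subseteq> gluings (\<lambda>i j. \<epsilon> (\<pi> i) (\<pi> j))"
    if "bij \<pi>" for \<pi> :: "'i \<Rightarrow> 'i" and \<epsilon> :: "'i \<Rightarrow> 'i \<Rightarrow> int"
  proof -
    have r: "dart_relabelling \<sigma> (relabel_dart \<pi>) \<pi>" if "\<sigma> \<in> gluings \<epsilon>" for \<sigma>
      using that gluing.relabel_dart_relabelling[OF _ \<open>bij \<pi>\<close>] by (simp add: gluings_def)
    show "inj_on (conjugate (relabel_dart \<pi>)) (gluings \<epsilon>)"
    proof (rule inj_onI)
      fix \<sigma> \<tau> assume st: "\<sigma> \<in> gluings \<epsilon>" "\<tau> \<in> gluings \<epsilon>"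
        and eq: "conjugate (relabel_dart \<pi>) \<sigma> = conjugate (relabel_dart \<pi>) \<tau>"
      have "\<sigma> (relabel_dart \<pi> e) = \<tau> (relabel_dart \<pi> e)" for e
        using dart_relabelling.theta_conjugate[OF r[OF st(1)]]
          dart_relabelling.theta_conjugate[OF r[OF st(2)]] eq by metis
      moreover have "surj (relabel_dart \<pi>)"
        using dart_relabelling.bij[OF r[OF st(1)]] by (rule bij_is_surj)
      ultimately show "\<sigma> = \<tau>" by (metis ext surjD)
    qed
    show "conjugate (relabel_dart \<pi>) ` gluings \<epsilon> \<subseteq> gluings (\<lambda>i j. \<epsilon> (\<pi> i) (\<pi> j))"
    proof (rule image_subsetI)
      fix \<sigma> assume s: "\<sigma> \<in> gluings \<epsilon>"
      then have "dart_matrix \<sigma> = \<epsilon>" by (simp add: gluings_def)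
      then show "conjugate (relabel_dart \<pi>) \<sigma> \<in> gluings (\<lambda>i j. \<epsilon> (\<pi> i) (\<pi> j))"
        using dart_relabelling.gluing_conjugate[OF r[OF s]]
          dart_relabelling.dart_matrix_conjugate[OF r[OF s]] by (simp add: gluings_def fun_eq_iff)
    qed
  qed
  have "(\<lambda>i j. \<epsilon> (\<pi> (inv_into UNIV \<pi> i)) (\<pi> (inv_into UNIV \<pi> j))) = \<epsilon>"
    using assms by (simp add: bij_is_surj surj_f_inv_f)
  then show ?thesis
    using bij_betw_by_card[OF inj[OF assms] into[OF assms] inj[OF bij_imp_bij_inv[OF assms]]]
      into[OF bij_imp_bij_inv[OF assms], of "\<lambda>i j. \<epsilon> (\<pi> i) (\<pi> j)"] by simp
qed

definition total_horocycle :: "('i::finite \<Rightarrow> 'i \<Rightarrow> int) \<Rightarrow> ('i \<Rightarrow> real) \<Rightarrow> real" where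
  "total_horocycle \<epsilon> l = (\<Sum>\<sigma>\<in>gluings \<epsilon>. horocycle \<sigma> l)"

lemma total_horocycle_mutate:
  assumes "\<And>j. l j > 0"
  shows "total_horocycle (mutate_matrix k \<epsilon>) (mutate_A k \<epsilon> l) = total_horocycle \<epsilon> l"
proof -
  have "total_horocycle (mutate_matrix k \<epsilon>) (mutate_A k \<epsilon> l)
      = (\<Sum>\<sigma>\<in>gluings \<epsilon>. horocycle (flip k \<sigma>) (mutate_A k \<epsilon> l))"
    unfolding total_horocycle_def by (rule sum.reindex_bij_betw[OF bij_betw_flip, symmetric])
  also have "\<dots> = total_horocycle \<epsilon> l"
    unfolding total_horocycle_def
  proof (rule sum.cong[OF refl])
    fix \<sigma> assume "\<sigma> \<in> gluings \<epsilon>"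
    then have "gluing \<sigma>" and e: "dart_matrix \<sigma> = \<epsilon>" by (auto simp: gluings_def)
    then show "horocycle (flip k \<sigma>) (mutate_A k \<epsilon> l) = horocycle \<sigma> l"
      using gluing.horocycle_flip[of \<sigma> l k] assms by simp
  qed
  finally show ?thesis .
qed

lemma total_horocycle_relabel:
  fixes \<pi> :: "'i::finite \<Rightarrow> 'i"
  assumes "bij \<pi>"
  shows "total_horocycle (\<lambda>i j. \<epsilon> (\<pi> i) (\<pi> j)) (l \<circ> \<pi>) = total_horocycle \<epsilon> l"
proof -
  have "total_horocycle (\<lambda>i j. \<epsilon> (\<pi> i) (\<pi> j)) (l \<circ> \<pi>)
      = (\<Sum>\<sigma>\<in>gluings \<epsilon>. horocycle (conjugate (relabel_dart \<pi>) \<sigma>) (l \<circ> \<pi>))"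
    unfolding total_horocycle_def
    by (rule sum.reindex_bij_betw[OF bij_betw_conjugate[OF assms], symmetric])
  also have "\<dots> = total_horocycle \<epsilon> l"
    unfolding total_horocycle_def
  proof (rule sum.cong[OF refl])
    fix \<sigma> assume "\<sigma> \<in> gluings \<epsilon>"
    then have "dart_relabelling \<sigma> (relabel_dart \<pi>) \<pi>"
      using gluing.relabel_dart_relabelling assms by (auto simp: gluings_def)
    then show "horocycle (conjugate (relabel_dart \<pi>) \<sigma>) (l \<circ> \<pi>) = horocycle \<sigma> l"
      by (rule dart_relabelling.horocycle_conjugate)
  qed
  finally show ?thesis .
qed

lemma total_horocycle_invariant:
  assumes p: "p \<in> A_manifold (mutation_class S0)" and S: "S \<in> mutation_class S0"
  shows "total_horocycle (exmat S) (p S) = total_horocycle (exmat S0) (p S0)"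
  using S
proof (induction rule: mutation_class_induct)
  case (mutate S k)
  have "p (mutate k S) = mutate_A k (exmat S) (p S)" "\<And>j. p S j > 0"
    using p mutate.hyps by (auto simp: A_manifold_def)
  then show ?case using total_horocycle_mutate[of "p S"] mutate.IH by (simp add: mutate_def)
next
  case (relabel S \<pi>)
  have "p (relabel \<pi> S) = p S \<circ> \<pi>" using p relabel.hyps by (auto simp: A_manifold_def)
  moreover have "exmat (relabel \<pi> S) = (\<lambda>i j. exmat S (\<pi> i) (\<pi> j))" by (simp add: relabel_def)
  ultimately show ?case
    using total_horocycle_relabel[OF relabel.hyps(2), of "exmat S" "p S"] relabel.IH by (simp only:)
qed simp

lemma exp_sum_total_horocycle:
  "exp_sum (\<lambda>x :: real^'i::finite. total_horocycle \<epsilon> (\<lambda>j. exp (x $ j)))"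
  unfolding total_horocycle_def horocycle_def
proof (intro exp_sum_sum)
  fix \<sigma> and e :: "'i dart"
  have "exp (x $ fst e) / (exp (x $ fst (\<sigma> e)) * exp (x $ fst (\<sigma> (\<sigma> e))))
      = exp ((axis (fst e) 1 - axis (fst (\<sigma> e)) 1 - axis (fst (\<sigma> (\<sigma> e))) 1) \<bullet> x)" for x :: "real^'i"
    by (simp add: inner_diff_left inner_axis' exp_diff)
  then show "exp_sum (\<lambda>x :: real^'i.
      exp (x $ fst e) / (exp (x $ fst (\<sigma> e)) * exp (x $ fst (\<sigma> (\<sigma> e)))))"
    by (simp add: exp_sum.mono)
qed

text \<open>Two corners of a triangle with the side \<open>j\<close> contribute \<open>x / (y * l j)\<close> and \<open>y / (l j * x)\<close>,
  and the product of these is \<open>1 / (l j)\<^sup>2\<close>.\<close>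

lemma (in gluing) horocycle_ge:
  assumes pos: "\<And>j. l j > 0"
  shows "inverse (l j) \<le> horocycle \<sigma> l"
proof -
  define h where "h e = l (fst e) / (l (fst (\<sigma> e)) * l (fst (\<sigma> (\<sigma> e))))" for e
  have h_nonneg: "h e \<ge> 0" for e using pos by (simp add: h_def less_imp_le)
  have H: "horocycle \<sigma> l = (\<Sum>e\<in>UNIV. h e)" by (simp add: horocycle_def h_def)
  have le: "h e \<le> horocycle \<sigma> l" for e
    unfolding H by (rule member_le_sum) (use h_nonneg in auto)
  define e where "e = \<sigma> (j, True)"
  have j: "\<sigma> (\<sigma> e) = (j, True)" by (simp add: e_def cube)
  have "h e * h (\<sigma> e) = (inverse (l j))\<^sup>2"
    using pos[of "fst e"] pos[of "fst (\<sigma> e)"] unfolding h_def cube unfolding j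
    by (simp add: power2_eq_square field_simps)
  moreover have "h e * h (\<sigma> e) \<le> (horocycle \<sigma> l)\<^sup>2"
    unfolding power2_eq_square by (intro mult_mono le h_nonneg order_trans[OF h_nonneg le])
  ultimately have "(inverse (l j))\<^sup>2 \<le> (horocycle \<sigma> l)\<^sup>2" by simp
  moreover have "horocycle \<sigma> l \<ge> 0" using h_nonneg le order_trans by blast
  ultimately show ?thesis by (rule power2_le_imp_le)
qed

lemma horocycle_nonneg:
  assumes "\<And>j. l j > 0"
  shows "horocycle \<sigma> l \<ge> 0"
  unfolding horocycle_def using assms by (intro sum_nonneg) (simp add: less_imp_le)

lemma total_horocycle_ge:
  assumes "gluing \<sigma>" and pos: "\<And>j. l j > 0"
  shows "inverse (l j) \<le> total_horocycle (dart_matrix \<sigma>) l"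
proof -
  have "inverse (l j) \<le> horocycle \<sigma> l" by (rule gluing.horocycle_ge[OF assms])
  also have "\<dots> \<le> total_horocycle (dart_matrix \<sigma>) l"
    unfolding total_horocycle_def
    by (rule member_le_sum) (use assms horocycle_nonneg in \<open>auto simp: gluings_def\<close>)
  finally show ?thesis .
qed

section \<open>Fixed points in the A-manifold\<close>

text \<open>Outside a cube one of the \<open>exp (x $ j)\<close> or \<open>exp (- (x $ j))\<close>, and hence \<open>F\<close>, exceeds \<open>F 0\<close>;
  this gives a minimum. It is unique because \<open>F\<close> is strictly convex at midpoints.\<close>

lemma exp_sum_strict_minimum:
  fixes f F :: "real^'n::finite \<Rightarrow> real"
  assumes f: "exp_sum f" and F: "\<And>x. F x = f x + (\<Sum>j\<in>UNIV. exp (x $ j))"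
    and low: "\<And>x j. exp (- (x $ j)) \<le> F x"
  shows "\<exists>x. \<forall>y. F x \<le> F y \<and> (F y \<le> F x \<longrightarrow> y = x)"
proof -
  have up: "exp (x $ j) \<le> F x" for x j
  proof -
    have "exp (x $ j) \<le> (\<Sum>j\<in>UNIV. exp (x $ j))" by (rule member_le_sum) auto
    then show ?thesis using exp_sum_nonneg[OF f, of x] F by simp
  qed
  define c where "c = F 0"
  have c1: "c \<ge> 1" using up[of 0 undefined] by (simp add: c_def)
  define K :: "(real^'n) set" where "K = cbox (\<chi> i. - ln c) (\<chi> i. ln c)"
  have 0: "0 \<in> K" using c1 by (simp add: K_def mem_box_cart)
  have "continuous_on K F"
  proof -
    have "continuous_on UNIV (\<lambda>x :: real^'n. f x + (\<Sum>j\<in>UNIV. exp (x $ j)))"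
      by (intro continuous_intros exp_sum_continuous[OF f])
    then have "continuous_on UNIV F" unfolding F[symmetric] by (simp add: continuous_on_def)
    then show ?thesis by (rule continuous_on_subset) simp
  qed
  then obtain x where x: "x \<in> K" "\<And>y. y \<in> K \<Longrightarrow> F x \<le> F y"
    using continuous_attains_inf[of K F] 0 by (auto simp: K_def compact_cbox)
  have outside: "F y > c" if "y \<notin> K" for y
  proof -
    obtain j where j: "y $ j > ln c \<or> y $ j < - ln c"
      using \<open>y \<notin> K\<close> by (auto simp: K_def mem_box_cart not_le)
    then have "exp (ln c) < exp (y $ j) \<or> exp (ln c) < exp (- (y $ j))" by auto
    moreover have "exp (ln c) = c" using c1 by simp
    ultimately have "c < exp (y $ j) \<or> c < exp (- (y $ j))" by simp
    then show ?thesis using up[of y j] low[of y j] by linarith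
  qed
  have min: "F x \<le> F y" for y
  proof (cases "y \<in> K")
    case False
    then show ?thesis using outside[OF False] x(2)[OF 0] by (simp add: c_def)
  qed (rule x(2))
  have "y = x" if "F y \<le> F x" for y
  proof (rule ccontr)
    assume "y \<noteq> x"
    then obtain i where i: "y $ i \<noteq> x $ i" by (auto simp: vec_eq_iff)
    define m where "m = (1/2) *\<^sub>R (x + y)"
    have mj: "m $ j = (x $ j + y $ j) / 2" for j by (simp add: m_def)
    have "exp (m $ j) \<le> (exp (x $ j) + exp (y $ j)) / 2" for j
      unfolding mj using exp_midpoint_less[of "x $ j" "y $ j"] by (cases "x $ j = y $ j") auto
    moreover have "exp (m $ i) < (exp (x $ i) + exp (y $ i)) / 2"
      unfolding mj using i by (intro exp_midpoint_less) auto
    ultimately have "(\<Sum>j\<in>UNIV. exp (m $ j)) < (\<Sum>j\<in>UNIV. (exp (x $ j) + exp (y $ j)) / 2)"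
      by (intro sum_strict_mono_ex1) auto
    also have "\<dots> = ((\<Sum>j\<in>UNIV. exp (x $ j)) + (\<Sum>j\<in>UNIV. exp (y $ j))) / 2"
      by (simp add: sum.distrib sum_divide_distrib[symmetric])
    finally have "F m < (F x + F y) / 2"
      using exp_sum_midpoint[OF f, of x y] unfolding F m_def[symmetric] by (simp add: add_divide_distrib)
    then show False using min[of m] that by simp
  qed
  then show ?thesis using min by blast
qed

lemma cluster_modularD:
  assumes "\<phi> \<in> carrier (cluster_modular_group s)"
  shows "\<phi> permutes s" "S \<in> s \<Longrightarrow> exmat (\<phi> S) = exmat S"
    "S \<in> s \<Longrightarrow> \<phi> (mutate k S) = mutate k (\<phi> S)"
    "S \<in> s \<Longrightarrow> bij \<pi> \<Longrightarrow> \<phi> (relabel \<pi> S) = relabel \<pi> (\<phi> S)"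
  using assms by (auto simp: cluster_modular_group_def)

lemma cluster_modular_inverse:
  assumes "\<phi> \<in> carrier (cluster_modular_group (mutation_class S0))" and S: "S \<in> mutation_class S0"
  shows "inv_into UNIV \<phi> S \<in> mutation_class S0" "exmat (inv_into UNIV \<phi> S) = exmat S"
    "inv_into UNIV \<phi> (mutate k S) = mutate k (inv_into UNIV \<phi> S)"
    "bij \<pi> \<Longrightarrow> inv_into UNIV \<phi> (relabel \<pi> S) = relabel \<pi> (inv_into UNIV \<phi> S)"
proof -
  note \<phi> = cluster_modularD[OF assms(1)]
  let ?R = "inv_into UNIV \<phi> S"
  have inv: "inv_into UNIV \<phi> T = R" if "\<phi> R = T" for R T
    using permutes_inverses(2)[OF \<phi>(1)] that by blast
  have R: "\<phi> ?R = S" using permutes_inverses(1)[OF \<phi>(1)] by blast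
  show 1: "?R \<in> mutation_class S0" using permutes_in_image[OF \<phi>(1), of ?R] R S by simp
  show "exmat ?R = exmat S" using \<phi>(2)[OF 1] R by simp
  show "inv_into UNIV \<phi> (mutate k S) = mutate k ?R" by (rule inv) (simp add: \<phi>(3)[OF 1] R)
  show "inv_into UNIV \<phi> (relabel \<pi> S) = relabel \<pi> ?R" if "bij \<pi>"
    by (rule inv) (simp add: \<phi>(4)[OF 1 that] R)
qed

lemma cluster_action_A_manifold:
  assumes \<phi>: "\<phi> \<in> carrier (cluster_modular_group (mutation_class S0))"
    and p: "p \<in> A_manifold (mutation_class S0)"
  shows "cluster_action \<phi> p \<in> A_manifold (mutation_class S0)"
  unfolding A_manifold_def cluster_action_def
proof (intro CollectI conjI ballI allI impI)
  note perm = cluster_modularD(1)[OF \<phi>]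
  have "inv_into UNIV \<phi> S = S" if "S \<notin> mutation_class S0" for S
    using permutes_not_in[OF permutes_inv[OF perm] that] .
  then show "(\<lambda>S. p (inv_into UNIV \<phi> S)) \<in> extensional (mutation_class S0)"
    using p by (simp add: A_manifold_def extensional_def)
  fix S assume S: "S \<in> mutation_class S0"
  note inv = cluster_modular_inverse[OF \<phi> S]
  show "p (inv_into UNIV \<phi> S) j > 0" for j using p inv(1) by (simp add: A_manifold_def)
  show "p (inv_into UNIV \<phi> (mutate k S)) = mutate_A k (exmat S) (p (inv_into UNIV \<phi> S))" for k
    unfolding inv(3) using p inv(1,2) by (simp add: A_manifold_def)
  show "p (inv_into UNIV \<phi> (relabel \<pi> S)) = p (inv_into UNIV \<phi> S) \<circ> \<pi>" if "bij \<pi>" for \<pi>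
    unfolding inv(4)[OF that] using p inv(1) that by (simp add: A_manifold_def)
qed

lemma A_fixed_point:
  fixes S0 :: "('i::finite, 'a::field_char_0, 'x::field_char_0) seed"
  assumes \<sigma>: "gluing \<sigma>" "exmat S0 = dart_matrix \<sigma>"
    and indep: "algebraically_independent (avar S0)"
    and G: "subgroup G (cluster_modular_group (mutation_class S0))" "finite G"
  shows "\<exists>a\<in>A_manifold (mutation_class S0). \<forall>\<phi>\<in>G. cluster_action \<phi> a = a"
proof -
  let ?s = "mutation_class S0"
  have G_sub: "\<phi> \<in> carrier (cluster_modular_group ?s)" if "\<phi> \<in> G" for \<phi>
    using subgroup.subset[OF G(1)] that by blast
  have G_comp: "\<phi> \<circ> \<psi> \<in> G" if "\<phi> \<in> G" "\<psi> \<in> G" for \<phi> \<psi>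
    using subgroup.m_closed[OF G(1) that] by (simp add: cluster_modular_group_def)
  have G_id: "id \<in> G" using subgroup.one_closed[OF G(1)] by (simp add: cluster_modular_group_def)
  \<comment> \<open>The horocycle length makes \<open>\<Phi>\<close> large when a coordinate tends to 0, the orbit sum when one
    tends to infinity.\<close>
  define \<Phi> where "\<Phi> p = total_horocycle (exmat S0) (p S0) + (\<Sum>\<phi>\<in>G. \<Sum>j\<in>UNIV. p (\<phi> S0) j)"
    for p :: "('i, 'a, 'x) seed \<Rightarrow> 'i \<Rightarrow> real"
  have \<Phi>_inv: "\<Phi> (cluster_action \<psi> p) = \<Phi> p" if \<psi>: "\<psi> \<in> G" and p: "p \<in> A_manifold ?s" for \<psi> p
  proof -
    note inv = cluster_modular_inverse[OF G_sub[OF \<psi>] seed_in_class]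
    have "total_horocycle (exmat S0) (cluster_action \<psi> p S0) = total_horocycle (exmat S0) (p S0)"
      unfolding cluster_action_def using total_horocycle_invariant[OF p inv(1)] inv(2) by simp
    moreover have "(\<Sum>\<phi>\<in>G. \<Sum>j\<in>UNIV. cluster_action \<psi> p (\<phi> S0) j) = (\<Sum>\<phi>\<in>G. \<Sum>j\<in>UNIV. p (\<phi> S0) j)"
    proof -
      have perm: "\<psi> permutes ?s" using cluster_modularD(1)[OF G_sub[OF \<psi>]] .
      have undo: "inv_into UNIV \<psi> (\<psi> S) = S" for S using permutes_inverses(2)[OF perm] by blast
      have inj: "inj_on ((\<circ>) \<psi>) G"
      proof (rule inj_onI)
        fix \<phi> \<phi>' assume "\<psi> \<circ> \<phi> = \<psi> \<circ> \<phi>'"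
        then have "inv_into UNIV \<psi> (\<psi> (\<phi> S)) = inv_into UNIV \<psi> (\<psi> (\<phi>' S))" for S
          by (metis comp_apply)
        then show "\<phi> = \<phi>'" unfolding undo by (rule ext)
      qed
      moreover have "((\<circ>) \<psi>) ` G \<subseteq> G" using G_comp[OF \<psi>] by blast
      ultimately have bij: "bij_betw ((\<circ>) \<psi>) G G"
        using endo_inj_surj[OF G(2)] by (simp add: bij_betw_def)
      have "(\<Sum>\<phi>\<in>G. \<Sum>j\<in>UNIV. cluster_action \<psi> p (\<phi> S0) j)
          = (\<Sum>\<phi>\<in>G. \<Sum>j\<in>UNIV. cluster_action \<psi> p ((\<psi> \<circ> \<phi>) S0) j)"
        by (rule sum.reindex_bij_betw[OF bij, symmetric])
      then show ?thesis by (simp add: cluster_action_def undo)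
    qed
    ultimately show ?thesis by (simp add: \<Phi>_def)
  qed
  have "\<forall>x :: real^'i. \<exists>p. p \<in> A_manifold ?s \<and> p S0 = (\<lambda>j. exp (x $ j))"
    using A_manifold_point_exists[OF indep] by (metis exp_gt_zero)
  from choice[OF this] obtain P where P: "\<And>x :: real^'i. P x \<in> A_manifold ?s" "\<And>x :: real^'i. P x S0 = (\<lambda>j. exp (x $ j))"
    by blast
  define F where "F x = \<Phi> (P x)" for x :: "real^'i"
  define f where "f x = total_horocycle (exmat S0) (\<lambda>j. exp (x $ j))
      + (\<Sum>\<phi>\<in>G - {id}. \<Sum>j\<in>UNIV. P x (\<phi> S0) j)" for x :: "real^'i"
  have in_class: "\<phi> S0 \<in> ?s" if "\<phi> \<in> G" for \<phi>
    using permutes_in_image[OF cluster_modularD(1)[OF G_sub[OF that]]] seed_in_class by blast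
  have coord: "exp_sum (\<lambda>x. P x S j)" if "S \<in> ?s" for S j
    by (rule cluster_coordinate_exp_sum[OF \<sigma> P(1) _ that]) (simp add: P(2))
  have f: "exp_sum f"
    unfolding f_def by (intro exp_sum.add exp_sum_total_horocycle exp_sum_sum coord in_class) auto
  have F: "F x = f x + (\<Sum>j\<in>UNIV. exp (x $ j))" for x :: "real^'i"
    unfolding F_def \<Phi>_def f_def by (subst sum.remove[OF G(2) G_id]) (simp add: P(2))
  have low: "exp (- (x $ j)) \<le> F x" for x :: "real^'i" and j
  proof -
    have "exp (- (x $ j)) \<le> total_horocycle (exmat S0) (P x S0)"
      unfolding \<sigma>(2) using total_horocycle_ge[OF \<sigma>(1), of "P x S0" j] by (simp add: P(2) exp_minus)
    moreover have "0 \<le> (\<Sum>\<phi>\<in>G. \<Sum>j\<in>UNIV. P x (\<phi> S0) j)"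
      using P(1)[of x] in_class by (intro sum_nonneg) (auto simp: A_manifold_def less_imp_le)
    ultimately show ?thesis by (simp add: F_def \<Phi>_def)
  qed
  \<comment> \<open>An element of \<open>G\<close> moves the minimum to another minimum.\<close>
  obtain x where min: "\<And>y. F x \<le> F y" and unique: "\<And>y. F y \<le> F x \<Longrightarrow> y = x"
    using exp_sum_strict_minimum[OF f F low] by blast
  have "cluster_action \<phi> (P x) = P x" if \<phi>: "\<phi> \<in> G" for \<phi>
  proof -
    let ?q = "cluster_action \<phi> (P x)"
    have q: "?q \<in> A_manifold ?s" by (rule cluster_action_A_manifold[OF G_sub[OF \<phi>] P(1)])
    define y :: "real^'i" where "y = (\<chi> j. ln (?q S0 j))"
    have "?q S0 j > 0" for j using q seed_in_class[of S0] by (simp add: A_manifold_def)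
    then have "P y S0 = ?q S0" by (simp add: P(2) y_def)
    then have eq: "P y = ?q" by (rule A_manifold_point_unique[OF P(1) q])
    then have "F y = F x" unfolding F_def using \<Phi>_inv[OF \<phi> P(1)] by simp
    then show ?thesis using unique[of y] eq by simp
  qed
  then show ?thesis using P(1) by blast
qed

section \<open>From the A-manifold to the X-manifold\<close>

definition monomial_point ::
    "('i::finite, 'a::field, 'x::field) seed set \<Rightarrow> (('i, 'a, 'x) seed \<Rightarrow> 'i \<Rightarrow> real)
      \<Rightarrow> ('i, 'a, 'x) seed \<Rightarrow> 'i \<Rightarrow> real" where
  "monomial_point s p = (\<lambda>S\<in>s. \<lambda>i. \<Prod>j\<in>UNIV. p S j powi exmat S i j)"

lemma prod_powi: "(\<Prod>j\<in>J. f j) powi n = (\<Prod>j\<in>J. f j powi n)" for f :: "'b \<Rightarrow> real"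
  by (induction J rule: infinite_finite_induct) (simp_all add: power_int_mult_distrib)

text \<open>With \<open>Mp\<close>, \<open>Mm\<close> the two monomials of the exchange relation, \<open>X k = Mp / Mm\<close> and \<open>A' k = (Mp
  + Mm) / A k\<close>, and the factor of \<open>X\<close>-mutation is \<open>(Mp + Mm) / Mp\<close> or \<open>(Mp + Mm) / Mm\<close>,
  depending on the sign of \<open>e i k\<close>.\<close>

lemma monomials_mutate:
  fixes A :: "'i::finite \<Rightarrow> real"
  assumes pos: "\<And>j. A j > 0" and diag: "e k k = 0"
  shows "(\<lambda>i. \<Prod>j\<in>UNIV. mutate_A k e A j powi mutate_matrix k e i j)
    = mutate_X k e (\<lambda>i. \<Prod>j\<in>UNIV. A j powi e i j)"
proof
  fix i
  have nz: "A j \<noteq> 0" for j using pos[of j] by simp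
  define Mp Mm where "Mp = (\<Prod>j\<in>UNIV. A j powi pos_part (e k j))"
    and "Mm = (\<Prod>j\<in>UNIV. A j powi pos_part (- e k j))"
  have M: "Mp > 0" "Mm > 0" unfolding Mp_def Mm_def using pos by (auto intro!: prod_pos zero_less_power_int)
  define X where "X i = (\<Prod>j\<in>UNIV. A j powi e i j)" for i
  have Xk: "X k = Mp / Mm"
  proof -
    have "e k j = pos_part (e k j) - pos_part (- e k j)" for j by simp
    then have "X k = (\<Prod>j\<in>UNIV. A j powi pos_part (e k j) / A j powi pos_part (- e k j))"
      unfolding X_def using nz power_int_diff by (metis (no_types, lifting))
    then show ?thesis by (simp add: Mp_def Mm_def prod_dividef)
  qed
  have A'k: "mutate_A k e A k = (Mp + Mm) / A k"
    by (simp add: mutate_A_def Mp_def Mm_def field_simps)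
  have A': "mutate_A k e A j = A j" if "j \<noteq> k" for j using that by (simp add: mutate_A_def)
  show "(\<Prod>j\<in>UNIV. mutate_A k e A j powi mutate_matrix k e i j) = mutate_X k e (\<lambda>i. \<Prod>j\<in>UNIV. A j powi e i j) i"
  proof (cases "i = k")
    case True
    have "mutate_A k e A j powi mutate_matrix k e k j = inverse (A j powi e k j)" for j
      using diag A'[of j] by (cases "j = k") (simp_all add: mutate_matrix_def power_int_minus)
    then show ?thesis
      using True prod_inversef[of "\<lambda>j. A j powi e k j" UNIV] by (simp add: mutate_X_def comp_def)
  next
    case False
    define b where "b = e i k"
    define R where "R = (\<Prod>j\<in>UNIV - {k}. A j powi e i j)"
    have Xi: "X i = A k powi b * R"
      unfolding X_def R_def b_def by (rule prod.remove) auto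
    have Mp': "Mp = (\<Prod>j\<in>UNIV - {k}. A j powi pos_part (e k j))"
      and Mm': "Mm = (\<Prod>j\<in>UNIV - {k}. A j powi pos_part (- e k j))"
      unfolding Mp_def Mm_def using diag by (subst prod.remove[of UNIV k]; simp)+
    have "(\<Prod>j\<in>UNIV. mutate_A k e A j powi mutate_matrix k e i j)
        = ((Mp + Mm) / A k) powi (- b) * (\<Prod>j\<in>UNIV - {k}. A j powi e i j
            * (A j powi pos_part (e k j)) powi pos_part b
            / (A j powi pos_part (- e k j)) powi pos_part (- b))"
    proof -
      have "mutate_A k e A j powi mutate_matrix k e i j = A j powi e i j
            * (A j powi pos_part (e k j)) powi pos_part b
            / (A j powi pos_part (- e k j)) powi pos_part (- b)" if "j \<in> UNIV - {k}" for j
      proof -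
        have "mutate_matrix k e i j
            = e i j + pos_part (e k j) * pos_part b - pos_part (- e k j) * pos_part (- b)"
          using that False by (simp add: mutate_matrix_def b_def mult.commute)
        then show ?thesis
          using that nz by (simp add: A' power_int_add power_int_diff power_int_mult)
      qed
      moreover have "mutate_A k e A k powi mutate_matrix k e i k = ((Mp + Mm) / A k) powi (- b)"
        unfolding A'k by (simp add: mutate_matrix_def b_def)
      ultimately show ?thesis by (subst prod.remove[of UNIV k]) simp_all
    qed
    also have "\<dots> = ((Mp + Mm) / A k) powi (- b) * (R * Mp powi pos_part b / Mm powi pos_part (- b))"
      unfolding Mp' Mm' R_def prod_powi prod_dividef prod.distrib ..
    also have "\<dots> = X i * (1 + X k powi (- sgn b)) powi (- b)"
    proof -
      have q: "((Mp + Mm) / A k) powi (- b) = (Mp + Mm) powi (- b) * A k powi b"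
        by (simp add: power_int_divide_distrib power_int_minus field_simps)
      consider "b > 0" | "b = 0" | "b < 0" by linarith
      then show ?thesis
      proof cases
        case 1
        have X: "1 + X k powi (- sgn b) = (Mp + Mm) / Mp"
          using 1 M by (simp add: Xk field_simps)
        show ?thesis
          unfolding X q Xi using 1 M by (simp add: power_int_divide_distrib power_int_minus field_simps)
      next
        case 2
        then show ?thesis by (simp add: Xi)
      next
        case 3
        have X: "1 + X k powi (- sgn b) = (Mp + Mm) / Mm"
          using 3 M by (simp add: Xk field_simps)
        show ?thesis
          unfolding X q Xi using 3 M by (simp add: power_int_divide_distrib power_int_minus field_simps)
      qed
    qed
    finally show ?thesis using False by (simp add: mutate_X_def X_def b_def)
  qed
qed

lemma exmat_skew:
  assumes "S \<in> mutation_class S0" "\<And>i j. exmat S0 j i = - exmat S0 i j"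
  shows "exmat S j i = - exmat S i j"
  using assms(1)
proof (induction arbitrary: i j rule: mutation_class_induct)
  case (mutate S k)
  have a: "exmat S k i = - exmat S i k" "exmat S j k = - exmat S k j" "exmat S j i = - exmat S i j"
    by (rule mutate.IH)+
  show ?case by (simp add: mutate_def mutate_matrix_def a)
next
  case (relabel S \<pi>)
  show ?case unfolding relabel_def seed.simps by (rule relabel.IH)
qed (rule assms(2))

lemma monomial_point_X_manifold:
  assumes p: "p \<in> A_manifold (mutation_class S0)"
    and skew: "\<And>i j. exmat S0 j i = - exmat S0 i j"
  shows "monomial_point (mutation_class S0) p \<in> X_manifold (mutation_class S0)"
  unfolding X_manifold_def
proof (intro CollectI conjI ballI allI impI)
  show "monomial_point (mutation_class S0) p \<in> extensional (mutation_class S0)"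
    by (simp add: monomial_point_def)
  fix S assume S: "S \<in> mutation_class S0"
  have pos: "p S j > 0" for j using p S by (simp add: A_manifold_def)
  show "monomial_point (mutation_class S0) p S j > 0" for j
    using S pos by (auto simp: monomial_point_def intro!: prod_pos zero_less_power_int)
  show "monomial_point (mutation_class S0) p (mutate k S)
      = mutate_X k (exmat S) (monomial_point (mutation_class S0) p S)" for k
  proof -
    have "exmat S k k = 0" using exmat_skew[OF S skew, of k k] by simp
    moreover have "p (mutate k S) = mutate_A k (exmat S) (p S)" using p S by (simp add: A_manifold_def)
    moreover have "exmat (mutate k S) = mutate_matrix k (exmat S)" by (simp add: mutate_def)
    ultimately show ?thesis
      using monomials_mutate[of "p S" "exmat S" k] pos S mutate_in_class[OF S]
      by (simp add: monomial_point_def)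
  qed
  show "monomial_point (mutation_class S0) p (relabel \<pi> S)
      = monomial_point (mutation_class S0) p S \<circ> \<pi>" if \<pi>: "bij \<pi>" for \<pi>
  proof -
    have "p (relabel \<pi> S) = p S \<circ> \<pi>" using p S \<pi> by (simp add: A_manifold_def)
    moreover have "(\<Prod>j\<in>UNIV. p S (\<pi> j) powi exmat S (\<pi> i) (\<pi> j)) = (\<Prod>j\<in>UNIV. p S j powi exmat S (\<pi> i) j)" for i
      by (rule prod.reindex_bij_betw[OF \<pi>, of "\<lambda>j. p S j powi exmat S (\<pi> i) j"])
    moreover have "exmat (relabel \<pi> S) = (\<lambda>i j. exmat S (\<pi> i) (\<pi> j))" by (simp add: relabel_def)
    ultimately show ?thesis
      using S relabel_in_class[OF S \<pi>] by (simp add: monomial_point_def fun_eq_iff)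
  qed
qed

lemma monomial_point_fixed:
  assumes \<phi>: "\<phi> \<in> carrier (cluster_modular_group (mutation_class S0))"
    and fixed: "cluster_action \<phi> p = p"
  shows "cluster_action \<phi> (monomial_point (mutation_class S0) p) = monomial_point (mutation_class S0) p"
proof
  fix S
  show "cluster_action \<phi> (monomial_point (mutation_class S0) p) S = monomial_point (mutation_class S0) p S"
  proof (cases "S \<in> mutation_class S0")
    case True
    have "p (inv_into UNIV \<phi> S) = p S" using fun_cong[OF fixed, of S] by (simp add: cluster_action_def)
    then show ?thesis
      using cluster_modular_inverse(1,2)[OF \<phi> True] True by (simp add: cluster_action_def monomial_point_def)
  next
    case False
    then show ?thesis
      using permutes_not_in[OF permutes_inv[OF cluster_modularD(1)[OF \<phi>]] False]
      by (simp add: cluster_action_def)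
  qed
qed

section \<open>Fixed points of finite subgroups\<close>

theorem proposition4p11:
  fixes T :: "'p topology" and \<A> :: "('p set \<times> ('p \<Rightarrow> complex)) set" and p :: 'p and g :: nat
    and arc :: "'i::finite \<Rightarrow> 'p set" and \<tau> :: "'p set \<Rightarrow> complex \<Rightarrow> 'p"
    and S0 :: "('i, 'a::field_char_0, 'x::field_char_0) seed"
    and s :: "('i, 'a, 'x) seed set"
    and G :: "(('i, 'a, 'x) seed \<Rightarrow> ('i, 'a, 'x) seed) set"
  assumes "closed_oriented_surface T \<A>" and "has_genus T g" and "g \<ge> 1" and "p \<in> topspace T"
    and "inj arc" and "ideal_triangulation T p (range arc)"
    and "cuts_into_triangles T \<A> p (range arc) \<tau>"
    and "is_seed (\<lambda>_. 1) S0"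
    and "exmat S0 = (\<lambda>i j. triangulation_matrix T (range arc) \<tau> (arc i) (arc j))"
    and "s = mutation_class S0"
    and "subgroup G (cluster_modular_group s)" and "finite G"
  shows "(\<exists>a\<in>A_manifold s. \<forall>\<phi>\<in>G. cluster_action \<phi> a = a) \<and>
         (\<exists>x\<in>X_manifold s. \<forall>\<phi>\<in>G. cluster_action \<phi> x = x)"
proof -
  have "arc_system T p (range arc)" using assms(6) by (simp add: ideal_triangulation_def)
  then obtain \<sigma> where \<sigma>: "gluing \<sigma>" "exmat S0 = dart_matrix \<sigma>"
    using triangulation_gluing_exists[OF assms(1,4,5) _ assms(7)] assms(9) by metis
  have indep: "algebraically_independent (avar S0)"
    using assms(8) by (simp add: is_seed_def free_generators_def)
  have G: "subgroup G (cluster_modular_group (mutation_class S0))" using assms(10,11) by simp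
  obtain a where a: "a \<in> A_manifold s" "\<And>\<phi>. \<phi> \<in> G \<Longrightarrow> cluster_action \<phi> a = a"
    using A_fixed_point[OF \<sigma> indep G assms(12)] unfolding assms(10) by blast
  have "monomial_point s a \<in> X_manifold s"
    using monomial_point_X_manifold a(1) dart_matrix_skew[of \<sigma>] \<sigma>(2) unfolding assms(10) by metis
  moreover have "cluster_action \<phi> (monomial_point s a) = monomial_point s a" if "\<phi> \<in> G" for \<phi>
    unfolding assms(10)
    by (rule monomial_point_fixed) (use subgroup.subset[OF G] that a(2) in auto)
  ultimately show ?thesis using a by blast
qed

end
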